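(* Let $I$ be a homogeneous ideal of $R=k[x_1,\ldots,x_n]$ such that $A=R/I$ is a (nonzero) standard graded Artinian $k$-algebra. Then $A$ has the strong Lefschetz property if and only if for any $\alpha=(\alpha_1,\ldots,\alpha_{n-1})\in J_{n-1}$, (1) $|\alpha|+f_n(\alpha_1,\ldots,\alpha_{n-1})\ge r_1(A)+1$, and (2) $f_n(\alpha_1,\ldots,\alpha_{n-1})\ge f_n(0,\ldots,0,|\alpha|+1)+1$, where $|\alpha|=\sum_{j=1}^{n-1}\alpha_j$.
   Context: $k$ is a field of characteristic $0$, $R=k[x_1,\ldots,x_n]$ with the standard grading, $n\ge 2$. $\mathrm{gin}(I)$ denotes the generic initial ideal of $I$ with respect to the reverse lexicographic order (with $x_1>\cdots>x_n$): $\mathrm{gin}(I)=\mathrm{in}(gI)$ for $g$ in a nonempty Zariski open subset of $GL_n(k)$. Strong Lefschetz property of $A=R/I$: there is a linear form $L\in R$ such that $\times L^i:A_d\to A_{d+i}$ has maximal rank (is injective or surjective) for each $d\ge 0$ and each $i\ge 1$. First reduction number: $r_1(A)=\min\{t \mid (R/(I+(L)))_{t+1}=0\}$, where $L$ is a general linear form of $R$. Functions $f_i$: $f_1=\min\{t \mid x_1^t\in\mathrm{gin}(I)\}$, and for $2\le i\le n$ and $(\alpha_1,\ldots,\alpha_{i-1})\in\mathbb{Z}_{\ge 0}^{i-1}$, $f_i(\alpha_1,\ldots,\alpha_{i-1})=\min\{t\ge 0 \mid x_1^{\alpha_1}\cdots x_{i-1}^{\alpha_{i-1}}x_i^t\in\mathrm{gin}(I)\}$.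 For $1\le i\le n-1$, $J_i$ is the set of $(\alpha_1,\ldots,\alpha_i)\in\mathbb{Z}_{\ge 0}^i$ such that $0\le\alpha_1<f_1$ and $0\le\alpha_j<f_j(\alpha_1,\ldots,\alpha_{j-1})$ for each $2\le j\le i$. The tuple $(0,\ldots,0,|\alpha|+1)$ lies in $\mathbb{Z}_{\ge 0}^{n-1}$. *)

theory Defs
  imports
    "HOL-Library.Poly_Mapping"
    "HOL-Algebra.QuotRing"
    "Jordan_Normal_Form.Matrix"
begin

text \<open>
  Polynomials are finitely supported functions from exponent vectors to coefficients.  The ring
  \<open>k[x\<^sub>1,\<dots>,x\<^sub>n]\<close> is the subring in which only the indeterminates with index in \<open>{..<n}\<close> occur,
  so \<open>x\<^sub>i\<close> of the mathematical notation has index \<open>i - 1\<close>.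
\<close>

type_synonym ('i, 'k) mpol = "('i \<Rightarrow>\<^sub>0 nat) \<Rightarrow>\<^sub>0 'k"

definition in_vars :: "'i set \<Rightarrow> ('i, 'k::zero) mpol \<Rightarrow> bool" where
  "in_vars V p \<longleftrightarrow> (\<forall>m \<in> Poly_Mapping.keys p. Poly_Mapping.keys m \<subseteq> V)"

definition polyring :: "nat \<Rightarrow> (nat, 'k::comm_ring_1) mpol ring" where
  "polyring n = \<lparr>carrier = {p. in_vars {..<n} p}, monoid.mult = (*), one = 1, zero = 0, add = (+)\<rparr>"

abbreviation coeff_embed :: "'k::zero \<Rightarrow> ('i, 'k) mpol" where
  "coeff_embed c \<equiv> Poly_Mapping.single 0 c"

definition indet :: "'i \<Rightarrow> ('i, 'k::zero_neq_one) mpol" where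
  "indet i = Poly_Mapping.single (Poly_Mapping.single i 1) 1"

definition mon :: "('i \<Rightarrow>\<^sub>0 nat) \<Rightarrow> ('i, 'k::zero_neq_one) mpol" where
  "mon m = Poly_Mapping.single m 1"

text \<open>Evaluation at \<open>v\<close> after applying \<open>\<phi>\<close> to the coefficients.\<close>

definition eval_mpol ::
    "('k::zero \<Rightarrow> 'b::comm_ring_1) \<Rightarrow> ('i \<Rightarrow> 'b) \<Rightarrow> ('i, 'k) mpol \<Rightarrow> 'b" where
  "eval_mpol \<phi> v p =
     (\<Sum>m \<in> Poly_Mapping.keys p. \<phi> (Poly_Mapping.lookup p m) *
        (\<Prod>i \<in> Poly_Mapping.keys m. v i ^ Poly_Mapping.lookup m i))"

definition mdeg :: "('i \<Rightarrow>\<^sub>0 nat) \<Rightarrow> nat" where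
  "mdeg m = (\<Sum>i \<in> Poly_Mapping.keys m. Poly_Mapping.lookup m i)"

definition forms :: "nat \<Rightarrow> nat \<Rightarrow> (nat, 'k::comm_ring_1) mpol set" where
  "forms n d = {p \<in> carrier (polyring n). \<forall>m \<in> Poly_Mapping.keys p. mdeg m = d}"

definition hom_component :: "nat \<Rightarrow> ('i, 'k::comm_monoid_add) mpol \<Rightarrow> ('i, 'k) mpol" where
  "hom_component d p =
     (\<Sum>m \<in> {m \<in> Poly_Mapping.keys p. mdeg m = d}. Poly_Mapping.single m (Poly_Mapping.lookup p m))"

definition homogeneous_ideal :: "nat \<Rightarrow> (nat, 'k::comm_ring_1) mpol set \<Rightarrow> bool" where
  "homogeneous_ideal n I \<longleftrightarrow>
     ideal I (polyring n) \<and> (\<forall>p \<in> I. \<forall>d. hom_component d p \<in> I)"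

definition artinian :: "('a, 'b) ring_scheme \<Rightarrow> bool" where
  "artinian A \<longleftrightarrow>
     (\<forall>J :: nat \<Rightarrow> 'a set. (\<forall>i. ideal (J i) A \<and> J (Suc i) \<subseteq> J i) \<longrightarrow>
        (\<exists>N. \<forall>i \<ge> N. J i = J N))"

text \<open>The degree \<open>d\<close> component of \<open>k[x\<^sub>1,\<dots>,x\<^sub>n]/I\<close>, as a set of cosets.\<close>

definition quot_piece ::
    "nat \<Rightarrow> (nat, 'k::comm_ring_1) mpol set \<Rightarrow> nat \<Rightarrow> (nat, 'k) mpol set set" where
  "quot_piece n I d = (\<lambda>p. I +>\<^bsub>polyring n\<^esub> p) ` forms n d"

definition strong_lefschetz :: "nat \<Rightarrow> (nat, 'k::comm_ring_1) mpol set \<Rightarrow> bool" where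
  "strong_lefschetz n I \<longleftrightarrow>
     (\<exists>L \<in> forms n 1. \<forall>d. \<forall>i \<ge> 1.
        let A = polyring n Quot I;
            mul = (\<lambda>a. (I +>\<^bsub>polyring n\<^esub> L) [^]\<^bsub>A\<^esub> i \<otimes>\<^bsub>A\<^esub> a)
        in inj_on mul (quot_piece n I d) \<or> mul ` quot_piece n I d = quot_piece n I (d + i))"


text \<open>
  The Zariski topology on a set \<open>X\<close> of points, where \<open>c x j\<close> for \<open>j \<in> V\<close> are the affine
  coordinates of the point \<open>x\<close>; open sets are complements of zero loci of sets of polynomials.
\<close>

definition zariski_open ::
    "'i set \<Rightarrow> ('p \<Rightarrow> 'i \<Rightarrow> 'k::comm_ring_1) \<Rightarrow> 'p set \<Rightarrow> 'p set \<Rightarrow> bool" where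
  "zariski_open V c X U \<longleftrightarrow>
     (\<exists>S :: ('i, 'k) mpol set. (\<forall>F \<in> S. in_vars V F) \<and>
        U = {x \<in> X. \<exists>F \<in> S. eval_mpol id (c x) F \<noteq> 0})"

definition holds_generically ::
    "'i set \<Rightarrow> ('p \<Rightarrow> 'i \<Rightarrow> 'k::comm_ring_1) \<Rightarrow> 'p set \<Rightarrow> ('p \<Rightarrow> bool) \<Rightarrow> bool" where
  "holds_generically V c X P \<longleftrightarrow>
     (\<exists>U. zariski_open V c X U \<and> U \<noteq> {} \<and> (\<forall>x \<in> U. P x))"

definition GL :: "nat \<Rightarrow> 'k::field mat set" where
  "GL n = {g \<in> carrier_mat n n. invertible_mat g}"

abbreviation generic_matrix :: "nat \<Rightarrow> ('k::field mat \<Rightarrow> bool) \<Rightarrow> bool" where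
  "generic_matrix n \<equiv> holds_generically ({..<n} \<times> {..<n}) (\<lambda>g ij. g $$ ij) (GL n)"

abbreviation general_linear_form ::
    "nat \<Rightarrow> ((nat, 'k::comm_ring_1) mpol \<Rightarrow> bool) \<Rightarrow> bool" where
  "general_linear_form n \<equiv>
     holds_generically {..<n}
       (\<lambda>L i. Poly_Mapping.lookup L (Poly_Mapping.single i 1)) (forms n 1)"


text \<open>
  Graded reverse lexicographic order with \<open>x\<^sub>1 > \<cdots> > x\<^sub>n\<close>: in equal degrees, \<open>s < t\<close> if at the
  last position where they differ \<open>s\<close> has the larger exponent.
\<close>

definition revlex_less :: "(nat \<Rightarrow>\<^sub>0 nat) \<Rightarrow> (nat \<Rightarrow>\<^sub>0 nat) \<Rightarrow> bool" where
  "revlex_less s t \<longleftrightarrow>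
     mdeg s < mdeg t \<or>
     mdeg s = mdeg t \<and>
       (\<exists>i. Poly_Mapping.lookup s i > Poly_Mapping.lookup t i \<and>
            (\<forall>j > i. Poly_Mapping.lookup s j = Poly_Mapping.lookup t j))"

definition lead_exp :: "(nat, 'k::zero) mpol \<Rightarrow> (nat \<Rightarrow>\<^sub>0 nat)" where
  "lead_exp p =
     (THE m. m \<in> Poly_Mapping.keys p \<and>
        (\<forall>m' \<in> Poly_Mapping.keys p. m' \<noteq> m \<longrightarrow> revlex_less m' m))"

definition initial_ideal ::
    "nat \<Rightarrow> (nat, 'k::comm_ring_1) mpol set \<Rightarrow> (nat, 'k) mpol set" where
  "initial_ideal n I = genideal (polyring n) ((\<lambda>p. mon (lead_exp p)) ` (I - {0}))"

text \<open>A matrix \<open>g\<close> acts by the \<open>k\<close>-algebra map with \<open>x\<^sub>j \<mapsto> \<Sum>\<^sub>i g\<^sub>i\<^sub>j x\<^sub>i\<close>.\<close>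

definition gl_act :: "nat \<Rightarrow> 'k::comm_ring_1 mat \<Rightarrow> (nat, 'k) mpol \<Rightarrow> (nat, 'k) mpol" where
  "gl_act n g = eval_mpol coeff_embed (\<lambda>j. \<Sum>i<n. coeff_embed (g $$ (i, j)) * indet i)"

text \<open>
  The generic value is unique since nonempty Zariski open subsets of \<open>GL\<^sub>n(k)\<close> (respectively of
  the space of linear forms) over an infinite field have nonempty intersections.
\<close>

definition gin :: "nat \<Rightarrow> (nat, 'k::field) mpol set \<Rightarrow> (nat, 'k) mpol set" where
  "gin n I = (THE J. generic_matrix n (\<lambda>g. initial_ideal n (gl_act n g ` I) = J))"

definition reduction_number :: "nat \<Rightarrow> (nat, 'k::field) mpol set \<Rightarrow> nat" where
  "reduction_number n I =
     (THE r. general_linear_form n (\<lambda>L.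
        let K = I <+>\<^bsub>polyring n\<^esub> cgenideal (polyring n) L
        in r = (LEAST t. quot_piece n K (t + 1) = {\<zero>\<^bsub>polyring n Quot K\<^esub>})))"


text \<open>
  A tuple of exponents of \<open>x\<^sub>1,\<dots>,x\<^sub>i\<close> is a list of length \<open>i\<close>; \<open>Poly_Mapping.nth\<close> pads it with
  zeros.  The index of \<open>f\<^sub>i\<close> is determined by its argument: \<open>f\<^sub>i(\<alpha>\<^sub>1,\<dots>,\<alpha>\<^sub>i\<^sub>-\<^sub>1)\<close> is \<open>gin_f\<close> at a list
  of length \<open>i - 1\<close>, and \<open>f\<^sub>1\<close> is its value at the empty list.
\<close>

definition gin_f :: "nat \<Rightarrow> (nat, 'k::field) mpol set \<Rightarrow> nat list \<Rightarrow> nat" where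
  "gin_f n I \<alpha> = (LEAST t. mon (Poly_Mapping.nth (\<alpha> @ [t])) \<in> gin n I)"

definition gin_J :: "nat \<Rightarrow> (nat, 'k::field) mpol set \<Rightarrow> nat \<Rightarrow> nat list set" where
  "gin_J n I i = {\<alpha>. length \<alpha> = i \<and> (\<forall>j < i. \<alpha> ! j < gin_f n I (take j \<alpha>))}"

end

theory Submission
  imports Defs "Jordan_Normal_Form.Determinant" "HOL-Computational_Algebra.Polynomial"
begin

text \<open>
  Write \<open>x\<^sub>1, \<dots>, x\<^sub>n\<close> for the variables (with indices \<open>0, \<dots>, n - 1\<close>), \<open>A = R / I\<close>, and \<open>E\<close> for the set of
  exponents of monomials in \<open>gin I\<close>.  The theorem rests on three facts.

  In the reverse lexicographic order a monomial divisible by \<open>x\<^sub>n\<^sup>i\<close> is smaller than every monomial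
  of the same degree that is not.  Hence passing to initial ideals commutes with adding \<open>x\<^sub>n\<^sup>i\<close> and
  with dividing by it, and the maximal rank property of \<open>x\<^sub>n\<^sup>i\<close> on \<open>R / K\<close> can be read off the
  leading exponents of \<open>K\<close> (\<open>last_power_surjective_iff\<close>, \<open>last_power_injective_iff\<close>).  A change of
  coordinates turns any nonzero linear form into \<open>x\<^sub>n\<close>, and the ranks of multiplication maps are
  largest for generic coordinates.  So \<open>A\<close> has the strong Lefschetz property if and only if
  multiplication by \<open>x\<^sub>n\<^sup>i\<close> on \<open>R / gin I\<close> has maximal rank in all degrees
  (\<open>strong_lefschetz_iff_E\<close>), and \<open>r\<^sub>1(A)\<close> is the largest degree of a monomial in
  \<open>x\<^sub>1, \<dots>, x\<^bsub>n-1\<^esub>\<close> outside \<open>gin I\<close> (\<open>reduction_number_eq\<close>).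

  The monomials outside \<open>gin I\<close> decompose into chains \<open>x\<^sup>\<alpha>, x\<^sup>\<alpha> x\<^sub>n, \<dots>, x\<^sup>\<alpha> x\<^sub>n\<^bsup>f-1\<^esup>\<close> with
  \<open>f = f\<^sub>n(\<alpha>)\<close>, one for every \<open>\<alpha> \<in> J\<^bsub>n-1\<^esub>\<close>, and multiplication by \<open>x\<^sub>n\<close> moves up the chains.  It has
  maximal rank throughout if and only if no chain begins and ends after another one, that is, if
  \<open>|\<alpha>| < |\<beta>|\<close> implies \<open>|\<beta>| + f\<^sub>n(\<beta>) \<le> |\<alpha>| + f\<^sub>n(\<alpha>)\<close> (\<open>maximal_rank_iff_chains\<close>).

  Finally, \<open>gin I\<close> is stable enough that among the chains beginning in degree \<open>m\<close> the one of
  \<open>(0, \<dots>, 0, m)\<close> is the longest: \<open>f\<^sub>n(\<alpha>) \<le> f\<^sub>n(0, \<dots>, 0, |\<alpha>|)\<close> (\<open>E_stable\<close>).  This is where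
  characteristic zero enters, as powers of generic linear forms have to span all forms.  It suffices
  to compare each chain with the longest chain of every higher degree, and for this the comparison
  with the next degree is enough, because it can be iterated along \<open>(0, \<dots>, 0, m)\<close>,
  \<open>(0, \<dots>, 0, m + 1)\<close>, and so on (\<open>interval_comparison\<close>).

  That \<open>gin I\<close> exists is part of the proof.  The number of leading exponents of \<open>g I\<close> in an upward
  closed set of monomials of degree \<open>d\<close> is the rank of a matrix depending polynomially on \<open>g\<close>, so it
  is largest on a nonempty open set.  These numbers determine the leading exponents, and since \<open>I\<close>
  contains all forms of large degree, finitely many of them matter (\<open>generic_leads\<close>).
\<close>

abbreviation lookup where "lookup \<equiv> Poly_Mapping.lookup"
abbreviation keys where "keys \<equiv> Poly_Mapping.keys"
abbreviation single where "single \<equiv> Poly_Mapping.single"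

section \<open>Polynomials as finitely supported functions\<close>

lemma mpol_expand_superset:
  fixes p :: "('i, 'k::comm_monoid_add) mpol"
  assumes "finite S" "keys p \<subseteq> S"
  shows "p = (\<Sum>m\<in>S. single m (lookup p m))"
proof (rule poly_mapping_eqI)
  fix k
  have "lookup (\<Sum>m\<in>S. single m (lookup p m)) k = (\<Sum>m\<in>S. if m = k then lookup p k else 0)"
    unfolding lookup_sum by (rule sum.cong) (auto simp: lookup_single)
  also have "\<dots> = lookup p k"
    using assms by (auto simp: in_keys_iff)
  finally show "lookup p k = lookup (\<Sum>m\<in>S. single m (lookup p m)) k" by simp
qed

lemmas mpol_expand = mpol_expand_superset[OF finite_keys subset_refl]

lemma lookup_single_times:
  fixes p :: "('i, 'k::comm_ring_1) mpol"
  shows "lookup (single s c * p) (s + m) = c * lookup p m"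
proof -
  have "single s c * p = (\<Sum>m\<in>keys p. single (s + m) (c * lookup p m))"
    by (subst mpol_expand[of p]) (simp add: sum_distrib_left mult_single)
  then have "lookup (single s c * p) (s + m) = (\<Sum>k\<in>keys p. if k = m then c * lookup p m else 0)"
    by (simp add: lookup_sum lookup_single when_def eq_commute cong: if_cong)
  also have "\<dots> = c * lookup p m"
    by (auto simp: in_keys_iff)
  finally show ?thesis .
qed

lemma keys_single_times:
  fixes p :: "('i, 'k::comm_ring_1) mpol"
  shows "keys (single s c * p) \<subseteq> (+) s ` keys p"
  using keys_mult[of "single s c" p] by (auto split: if_splits)

lemma lookup_const_times:
  fixes p :: "('i, 'k::comm_ring_1) mpol"
  shows "lookup (coeff_embed c * p) m = c * lookup p m"
  using lookup_single_times[of 0 c p m] by simp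

lemma mon_add: "mon (s + t) = (mon s * mon t :: ('i, 'k::comm_ring_1) mpol)"
  by (simp add: mon_def mult_single)

lemma mon_zero: "mon 0 = (1 :: ('i, 'k::comm_ring_1) mpol)"
  by (simp add: mon_def)

lemma lookup_mon: "lookup (mon s :: ('i, 'k::comm_ring_1) mpol) m = (if m = s then 1 else 0)"
  by (auto simp: mon_def lookup_single)

lemma single_eq_const_mon:
  "single m c = coeff_embed c * (mon m :: ('i, 'k::comm_ring_1) mpol)"
  by (simp add: mon_def mult_single)

lemma keys_mon: "keys (mon m :: ('i, 'k::comm_ring_1) mpol) = {m}"
  by (simp add: mon_def)

lemma keys_exp_add: "keys (m + m' :: 'i \<Rightarrow>\<^sub>0 nat) = keys m \<union> keys m'"
  by (auto simp: in_keys_iff lookup_add)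

lemma mdeg_superset:
  assumes "finite S" "keys m \<subseteq> S"
  shows "mdeg m = (\<Sum>i\<in>S. lookup m i)"
  unfolding mdeg_def using assms by (intro sum.mono_neutral_left) (auto simp: in_keys_iff)

lemma mdeg_add: "mdeg (m + m') = mdeg m + mdeg m'"
proof -
  let ?S = "keys m \<union> keys m'"
  show ?thesis
    by (subst (1 2 3) mdeg_superset[of ?S]) (auto simp: lookup_add sum.distrib keys_exp_add)
qed

lemma mdeg_zero: "mdeg 0 = 0"
  by (simp add: mdeg_def)

lemma mdeg_single: "mdeg (single i k) = k"
  by (simp add: mdeg_def)

subsection \<open>Evaluation\<close>

definition coeff_hom :: "('k::comm_ring_1 \<Rightarrow> 'b::comm_ring_1) \<Rightarrow> bool" where
  "coeff_hom \<phi> \<longleftrightarrow> \<phi> 0 = 0 \<and> \<phi> 1 = 1 \<and> (\<forall>a b. \<phi> (a + b) = \<phi> a + \<phi> b \<and> \<phi> (a * b) = \<phi> a * \<phi> b)"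

lemma coeff_hom_id: "coeff_hom id"
  by (simp add: coeff_hom_def)

lemma coeff_hom_embed: "coeff_hom (coeff_embed :: 'k::comm_ring_1 \<Rightarrow> ('i, 'k) mpol)"
  by (simp add: coeff_hom_def single_add mult_single)

abbreviation monomial_value :: "('i \<Rightarrow> 'b::comm_ring_1) \<Rightarrow> ('i \<Rightarrow>\<^sub>0 nat) \<Rightarrow> 'b" where
  "monomial_value v m \<equiv> \<Prod>i\<in>keys m. v i ^ lookup m i"

lemma monomial_value_superset:
  assumes "finite S" "keys m \<subseteq> S"
  shows "monomial_value v m = (\<Prod>i\<in>S. v i ^ lookup m i)"
  using assms by (intro prod.mono_neutral_left) (auto simp: in_keys_iff)

lemma monomial_value_add:
  "monomial_value v (m + m') = monomial_value v m * monomial_value v m'"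
proof -
  let ?S = "keys m \<union> keys m'"
  show ?thesis
    by (subst (1 2 3) monomial_value_superset[of ?S])
       (auto simp: lookup_add power_add prod.distrib keys_exp_add)
qed

lemma eval_mpol_single:
  assumes "coeff_hom \<phi>"
  shows "eval_mpol \<phi> v (single m c) = \<phi> c * monomial_value v m"
  using assms by (auto simp: eval_mpol_def coeff_hom_def)

lemma eval_mpol_zero: "eval_mpol \<phi> v 0 = 0"
  by (simp add: eval_mpol_def)

lemma eval_mpol_add:
  assumes "coeff_hom \<phi>"
  shows "eval_mpol \<phi> v (p + q) = eval_mpol \<phi> v p + eval_mpol \<phi> v q"
  unfolding eval_mpol_def using assms
  by (intro setsum_keys_plus_distrib[of "\<lambda>m c. \<phi> c * monomial_value v m"])
     (auto simp: coeff_hom_def ring_distribs)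

lemma eval_mpol_sum:
  assumes "coeff_hom \<phi>"
  shows "eval_mpol \<phi> v (sum f S) = (\<Sum>x\<in>S. eval_mpol \<phi> v (f x))"
  by (induction S rule: infinite_finite_induct)
     (auto simp: eval_mpol_zero eval_mpol_add[OF assms])

lemma eval_mpol_mult:
  assumes "coeff_hom \<phi>"
  shows "eval_mpol \<phi> v (p * q) = eval_mpol \<phi> v p * eval_mpol \<phi> v q"
proof -
  have mult: "\<phi> (a * b) = \<phi> a * \<phi> b" for a b using assms by (simp add: coeff_hom_def)
  have "p * q = (\<Sum>m\<in>keys p. \<Sum>m'\<in>keys q. single (m + m') (lookup p m * lookup q m'))"
    by (subst mpol_expand[of p], subst mpol_expand[of q]) (simp add: sum_product mult_single)
  then have "eval_mpol \<phi> v (p * q) = (\<Sum>m\<in>keys p. \<Sum>m'\<in>keys q.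
      \<phi> (lookup p m) * monomial_value v m * (\<phi> (lookup q m') * monomial_value v m'))"
    by (simp only: eval_mpol_sum[OF assms] eval_mpol_single[OF assms] monomial_value_add mult mult_ac)
  also have "\<dots> = eval_mpol \<phi> v p * eval_mpol \<phi> v q"
    unfolding eval_mpol_def sum_product ..
  finally show ?thesis .
qed

lemma eval_mpol_one:
  assumes "coeff_hom \<phi>"
  shows "eval_mpol \<phi> v 1 = 1"
  using eval_mpol_single[OF assms, of v 0 1] assms by (simp add: coeff_hom_def)

lemma eval_mpol_const:
  assumes "coeff_hom \<phi>"
  shows "eval_mpol \<phi> v (coeff_embed c) = \<phi> c"
  using eval_mpol_single[OF assms, of v 0 c] by simp

lemma eval_mpol_indet:
  assumes "coeff_hom \<phi>"
  shows "eval_mpol \<phi> v (indet i) = v i"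
  using eval_mpol_single[OF assms, of v "single i 1" 1] assms by (simp add: indet_def coeff_hom_def)

lemma eval_mpol_power:
  assumes "coeff_hom \<phi>"
  shows "eval_mpol \<phi> v (p ^ e) = eval_mpol \<phi> v p ^ e"
  by (induction e) (simp_all add: eval_mpol_one[OF assms] eval_mpol_mult[OF assms])

lemma eval_mpol_diff:
  assumes "coeff_hom \<phi>"
  shows "eval_mpol \<phi> v (p - q) = eval_mpol \<phi> v p - eval_mpol \<phi> v q"
  using eval_mpol_add[OF assms, of v "p - q" q] by simp

lemma eval_mpol_cong:
  assumes "in_vars V p" "\<And>i. i \<in> V \<Longrightarrow> v i = w i"
  shows "eval_mpol \<phi> v p = eval_mpol \<phi> w p"
  unfolding eval_mpol_def using assms by (intro sum.cong refl arg_cong2[of _ _ _ _ "(*)"] prod.cong)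
    (auto simp: in_vars_def subset_iff)

lemma mon_eq_prod_indet:
  "(mon m :: ('i, 'k::comm_ring_1) mpol) = (\<Prod>i\<in>keys m. indet i ^ lookup m i)"
proof -
  have pow: "(indet i :: ('i, 'k) mpol) ^ e = mon (single i e)" for i e
    by (induction e) (simp_all add: indet_def mon_def mult_single single_add[symmetric])
  have "(\<Prod>i\<in>S. mon (single i (lookup m i)) :: ('i, 'k) mpol) = mon (\<Sum>i\<in>S. single i (lookup m i))"
    if "finite S" for S
    using that by (induction S) (simp_all add: mon_zero mon_add)
  moreover have "(\<Sum>i\<in>keys m. single i (lookup m i)) = m"
  proof (rule poly_mapping_eqI)
    fix k
    have "lookup (\<Sum>i\<in>keys m. single i (lookup m i)) k = (\<Sum>i\<in>keys m. if i = k then lookup m k else 0)"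
      unfolding lookup_sum by (rule sum.cong) (auto simp: lookup_single)
    then show "lookup (\<Sum>i\<in>keys m. single i (lookup m i)) k = lookup m k"
      by (auto simp: in_keys_iff)
  qed
  ultimately show ?thesis by (simp add: pow)
qed

lemma eval_mpol_ident:
  "eval_mpol coeff_embed indet p = (p :: ('i, 'k::comm_ring_1) mpol)"
  by (subst (2) mpol_expand)
     (simp only: eval_mpol_def mon_eq_prod_indet[symmetric] single_eq_const_mon[symmetric])

lemma eval_mpol_comp:
  fixes v :: "'i \<Rightarrow> ('j, 'k::comm_ring_1) mpol" and w :: "'j \<Rightarrow> ('l, 'k) mpol"
  shows "eval_mpol coeff_embed w (eval_mpol coeff_embed v p) =
    eval_mpol coeff_embed (\<lambda>i. eval_mpol coeff_embed w (v i)) p"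
proof -
  note h = coeff_hom_embed
  have "eval_mpol coeff_embed w (prod f S) = (\<Prod>i\<in>S. eval_mpol coeff_embed w (f i))"
    for f :: "'i \<Rightarrow> ('j, 'k) mpol" and S
    by (induction S rule: infinite_finite_induct) (simp_all add: eval_mpol_one[OF h] eval_mpol_mult[OF h])
  then show ?thesis
    unfolding eval_mpol_def[of coeff_embed v p]
    by (simp add: eval_mpol_sum[OF h] eval_mpol_mult[OF h] eval_mpol_const[OF h] eval_mpol_power[OF h])
       (simp add: eval_mpol_def)
qed

subsection \<open>The polynomial ring and its graded pieces\<close>

lemma in_vars_zero: "in_vars V 0" by (simp add: in_vars_def)
lemma in_vars_one: "in_vars V (1 :: ('i, 'k::comm_ring_1) mpol)" by (simp add: in_vars_def)
lemma in_vars_const: "in_vars V (coeff_embed c)" by (simp add: in_vars_def)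
lemma in_vars_indet: "i \<in> V \<Longrightarrow> in_vars V (indet i)" by (auto simp: in_vars_def indet_def)

lemma in_vars_add:
  "in_vars V p \<Longrightarrow> in_vars V q \<Longrightarrow> in_vars V (p + q :: ('i, 'k::comm_ring_1) mpol)"
  using keys_add[of p q] by (auto simp: in_vars_def)

lemma in_vars_uminus: "in_vars V p \<Longrightarrow> in_vars V (- p :: ('i, 'k::comm_ring_1) mpol)"
  by (simp add: in_vars_def in_keys_iff)

lemma in_vars_mult:
  "in_vars V p \<Longrightarrow> in_vars V q \<Longrightarrow> in_vars V (p * q :: ('i, 'k::comm_ring_1) mpol)"
  using keys_mult[of p q] unfolding in_vars_def
  by (fastforce simp: keys_exp_add)

lemma in_vars_sum:
  "(\<And>x. x \<in> S \<Longrightarrow> in_vars V (f x)) \<Longrightarrow> in_vars V (sum f S :: ('i, 'k::comm_ring_1) mpol)"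
  by (induction S rule: infinite_finite_induct) (auto simp: in_vars_zero in_vars_add)

lemma in_vars_power: "in_vars V p \<Longrightarrow> in_vars V (p ^ e :: ('i, 'k::comm_ring_1) mpol)"
  by (induction e) (auto simp: in_vars_one in_vars_mult)

lemma in_vars_prod:
  "(\<And>x. x \<in> S \<Longrightarrow> in_vars V (f x)) \<Longrightarrow> in_vars V (prod f S :: ('i, 'k::comm_ring_1) mpol)"
  by (induction S rule: infinite_finite_induct) (auto simp: in_vars_one in_vars_mult)

lemma in_vars_eval:
  assumes "in_vars V p" "\<And>i. i \<in> V \<Longrightarrow> in_vars W (v i)"
  shows "in_vars W (eval_mpol coeff_embed v p :: ('i, 'k::comm_ring_1) mpol)"
  unfolding eval_mpol_def using assms
  by (intro in_vars_sum in_vars_mult in_vars_const in_vars_prod in_vars_power)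
     (auto simp: in_vars_def subset_iff, blast)

lemma polyring_simps [simp]:
  "carrier (polyring n) = {p. in_vars {..<n} p}"
  "p \<otimes>\<^bsub>polyring n\<^esub> q = p * q" "p \<oplus>\<^bsub>polyring n\<^esub> q = p + q"
  "\<one>\<^bsub>polyring n\<^esub> = 1" "\<zero>\<^bsub>polyring n\<^esub> = 0"
  by (simp_all add: polyring_def)

lemma cring_polyring: "cring (polyring n :: (nat, 'k::comm_ring_1) mpol ring)"
proof (rule cringI)
  show "abelian_group (polyring n :: (nat, 'k) mpol ring)"
  proof (rule abelian_groupI)
    fix x :: "(nat, 'k) mpol" assume "x \<in> carrier (polyring n)"
    then show "\<exists>y\<in>carrier (polyring n). y \<oplus>\<^bsub>polyring n\<^esub> x = \<zero>\<^bsub>polyring n\<^esub>"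
      by (intro bexI[of _ "- x"]) (auto simp: in_vars_uminus)
  qed (auto simp: in_vars_add in_vars_zero algebra_simps)
  show "Group.comm_monoid (polyring n :: (nat, 'k) mpol ring)"
    by (rule comm_monoidI) (auto simp: in_vars_mult in_vars_one algebra_simps)
qed (auto simp: algebra_simps)

lemma polyring_a_inv:
  assumes "in_vars {..<n} p"
  shows "\<ominus>\<^bsub>polyring n\<^esub> p = - (p :: (nat, 'k::comm_ring_1) mpol)"
proof -
  interpret cring "polyring n :: (nat, 'k) mpol ring" by (rule cring_polyring)
  show ?thesis using assms by (intro minus_equality) (auto simp: in_vars_uminus)
qed

definition exps :: "nat \<Rightarrow> nat \<Rightarrow> (nat \<Rightarrow>\<^sub>0 nat) set" where
  "exps n d = {m. keys m \<subseteq> {..<n} \<and> mdeg m = d}"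

lemma forms_iff: "p \<in> forms n d \<longleftrightarrow> keys p \<subseteq> exps n d"
  by (auto simp: forms_def exps_def in_vars_def)

lemma finite_exps: "finite (exps n d)"
proof -
  have "exps n d \<subseteq> Poly_Mapping.nth ` {xs. set xs \<subseteq> {..d} \<and> length xs = n}"
  proof
    fix m assume m: "m \<in> exps n d"
    let ?xs = "map (lookup m) [0..<n]"
    have "lookup m i \<le> d" if "i < n" for i
    proof -
      have "mdeg m = (\<Sum>i<n. lookup m i)"
        using m by (intro mdeg_superset) (auto simp: exps_def)
      then show ?thesis using m that member_le_sum[of i "{..<n}" "lookup m"] by (simp add: exps_def)
    qed
    moreover have "m = Poly_Mapping.nth ?xs"
    proof (rule poly_mapping_eqI)
      fix i
      have "i \<ge> n \<Longrightarrow> lookup m i = 0"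
        using m by (auto simp: exps_def subset_iff in_keys_iff) 
      then show "lookup m i = lookup (Poly_Mapping.nth ?xs) i"
        by (auto simp: nth_default_def)
    qed
    ultimately show "m \<in> Poly_Mapping.nth ` {xs. set xs \<subseteq> {..d} \<and> length xs = n}"
      by (intro image_eqI[of _ _ ?xs]) auto
  qed
  then show ?thesis
    by (rule finite_subset) (intro finite_imageI finite_lists_length_eq finite_atMost)
qed

lemma exps_add: "m \<in> exps n d \<Longrightarrow> m' \<in> exps n e \<Longrightarrow> m + m' \<in> exps n (d + e)"
  by (auto simp: exps_def mdeg_add keys_exp_add)

lemma forms_zero: "0 \<in> forms n d" by (simp add: forms_iff)

lemma forms_add: "p \<in> forms n d \<Longrightarrow> q \<in> forms n d \<Longrightarrow> p + q \<in> forms n d"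
  using keys_add[of p q] by (auto simp: forms_iff)

lemma forms_diff: "p \<in> forms n d \<Longrightarrow> q \<in> forms n d \<Longrightarrow> p - q \<in> forms n d"
  using keys_diff[of p q] by (auto simp: forms_iff)

lemma forms_mult: "p \<in> forms n d \<Longrightarrow> q \<in> forms n e \<Longrightarrow> p * q \<in> forms n (d + e)"
  using keys_mult[of p q] unfolding forms_iff by (blast intro: exps_add)

lemma forms_const: "coeff_embed c \<in> forms n 0"
  by (auto simp: forms_iff exps_def mdeg_zero)

lemma forms_one: "(1 :: (nat, 'k::comm_ring_1) mpol) \<in> forms n 0"
  by (auto simp: forms_iff exps_def mdeg_zero)

lemma forms_scale: "p \<in> forms n d \<Longrightarrow> coeff_embed c * p \<in> forms n d"
  using forms_mult[OF forms_const[of c n]] by fastforce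

lemma forms_sum: "(\<And>x. x \<in> S \<Longrightarrow> f x \<in> forms n d) \<Longrightarrow> sum f S \<in> forms n d"
  by (induction S rule: infinite_finite_induct) (auto simp: forms_zero forms_add)

lemma forms_power: "p \<in> forms n d \<Longrightarrow> p ^ e \<in> forms n (d * e)"
  by (induction e) (auto simp: forms_one dest: forms_mult)

lemma forms_mon: "m \<in> exps n d \<Longrightarrow> mon m \<in> forms n d"
  by (simp add: forms_iff keys_mon)

lemma forms_indet: "i < n \<Longrightarrow> (indet i :: (nat, 'k::comm_ring_1) mpol) \<in> forms n 1"
  by (auto simp: forms_iff indet_def exps_def mdeg_single)

lemma forms_in_vars: "p \<in> forms n d \<Longrightarrow> in_vars {..<n} p"
  by (auto simp: forms_iff in_vars_def exps_def)

lemma forms_prod: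
  "(\<And>x. x \<in> S \<Longrightarrow> f x \<in> forms n (e x)) \<Longrightarrow> finite S \<Longrightarrow> prod f S \<in> forms n (sum e S)"
  by (induction S rule: infinite_finite_induct) (auto simp: forms_one forms_mult)

lemma eval_mpol_forms:
  assumes "p \<in> forms n d" "\<And>i. i < n \<Longrightarrow> v i \<in> forms n 1"
  shows "eval_mpol coeff_embed v p \<in> forms n d"
  unfolding eval_mpol_def
proof (intro forms_sum forms_scale)
  fix m assume "m \<in> keys p"
  then have m: "keys m \<subseteq> {..<n}" "mdeg m = d" using assms by (auto simp: forms_iff exps_def)
  have "monomial_value v m \<in> forms n (\<Sum>i\<in>keys m. 1 * lookup m i)"
    using m assms(2) by (intro forms_prod forms_power) auto
  then show "monomial_value v m \<in> forms n d" using m by (simp add: mdeg_def)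
qed

lemma lookup_hom_component:
  "lookup (hom_component d p) m = (if mdeg m = d then lookup p m else (0::'k::comm_monoid_add))"
proof -
  have "lookup (hom_component d p) m =
    (\<Sum>k\<in>{k \<in> keys p. mdeg k = d}. if k = m then lookup p m else 0)"
    unfolding hom_component_def lookup_sum by (rule sum.cong) (auto simp: lookup_single)
  then show ?thesis by (auto simp: in_keys_iff)
qed

lemma hom_component_forms: "in_vars {..<n} p \<Longrightarrow> hom_component d p \<in> forms n d"
  by (auto simp: forms_iff in_keys_iff exps_def in_vars_def lookup_hom_component split: if_splits)

lemma hom_component_diff:
  "hom_component d (p - q) = hom_component d p - hom_component d (q::('i, 'k::comm_ring_1) mpol)"
  by (rule poly_mapping_eqI) (simp add: lookup_hom_component lookup_minus)

lemma hom_component_of_form: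
  "p \<in> forms n e \<Longrightarrow> hom_component d p = (if d = e then p else 0)"
  by (rule poly_mapping_eqI) (auto simp: lookup_hom_component forms_iff exps_def in_keys_iff subset_iff)

lemma sum_hom_components:
  assumes "finite S" "mdeg ` keys p \<subseteq> S"
  shows "(\<Sum>d\<in>S. hom_component d p) = (p :: ('i, 'k::comm_ring_1) mpol)"
proof (rule poly_mapping_eqI)
  fix m
  have "lookup (\<Sum>d\<in>S. hom_component d p) m = (\<Sum>d\<in>S. if d = mdeg m then lookup p m else 0)"
    unfolding lookup_sum by (rule sum.cong) (auto simp: lookup_hom_component)
  then show "lookup (\<Sum>d\<in>S. hom_component d p) m = lookup p m"
    using assms by (auto simp: in_keys_iff image_subset_iff)
qed

lemma hom_component_mult_form:
  fixes q :: "(nat, 'k::comm_ring_1) mpol"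
  assumes "L \<in> forms n e" "in_vars {..<n} q"
  shows "hom_component (d + e) (L * q) = L * hom_component d q"
proof -
  let ?S = "insert d (mdeg ` keys q)"
  have q: "q = (\<Sum>c\<in>?S. hom_component c q)" by (rule sum_hom_components[symmetric]) auto
  have "hom_component (d + e) (L * q) = (\<Sum>c\<in>?S. hom_component (d + e) (L * hom_component c q))"
    by (subst q, unfold sum_distrib_left)
       (rule poly_mapping_eqI, auto simp: lookup_hom_component lookup_sum)
  also have "\<dots> = (\<Sum>c\<in>?S. if c = d then L * hom_component d q else 0)"
    using hom_component_of_form[OF forms_mult[OF assms(1) hom_component_forms[OF assms(2)]]]
    by (intro sum.cong) auto
  also have "\<dots> = L * hom_component d q" by simp
  finally show ?thesis .
qed

section \<open>Polynomial functions and generic points\<close>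

text \<open>Genericity is handled through polynomial functions rather than polynomials: determinants,
  compositions and restrictions to lines are then immediate, and the two views agree by
  \<open>polyfun_eval_mpol\<close> and \<open>polyfun_imp_mpol\<close>.\<close>

inductive polyfun :: "'i set \<Rightarrow> (('i \<Rightarrow> 'k::comm_ring_1) \<Rightarrow> 'k) \<Rightarrow> bool" for V where
  const: "polyfun V (\<lambda>_. c)"
| var: "i \<in> V \<Longrightarrow> polyfun V (\<lambda>a. a i)"
| add: "polyfun V f \<Longrightarrow> polyfun V g \<Longrightarrow> polyfun V (\<lambda>a. f a + g a)"
| mult: "polyfun V f \<Longrightarrow> polyfun V g \<Longrightarrow> polyfun V (\<lambda>a. f a * g a)"

lemma polyfun_diff:
  assumes "polyfun V f" "polyfun V g"
  shows "polyfun V (\<lambda>a. f a - g a)"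
  using polyfun.add[OF assms(1) polyfun.mult[OF polyfun.const[of V "-1"] assms(2)]] by simp

lemma polyfun_sum:
  "(\<And>x. x \<in> S \<Longrightarrow> polyfun V (f x)) \<Longrightarrow> polyfun V (\<lambda>a. \<Sum>x\<in>S. f x a)"
  by (induction S rule: infinite_finite_induct) (auto intro: polyfun.intros)

lemma polyfun_prod:
  "(\<And>x. x \<in> S \<Longrightarrow> polyfun V (f x)) \<Longrightarrow> polyfun V (\<lambda>a. \<Prod>x\<in>S. f x a)"
  by (induction S rule: infinite_finite_induct) (auto intro: polyfun.intros)

lemma polyfun_power: "polyfun V f \<Longrightarrow> polyfun V (\<lambda>a. f a ^ e)"
  by (induction e) (auto intro: polyfun.intros)

lemma polyfun_eval_mpol:
  assumes "in_vars V F"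
  shows "polyfun V (\<lambda>a. eval_mpol id a F)"
  unfolding eval_mpol_def using assms
  by (intro polyfun_sum polyfun.mult polyfun.const polyfun_prod polyfun_power polyfun.var)
     (auto simp: in_vars_def)

lemma polyfun_imp_mpol:
  assumes "polyfun V f"
  obtains F where "in_vars V F" "\<And>a. eval_mpol id a F = f a"
proof -
  have "\<exists>F. in_vars V F \<and> (\<forall>a. eval_mpol id a F = f a)"
    using assms
  proof induction
    case (const c)
    show ?case
      by (intro exI[of _ "coeff_embed c"] conjI allI in_vars_const)
         (rule trans[OF eval_mpol_const[OF coeff_hom_id]], rule id_apply)
  next
    case (var i)
    then show ?case
      by (intro exI[of _ "indet i"] conjI allI in_vars_indet)
         (simp_all only: eval_mpol_indet[OF coeff_hom_id])
  next
    case (add f g)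
    then obtain F G where "in_vars V F" "in_vars V G"
      "\<And>a. eval_mpol id a F = f a" "\<And>a. eval_mpol id a G = g a" by blast
    then show ?case
      by (intro exI[of _ "F + G"] conjI allI in_vars_add)
         (simp_all only: eval_mpol_add[OF coeff_hom_id])
  next
    case (mult f g)
    then obtain F G where "in_vars V F" "in_vars V G"
      "\<And>a. eval_mpol id a F = f a" "\<And>a. eval_mpol id a G = g a" by blast
    then show ?case
      by (intro exI[of _ "F * G"] conjI allI in_vars_mult)
         (simp_all only: eval_mpol_mult[OF coeff_hom_id])
  qed
  then show ?thesis using that by blast
qed

lemma polyfun_cong:
  "polyfun V f \<Longrightarrow> (\<And>i. i \<in> V \<Longrightarrow> a i = b i) \<Longrightarrow> f a = f b"
  by (induction rule: polyfun.induct) auto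

lemma polyfun_on_line:
  fixes f :: "('i \<Rightarrow> 'k::comm_ring_1) \<Rightarrow> 'k"
  assumes "polyfun V f"
  obtains p where "\<And>t. poly p t = f (\<lambda>i. a i + t * b i)"
proof -
  have "\<exists>p. \<forall>t. poly p t = f (\<lambda>i. a i + t * b i)"
    using assms
  proof induction
    case (const c)
    show ?case by (intro exI[of _ "[:c:]"]) simp
  next
    case (var i)
    show ?case by (intro exI[of _ "[:a i, b i:]"]) simp
  next
    case (add f g)
    then obtain p q where "\<forall>t. poly p t = f (\<lambda>i. a i + t * b i)" "\<forall>t. poly q t = g (\<lambda>i. a i + t * b i)"
      by blast
    then show ?case by (intro exI[of _ "p + q"]) simp
  next
    case (mult f g)
    then obtain p q where "\<forall>t. poly p t = f (\<lambda>i. a i + t * b i)" "\<forall>t. poly q t = g (\<lambda>i. a i + t * b i)"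
      by blast
    then show ?case by (intro exI[of _ "p * q"]) simp
  qed
  then show ?thesis using that by blast
qed

lemma finite_zeros_on_line:
  fixes f :: "('i \<Rightarrow> 'k::field_char_0) \<Rightarrow> 'k"
  assumes "polyfun V f" "f a \<noteq> 0"
  shows "finite {t. f (\<lambda>i. a i + t * b i) = 0}"
proof -
  obtain p where p: "\<And>t. poly p t = f (\<lambda>i. a i + t * b i)"
    using polyfun_on_line[OF assms(1)] by blast
  have "p \<noteq> 0" using p[of 0] assms(2) by auto
  then show ?thesis using poly_roots_finite[of p] by (simp add: p)
qed

text \<open>On the line through \<open>a\<close> and \<open>b\<close> both functions are nonzero univariate polynomials, so they
  vanish at finitely many points only, while the field is infinite.\<close>

lemma polyfun_common_nonzero:
  fixes f g :: "('i \<Rightarrow> 'k::field_char_0) \<Rightarrow> 'k"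
  assumes "polyfun V f" "f a \<noteq> 0" "polyfun V g" "g b \<noteq> 0"
  obtains c where "f c \<noteq> 0" "g c \<noteq> 0"
proof -
  let ?l = "\<lambda>t i. a i + t * (b i - a i)" and ?r = "\<lambda>t i. b i + t * (a i - b i)"
  have "finite {t. f (?l t) = 0}" "finite {t. g (?r t) = 0}"
    using assms by (auto intro: finite_zeros_on_line)
  moreover have "finite {t. g (?l t) = 0}"
  proof -
    have line: "?l t = ?r (1 - t)" for t by (auto simp: algebra_simps)
    have "{t. g (?l t) = 0} = (\<lambda>t. 1 - t) -` {t. g (?r t) = 0}"
      unfolding line by blast
    then show ?thesis
      using finite_vimageI[OF \<open>finite {t. g (?r t) = 0}\<close>, of "\<lambda>t. 1 - t"] by (simp add: inj_def)
  qed
  ultimately have "finite ({t. f (?l t) = 0} \<union> {t. g (?l t) = 0})" by simp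
  then obtain t where "t \<notin> {t. f (?l t) = 0} \<union> {t. g (?l t) = 0}"
    using ex_new_if_finite[OF infinite_UNIV_char_0] by blast
  then show ?thesis using that[of "?l t"] by simp
qed

lemma polyfun_prod_nonzero:
  fixes f :: "'s \<Rightarrow> ('i \<Rightarrow> 'k::field_char_0) \<Rightarrow> 'k"
  assumes "finite S" "\<And>s. s \<in> S \<Longrightarrow> polyfun V (f s)" "\<And>s. s \<in> S \<Longrightarrow> \<exists>a. f s a \<noteq> 0"
  obtains a where "(\<Prod>s\<in>S. f s a) \<noteq> 0"
proof -
  have "\<exists>a. (\<Prod>s\<in>S. f s a) \<noteq> 0"
    using assms
  proof (induction S)
    case (insert s S)
    then obtain a b where ab: "f s a \<noteq> 0" "(\<Prod>s\<in>S. f s b) \<noteq> 0" by fastforce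
    have "polyfun V (f s)" "polyfun V (\<lambda>a. \<Prod>s\<in>S. f s a)"
      using insert.prems(1) by (auto intro: polyfun_prod)
    from polyfun_common_nonzero[OF this(1) ab(1) this(2) ab(2)]
    obtain c where "f s c \<noteq> 0" "(\<Prod>s\<in>S. f s c) \<noteq> 0" by blast
    then show ?case using insert by (intro exI[of _ c]) simp
  qed simp
  then show ?thesis using that by blast
qed

lemma zariski_open_principal:
  assumes "polyfun V f"
  shows "zariski_open V c X {x \<in> X. f (c x) \<noteq> 0}"
proof -
  obtain F where "in_vars V F" "\<And>a. eval_mpol id a F = f a"
    using polyfun_imp_mpol[OF assms] by blast
  then show ?thesis unfolding zariski_open_def by (intro exI[of _ "{F}"]) auto
qed

lemma holds_generically_principal:
  assumes "polyfun V f" "x \<in> X" "f (c x) \<noteq> 0" "\<And>x. x \<in> X \<Longrightarrow> f (c x) \<noteq> 0 \<Longrightarrow> P x"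
  shows "holds_generically V c X P"
  unfolding holds_generically_def
  using zariski_open_principal[OF assms(1), of c X] assms(2-4) by blast

text \<open>Here \<open>X\<close> is itself the nonvanishing locus of \<open>G\<close> in affine space, as in the cases \<open>GL\<^sub>n(k)\<close>,
  with \<open>G\<close> the determinant, and the space of linear forms, with \<open>G = 1\<close>.\<close>

lemma holds_generically_common_point:
  fixes c :: "'p \<Rightarrow> 'i \<Rightarrow> 'k::field_char_0"
  assumes "holds_generically V c X P" "holds_generically V c X Q"
    and G: "polyfun V G" "\<And>x. x \<in> X \<Longrightarrow> G (c x) \<noteq> 0"
      "\<And>a. G a \<noteq> 0 \<Longrightarrow> \<exists>x\<in>X. \<forall>j\<in>V. c x j = a j"
  obtains x where "x \<in> X" "P x" "Q x"
proof -
  have principal: "\<exists>x f. x \<in> X \<and> polyfun V f \<and> f (c x) \<noteq> 0 \<and> (\<forall>y\<in>X. f (c y) \<noteq> 0 \<longrightarrow> P y)"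
    if P: "holds_generically V c X P" for P
  proof -
    obtain U where U: "zariski_open V c X U" "U \<noteq> {}" "\<forall>x\<in>U. P x"
      using P unfolding holds_generically_def by blast
    obtain S where S: "\<forall>F\<in>S. in_vars V F" "U = {x \<in> X. \<exists>F\<in>S. eval_mpol id (c x) F \<noteq> 0}"
      using U(1) unfolding zariski_open_def by blast
    obtain x F where x: "x \<in> X" "F \<in> S" "eval_mpol id (c x) F \<noteq> 0" using S U(2) by blast
    have "polyfun V (\<lambda>a. eval_mpol id a F)" using x(2) S(1) by (blast intro: polyfun_eval_mpol)
    moreover have "\<forall>y\<in>X. eval_mpol id (c y) F \<noteq> 0 \<longrightarrow> P y" using U(3) S(2) x(2) by blast
    ultimately show ?thesis using x by blast
  qed
  obtain x f where f: "x \<in> X" "polyfun V f" "f (c x) \<noteq> 0" "\<forall>y\<in>X. f (c y) \<noteq> 0 \<longrightarrow> P y"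
    using principal[OF assms(1)] by blast
  obtain z g where g: "z \<in> X" "polyfun V g" "g (c z) \<noteq> 0" "\<forall>y\<in>X. g (c y) \<noteq> 0 \<longrightarrow> Q y"
    using principal[OF assms(2)] by blast
  have "polyfun V (\<lambda>a. g a * G a)" "g (c z) * G (c z) \<noteq> 0"
    using polyfun.mult[OF g(2) G(1)] g(1,3) G(2) by auto
  then obtain a where a: "f a \<noteq> 0" "g a * G a \<noteq> 0"
    using polyfun_common_nonzero[of V f "c x" "\<lambda>a. g a * G a" "c z"] f(2,3) by blast
  then obtain y where y: "y \<in> X" "\<forall>j\<in>V. c y j = a j" using G(3) by fastforce
  have "f (c y) = f a" "g (c y) = g a"
    using polyfun_cong[OF f(2)] polyfun_cong[OF g(2)] y(2) by blast+
  then show ?thesis using that y(1) a f(4) g(4) by auto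
qed

lemma generic_value_eq:
  fixes c :: "'p \<Rightarrow> 'i \<Rightarrow> 'k::field_char_0"
  assumes "holds_generically V c X (\<lambda>x. f x = y)"
    and "polyfun V G" "\<And>x. x \<in> X \<Longrightarrow> G (c x) \<noteq> 0"
      "\<And>a. G a \<noteq> 0 \<Longrightarrow> \<exists>x\<in>X. \<forall>j\<in>V. c x j = a j"
  shows "(THE y. holds_generically V c X (\<lambda>x. f x = y)) = y"
  using assms(1)
proof (rule the_equality)
  fix y' assume "holds_generically V c X (\<lambda>x. f x = y')"
  from holds_generically_common_point[OF assms(1) this assms(2-4)]
  obtain x where "f x = y" "f x = y'" by blast
  then show "y' = y" by simp
qed

lemma polyfun_det: "polyfun ({..<n} \<times> {..<n}) (\<lambda>a. det (mat n n a))"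
proof -
  have perm: "p i < n" if "p permutes {0..<n}" "i < n" for p :: "nat \<Rightarrow> nat" and i
    using permutes_in_image[OF that(1), of i] that(2) by simp
  have eq: "(\<lambda>a. det (mat n n a)) =
      (\<lambda>a :: nat \<times> nat \<Rightarrow> 'a. \<Sum>p\<in>{p. p permutes {0..<n}}. signof p * (\<Prod>i=0..<n. a (i, p i)))"
    unfolding det_def using perm by (auto intro!: ext sum.cong prod.cong)
  show ?thesis
    unfolding eq
  proof (intro polyfun_sum polyfun.mult polyfun.const polyfun_prod polyfun.var)
    fix p i assume "p \<in> {p. p permutes {0..<n}}" "i \<in> {0..<n}"
    then show "(i, p i) \<in> {..<n} \<times> {..<n}" using perm by simp
  qed
qed

lemma GL_inverse_mat:
  assumes "g \<in> GL n"
  obtains h where "h \<in> GL n" "g \<in> carrier_mat n n" "h \<in> carrier_mat n n" "g * h = 1\<^sub>m n" "h * g = 1\<^sub>m n"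
proof -
  obtain h where g: "g \<in> carrier_mat n n" and h: "g * h = 1\<^sub>m n" "h * g = 1\<^sub>m (dim_row h)"
    using assms unfolding GL_def invertible_mat_def inverts_mat_def by auto
  have "dim_col h = n" using arg_cong[OF h(1), of dim_col] by simp
  moreover have dr: "dim_row h = n" using arg_cong[OF h(2), of dim_col] g by simp
  ultimately have hc: "h \<in> carrier_mat n n" by auto
  have "h \<in> GL n"
    using hc h g dr unfolding GL_def invertible_mat_def inverts_mat_def by (auto intro!: exI[of _ g])
  then show ?thesis using that g hc h dr by simp
qed

lemma GL_iff_det: "g \<in> GL n \<longleftrightarrow> g \<in> carrier_mat n n \<and> det g \<noteq> 0"
proof
  assume "g \<in> GL n"
  then obtain h where h: "g \<in> carrier_mat n n" "h \<in> carrier_mat n n" "g * h = 1\<^sub>m n"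
    using GL_inverse_mat by metis
  then have "det g * det h = 1" using det_mult[OF h(1,2)] by simp
  then show "g \<in> carrier_mat n n \<and> det g \<noteq> 0" using h(1) by auto
next
  assume "g \<in> carrier_mat n n \<and> det g \<noteq> 0"
  then have g: "g \<in> carrier_mat n n" and d: "det g \<noteq> 0" by auto
  let ?h = "(1 / det g) \<cdot>\<^sub>m adj_mat g"
  have h: "?h \<in> carrier_mat n n" using adj_mat[OF g] by simp
  have one: "(1 / det g) \<cdot>\<^sub>m (det g \<cdot>\<^sub>m 1\<^sub>m n) = 1\<^sub>m n"
    using d by (intro eq_matI) auto
  have "g * ?h = 1\<^sub>m n" "?h * g = 1\<^sub>m n"
    using adj_mat[OF g] g one by (simp_all add: mult_smult_distrib mult_smult_assoc_mat)
  then show "g \<in> GL n"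
    using g h unfolding GL_def invertible_mat_def inverts_mat_def by (auto intro!: exI[of _ ?h])
qed

section \<open>Linear independence is an open condition\<close>

text \<open>The restrictions of the \<open>r\<close> vectors \<open>v 0, \<dots>, v (r - 1)\<close> to the coordinates in \<open>Y\<close> are linearly
  independent.\<close>

definition indep_on :: "'m set \<Rightarrow> nat \<Rightarrow> (nat \<Rightarrow> 'm \<Rightarrow> 'k::field) \<Rightarrow> bool" where
  "indep_on Y r v \<longleftrightarrow> (\<forall>c. (\<forall>y\<in>Y. (\<Sum>i<r. c i * v i y) = 0) \<longrightarrow> (\<forall>i<r. c i = 0))"

lemma indep_onD:
  "indep_on Y r v \<Longrightarrow> (\<And>y. y \<in> Y \<Longrightarrow> (\<Sum>i<r. c i * v i y) = 0) \<Longrightarrow> i < r \<Longrightarrow> c i = 0"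
  unfolding indep_on_def by blast

lemma indep_on_cong:
  assumes "\<And>i y. i < r \<Longrightarrow> y \<in> Y \<Longrightarrow> v i y = w i y"
  shows "indep_on Y r v \<longleftrightarrow> indep_on Y r w"
proof -
  have "(\<Sum>i<r. c i * v i y) = (\<Sum>i<r. c i * w i y)" if "y \<in> Y" for c y
    using assms that by (intro sum.cong) auto
  then show ?thesis unfolding indep_on_def by simp
qed

lemma indep_on_pivot:
  assumes "indep_on Y (Suc r) v"
  obtains y where "y \<in> Y" "v r y \<noteq> 0"
proof (rule ccontr)
  assume "\<not> thesis"
  then have "v r y = 0" if "y \<in> Y" for y using that(1) \<open>\<And>y. y \<in> Y \<Longrightarrow> v r y \<noteq> 0 \<Longrightarrow> thesis\<close> by blast
  then have "(\<Sum>i<Suc r. (if i = r then 1 else 0) * v i y) = 0" if "y \<in> Y" for y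
    using that by simp
  from indep_onD[OF assms this, of r] show False by simp
qed

text \<open>A step of Gaussian elimination with pivot \<open>v r y0\<close>.  It avoids division, so that entries that
  are polynomial functions of a parameter remain so.\<close>

lemma indep_on_eliminate:
  assumes "y0 \<in> Y" "v r y0 \<noteq> 0"
  shows "indep_on Y (Suc r) v \<longleftrightarrow> indep_on (Y - {y0}) r (\<lambda>i y. v r y0 * v i y - v i y0 * v r y)"
    (is "_ \<longleftrightarrow> indep_on _ _ ?w")
proof
  assume L: "indep_on Y (Suc r) v"
  show "indep_on (Y - {y0}) r ?w"
    unfolding indep_on_def
  proof (intro allI impI)
    fix c i assume c: "\<forall>y\<in>Y - {y0}. (\<Sum>i<r. c i * ?w i y) = 0" and i: "i < r"
    define d where "d = (\<lambda>i. if i < r then c i * v r y0 else - (\<Sum>i<r. c i * v i y0))"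
    have "(\<Sum>i<Suc r. d i * v i y) = (\<Sum>i<r. c i * ?w i y)" for y
      by (simp add: d_def right_diff_distrib sum_subtractf sum_distrib_left mult_ac)
    moreover have "(\<Sum>i<r. c i * ?w i y0) = 0" by (simp add: mult_ac)
    ultimately have "(\<Sum>i<Suc r. d i * v i y) = 0" if "y \<in> Y" for y
      using c that by (cases "y = y0") auto
    from indep_onD[OF L this, of i] i have "d i = 0" by simp
    then show "c i = 0" using i assms(2) by (simp add: d_def)
  qed
next
  assume R: "indep_on (Y - {y0}) r ?w"
  show "indep_on Y (Suc r) v"
    unfolding indep_on_def
  proof (intro allI impI)
    fix c i assume c: "\<forall>y\<in>Y. (\<Sum>i<Suc r. c i * v i y) = 0" and i: "i < Suc r"
    have c': "(\<Sum>i<r. c i * v i y) = - (c r * v r y)" if "y \<in> Y" for y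
      using c that by (simp add: add_eq_0_iff)
    have "(\<Sum>i<r. c i * ?w i y) = v r y0 * (\<Sum>i<r. c i * v i y) - (\<Sum>i<r. c i * v i y0) * v r y" for y
      by (simp add: right_diff_distrib sum_subtractf sum_distrib_right sum_distrib_left mult_ac)
    then have "(\<Sum>i<r. c i * ?w i y) = 0" if "y \<in> Y - {y0}" for y
      using c'[of y] c'[of y0] that assms(1) by simp
    from indep_onD[OF R this] have 0: "c i = 0" if "i < r" for i using that by blast
    then have "c r * v r y0 = 0" using c assms(1) by force
    then show "c i = 0" using 0 i assms(2) by (cases "i = r") auto
  qed
qed

lemma indep_on_card_le:
  "finite Y \<Longrightarrow> indep_on Y r v \<Longrightarrow> r \<le> card Y"
proof (induction r arbitrary: Y v)
  case (Suc r)
  obtain y where y: "y \<in> Y" "v r y \<noteq> 0" using indep_on_pivot[OF Suc.prems(2)] .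
  then have "indep_on (Y - {y}) r (\<lambda>i x. v r y * v i x - v i y * v r x)"
    using Suc.prems indep_on_eliminate[of y Y v r] by simp
  then have "r \<le> card (Y - {y})" using Suc by blast
  moreover have "card Y > 0" using y(1) Suc.prems(1) by (auto simp: card_gt_0_iff)
  ultimately show ?case using y(1) by simp
qed simp

text \<open>The product of the pivots that elimination meets at \<open>a0\<close> is the required function: wherever it
  does not vanish, the same elimination succeeds.\<close>

lemma indep_on_open:
  fixes v :: "('i \<Rightarrow> 'k::field) \<Rightarrow> nat \<Rightarrow> 'm \<Rightarrow> 'k"
  assumes "\<And>i y. i < r \<Longrightarrow> y \<in> Y \<Longrightarrow> polyfun V (\<lambda>a. v a i y)" "indep_on Y r (v a0)"
  obtains F where "polyfun V F" "F a0 \<noteq> 0" "\<And>a. F a \<noteq> 0 \<Longrightarrow> indep_on Y r (v a)"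
proof -
  have "\<exists>F. polyfun V F \<and> F a0 \<noteq> 0 \<and> (\<forall>a. F a \<noteq> 0 \<longrightarrow> indep_on Y r (v a))"
    using assms
  proof (induction r arbitrary: Y v)
    case 0
    show ?case
      by (rule exI[of _ "\<lambda>_. 1"]) (auto simp: indep_on_def intro: polyfun.const)
  next
    case (Suc r)
    obtain y where y: "y \<in> Y" "v a0 r y \<noteq> 0" using indep_on_pivot[OF Suc.prems(2)] .
    let ?w = "\<lambda>a i x. v a r y * v a i x - v a i y * v a r x"
    have "indep_on (Y - {y}) r (?w a0)"
      using y Suc.prems(2) indep_on_eliminate[of y Y "v a0" r] by simp
    moreover have "polyfun V (\<lambda>a. ?w a i x)" if "i < r" "x \<in> Y - {y}" for i x
      using that y(1) by (intro polyfun_diff polyfun.mult Suc.prems(1)) auto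
    ultimately obtain F where F: "polyfun V F" "F a0 \<noteq> 0"
      "\<And>a. F a \<noteq> 0 \<Longrightarrow> indep_on (Y - {y}) r (?w a)"
      using Suc.IH[of "Y - {y}" ?w] by blast
    have "polyfun V (\<lambda>a. F a * v a r y)"
      using y(1) by (intro polyfun.mult F Suc.prems(1)) auto
    moreover have "indep_on Y (Suc r) (v a)" if "F a * v a r y \<noteq> 0" for a
      using that F(3)[of a] indep_on_eliminate[OF y(1), of "v a" r] by simp
    ultimately show ?case using F(2) y(2) by (intro exI[of _ "\<lambda>a. F a * v a r y"]) auto
  qed
  then show ?thesis using that by blast
qed

section \<open>Extracting the coefficients of a polynomial curve\<close>

definition subspace :: "('i, 'k::comm_ring_1) mpol set \<Rightarrow> bool" where
  "subspace W \<longleftrightarrow> 0 \<in> W \<and> (\<forall>p\<in>W. \<forall>q\<in>W. p + q \<in> W) \<and> (\<forall>c. \<forall>p\<in>W. coeff_embed c * p \<in> W)"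

lemma subspace_linear_congruence:
  fixes S T K :: "('i, 'k::comm_ring_1) mpol set"
  assumes "subspace S" "subspace T" "subspace K"
  shows "subspace {h \<in> S. \<exists>r\<in>T. h * f - g * r \<in> K}" (is "subspace ?W")
  unfolding subspace_def
proof (intro conjI ballI allI)
  show "0 \<in> ?W" using assms unfolding subspace_def by force
next
  fix p q assume "p \<in> ?W" "q \<in> ?W"
  then obtain r s where *: "p \<in> S" "r \<in> T" "p * f - g * r \<in> K" "q \<in> S" "s \<in> T" "q * f - g * s \<in> K"
    by blast
  have "(p + q) * f - g * (r + s) = (p * f - g * r) + (q * f - g * s)" by (simp add: algebra_simps)
  then have "(p + q) * f - g * (r + s) \<in> K" using *(3,6) assms(3) by (simp only: subspace_def)
  then show "p + q \<in> ?W" using * assms unfolding subspace_def by blast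
next
  fix c p assume "p \<in> ?W"
  then obtain r where *: "p \<in> S" "r \<in> T" "p * f - g * r \<in> K" by blast
  have "(coeff_embed c * p) * f - g * (coeff_embed c * r) = coeff_embed c * (p * f - g * r)"
    by (simp add: algebra_simps)
  then have "(coeff_embed c * p) * f - g * (coeff_embed c * r) \<in> K"
    using *(3) assms(3) by (simp only: subspace_def)
  then show "coeff_embed c * p \<in> ?W" using * assms unfolding subspace_def by blast
qed

lemma subspace_sum: "subspace W \<Longrightarrow> (\<And>x. x \<in> S \<Longrightarrow> f x \<in> W) \<Longrightarrow> sum f S \<in> W"
  by (induction S rule: infinite_finite_induct) (auto simp: subspace_def)

text \<open>The functional \<open>p \<mapsto> \<Sum>\<^sub>t l(t) p(t)\<close> computes the coefficient of \<open>X\<^sup>j\<close> of a polynomial of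
  degree at most \<open>m\<close>: by interpolation \<open>p = \<Sum>\<^sub>t p(t) L\<^sub>t\<close> with the Lagrange polynomials \<open>L\<^sub>t\<close>, and \<open>l(t)\<close>
  is the coefficient of \<open>X\<^sup>j\<close> in \<open>L\<^sub>t\<close>.\<close>

lemma lagrange_functional:
  fixes T :: "'k::field set"
  assumes "card T = Suc m"
  obtains l where "\<And>k. k \<le> m \<Longrightarrow> (\<Sum>t\<in>T. l t * t ^ k) = (if k = j then 1 else 0)"
proof
  have fin: "finite T" using assms card.infinite by force
  define L where "L = (\<lambda>t. \<Prod>s\<in>T - {t}. smult (1 / (t - s)) [:- s, 1:])"
  have deg: "degree (L t) \<le> m" if "t \<in> T" for t
  proof -
    have "degree (L t) \<le> (\<Sum>s\<in>T - {t}. 1)"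
      unfolding L_def using fin by (intro order.trans[OF degree_prod_sum_le] sum_mono) auto
    then show ?thesis using that fin assms by simp
  qed
  have val: "poly (L t) s = (if s = t then 1 else 0)" if "t \<in> T" "s \<in> T" for s t
  proof -
    have "poly (L t) s = (\<Prod>x\<in>T - {t}. (s - x) / (t - x))"
      by (simp add: L_def poly_prod diff_divide_distrib)
    then show ?thesis using that fin by (auto intro!: prod.neutral)
  qed
  show "(\<Sum>t\<in>T. coeff (L t) j * t ^ k) = (if k = j then 1 else 0)" if "k \<le> m" for k
  proof -
    have "monom 1 k = (\<Sum>t\<in>T. smult (t ^ k) (L t))"
    proof (rule poly_eqI_degree)
      show "poly (monom 1 k) s = poly (\<Sum>t\<in>T. smult (t ^ k) (L t)) s" if "s \<in> T" for s
      proof -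
        have "poly (\<Sum>t\<in>T. smult (t ^ k) (L t)) s = (\<Sum>t\<in>T. if s = t then s ^ k else 0)"
          unfolding poly_sum using that by (intro sum.cong) (auto simp: val)
        then show ?thesis using that fin by (simp add: poly_monom)
      qed
      show "degree (monom 1 k :: 'k poly) < card T" using that assms by (simp add: degree_monom_eq)
      have "degree (\<Sum>t\<in>T. smult (t ^ k) (L t)) \<le> m"
        by (intro degree_sum_le fin order.trans[OF degree_smult_le] deg)
      then show "degree (\<Sum>t\<in>T. smult (t ^ k) (L t)) < card T" using assms by simp
    qed
    from arg_cong[OF this, of "\<lambda>p. coeff p j"] show ?thesis
      by (simp add: coeff_sum mult_ac eq_commute)
  qed
qed

lemma subspace_coefficients:
  fixes v :: "nat \<Rightarrow> ('i, 'k::field) mpol"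
  assumes W: "subspace W" and T: "infinite T"
    and curve: "\<And>t. t \<in> T \<Longrightarrow> (\<Sum>k\<le>m. coeff_embed (t ^ k) * v k) \<in> W" and j: "j \<le> m"
  shows "v j \<in> W"
proof -
  obtain T' where T': "T' \<subseteq> T" "card T' = Suc m"
    using infinite_arbitrarily_large[OF T] by blast
  obtain l where l: "\<And>k. k \<le> m \<Longrightarrow> (\<Sum>t\<in>T'. l t * t ^ k) = (if k = j then 1 else 0)"
    using lagrange_functional[OF T'(2)] by blast
  have "(\<Sum>t\<in>T'. coeff_embed (l t) * (\<Sum>k\<le>m. coeff_embed (t ^ k) * v k)) \<in> W"
    using W T' curve by (intro subspace_sum) (auto simp: subspace_def)
  also have "(\<Sum>t\<in>T'. coeff_embed (l t) * (\<Sum>k\<le>m. coeff_embed (t ^ k) * v k)) =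
      (\<Sum>k\<le>m. \<Sum>t\<in>T'. coeff_embed (l t * t ^ k) * v k)"
    by (simp add: sum_distrib_left mult.assoc[symmetric] mult_single) (rule sum.swap)
  also have "\<dots> = (\<Sum>k\<le>m. coeff_embed (\<Sum>t\<in>T'. l t * t ^ k) * v k)"
  proof -
    have "coeff_embed (sum f S) = (\<Sum>t\<in>S. coeff_embed (f t) :: ('i, 'k) mpol)" for f :: "'k \<Rightarrow> 'k" and S
      by (induction S rule: infinite_finite_induct) (auto simp: single_add)
    then show ?thesis by (simp add: sum_distrib_right)
  qed
  also have "\<dots> = (\<Sum>k\<le>m. if k = j then v j else 0)"
    by (intro sum.cong) (auto simp: l)
  also have "\<dots> = v j" using j by simp
  finally show ?thesis .
qed

section \<open>The reverse lexicographic order and leading exponents\<close>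

lemma revlex_less_irrefl: "\<not> revlex_less s s"
  by (simp add: revlex_less_def)

lemma revlex_less_trans:
  assumes "revlex_less s t" "revlex_less t u"
  shows "revlex_less s u"
proof (cases "mdeg s = mdeg t \<and> mdeg t = mdeg u")
  case True
  then obtain i j where
    i: "lookup s i > lookup t i" "\<forall>k>i. lookup s k = lookup t k" and
    j: "lookup t j > lookup u j" "\<forall>k>j. lookup t k = lookup u k"
    using assms unfolding revlex_less_def by auto
  have "lookup s (max i j) > lookup u (max i j) \<and> (\<forall>k>max i j. lookup s k = lookup u k)"
    using i j by (cases i j rule: linorder_cases) (auto simp: max_def)
  then show ?thesis unfolding revlex_less_def using True by auto
qed (use assms in \<open>auto simp: revlex_less_def\<close>)

lemma revlex_less_total:
  assumes "s \<noteq> t"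
  shows "revlex_less s t \<or> revlex_less t s"
proof (cases "mdeg s = mdeg t")
  case True
  let ?D = "{i. lookup s i \<noteq> lookup t i}"
  have "?D \<subseteq> keys s \<union> keys t" by (auto simp: in_keys_iff)
  then have fin: "finite ?D" by (rule finite_subset) simp
  have "?D \<noteq> {}" using assms by (auto intro: poly_mapping_eqI)
  then have "Max ?D \<in> ?D" using fin by (rule Max_in[rotated])
  moreover have "\<forall>k>Max ?D. lookup s k = lookup t k"
    using Max_ge[OF fin] by (metis (mono_tags, lifting) leD mem_Collect_eq)
  ultimately have "\<exists>i. lookup s i \<noteq> lookup t i \<and> (\<forall>k>i. lookup s k = lookup t k)" by blast
  then show ?thesis unfolding revlex_less_def using True
    by (metis linorder_neq_iff)
qed (auto simp: revlex_less_def)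

lemma revlex_less_add_left: "revlex_less s t \<Longrightarrow> revlex_less (u + s) (u + t)"
  by (auto simp: revlex_less_def mdeg_add lookup_add)

lemma revlex_max_exists:
  assumes "finite A" "A \<noteq> {}"
  obtains m where "m \<in> A" "\<And>m'. m' \<in> A \<Longrightarrow> m' \<noteq> m \<Longrightarrow> revlex_less m' m"
proof -
  have "\<exists>m\<in>A. \<forall>m'\<in>A. m' \<noteq> m \<longrightarrow> revlex_less m' m"
    using assms
  proof (induction rule: finite_ne_induct)
    case (insert x A)
    then obtain m where "m \<in> A" "\<forall>m'\<in>A. m' \<noteq> m \<longrightarrow> revlex_less m' m" by blast
    then show ?case using revlex_less_total[of x m] revlex_less_trans by (metis insert_iff)
  qed simp
  then show ?thesis using that by blast
qed

lemma lead_exp_eqI: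
  assumes "m \<in> keys p" "\<And>m'. m' \<in> keys p \<Longrightarrow> m' \<noteq> m \<Longrightarrow> revlex_less m' m"
  shows "lead_exp p = m"
  unfolding lead_exp_def
proof (rule the_equality)
  fix m' assume m': "m' \<in> keys p \<and> (\<forall>k\<in>keys p. k \<noteq> m' \<longrightarrow> revlex_less k m')"
  show "m' = m"
  proof (rule ccontr)
    assume "m' \<noteq> m"
    then have "revlex_less m m'" "revlex_less m' m" using m' assms by auto
    then show False using revlex_less_trans revlex_less_irrefl by blast
  qed
qed (use assms in blast)

lemma lead_exp_props:
  assumes "p \<noteq> 0"
  shows "lead_exp p \<in> keys p" "\<And>m. m \<in> keys p \<Longrightarrow> m \<noteq> lead_exp p \<Longrightarrow> revlex_less m (lead_exp p)"
proof -
  have "keys p \<noteq> {}" using assms by (auto intro: poly_mapping_eqI simp: in_keys_iff)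
  then obtain m where m: "m \<in> keys p" "\<And>m'. m' \<in> keys p \<Longrightarrow> m' \<noteq> m \<Longrightarrow> revlex_less m' m"
    using revlex_max_exists[OF finite_keys] by metis
  then have "lead_exp p = m" by (rule lead_exp_eqI)
  then show "lead_exp p \<in> keys p" "\<And>m. m \<in> keys p \<Longrightarrow> m \<noteq> lead_exp p \<Longrightarrow> revlex_less m (lead_exp p)"
    using m by auto
qed

lemma lookup_lead_exp: "p \<noteq> 0 \<Longrightarrow> lookup p (lead_exp p) \<noteq> 0"
  using lead_exp_props(1) by (auto simp: in_keys_iff)

lemma lead_exp_mon_mult:
  fixes p :: "(nat, 'k::comm_ring_1) mpol"
  assumes "p \<noteq> 0"
  shows "lead_exp (mon s * p) = s + lead_exp p" "mon s * p \<noteq> 0"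
proof -
  have lk: "lookup (mon s * p) (s + m) = lookup p m" for m
    by (simp add: mon_def lookup_single_times)
  have sub: "keys (mon s * p) \<subseteq> (+) s ` keys p"
    unfolding mon_def by (rule keys_single_times)
  show "lead_exp (mon s * p) = s + lead_exp p"
  proof (rule lead_exp_eqI)
    show "s + lead_exp p \<in> keys (mon s * p)"
      using lookup_lead_exp[OF assms] by (simp add: in_keys_iff lk)
    show "revlex_less m' (s + lead_exp p)" if "m' \<in> keys (mon s * p)" "m' \<noteq> s + lead_exp p" for m'
      using that sub lead_exp_props(2)[OF assms] by (auto intro: revlex_less_add_left)
  qed
  show "mon s * p \<noteq> 0"
    using lookup_lead_exp[OF assms] lk by (metis lookup_zero)
qed

definition leads :: "(nat, 'k::zero) mpol set \<Rightarrow> (nat \<Rightarrow>\<^sub>0 nat) set" where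
  "leads W = lead_exp ` (W - {0})"

lemma leadsE:
  assumes "m \<in> leads W"
  obtains p where "p \<in> W" "p \<noteq> 0" "lead_exp p = m"
  using assms by (auto simp: leads_def)

lemma leadsI: "p \<in> W \<Longrightarrow> p \<noteq> 0 \<Longrightarrow> lead_exp p \<in> leads W"
  by (auto simp: leads_def)

text \<open>For an upward closed set \<open>Y\<close> the number of leading exponents of a space of forms in \<open>Y\<close> is the
  rank of its projection to the coordinates in \<open>Y\<close> (\<open>indep_le_card_leads\<close>, \<open>leads_imp_indep\<close>); for
  other sets it is not in general.\<close>

definition revlex_upset :: "nat \<Rightarrow> nat \<Rightarrow> (nat \<Rightarrow>\<^sub>0 nat) set \<Rightarrow> bool" where
  "revlex_upset n d Y \<longleftrightarrow> Y \<subseteq> exps n d \<and> (\<forall>y\<in>Y. \<forall>z\<in>exps n d. revlex_less y z \<longrightarrow> z \<in> Y)"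

lemma revlex_upset_finite: "revlex_upset n d Y \<Longrightarrow> finite Y"
  unfolding revlex_upset_def using finite_exps finite_subset by blast

lemma revlex_upset_all: "revlex_upset n d (exps n d)"
  by (simp add: revlex_upset_def)

text \<open>This is the property of the reverse lexicographic order that ties it to multiplication by the
  last variable.\<close>

lemma revlex_upset_last_exponent:
  assumes "n \<ge> 1"
  shows "revlex_upset n d {w \<in> exps n d. lookup w (n - 1) < i}"
proof -
  have "lookup z (n - 1) \<le> lookup y (n - 1)"
    if yz: "y \<in> exps n d" "z \<in> exps n d" "revlex_less y z" for y z
  proof -
    obtain j where j: "lookup y j > lookup z j" "\<forall>k>j. lookup y k = lookup z k"
      using yz by (auto simp: revlex_less_def exps_def)
    have "j \<in> keys y" using j by (auto simp: in_keys_iff)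
    then have "j < n" using yz by (auto simp: exps_def)
    then have "j = n - 1 \<or> j < n - 1" by auto
    then show ?thesis using j by auto
  qed
  then show ?thesis unfolding revlex_upset_def by fastforce
qed

text \<open>The division algorithm: the exponents in \<open>X\<close> are removed from \<open>p\<close> from the largest downwards, and
  subtracting a multiple of an element with leading exponent \<open>u\<close> affects only \<open>u\<close> and smaller
  exponents.\<close>

lemma subspace_reduce:
  fixes W :: "(nat, 'k::field) mpol set"
  assumes W: "subspace W"
  shows "finite X \<Longrightarrow> X \<subseteq> leads W \<Longrightarrow>
    \<exists>w\<in>W. (\<forall>x\<in>X. lookup (p - w) x = 0) \<and> (\<forall>m\<in>keys w. \<exists>x\<in>X. m = x \<or> revlex_less m x)"
proof (induction X arbitrary: p rule: finite_psubset_induct)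
  case (psubset X)
  show ?case
  proof (cases "X = {}")
    case True
    then show ?thesis using W by (intro bexI[of _ 0]) (auto simp: subspace_def)
  next
    case False
    obtain u where u: "u \<in> X" "\<And>x. x \<in> X \<Longrightarrow> x \<noteq> u \<Longrightarrow> revlex_less x u"
      using revlex_max_exists[OF psubset.hyps False] by metis
    obtain f where f: "f \<in> W" "f \<noteq> 0" "lead_exp f = u"
      using u(1) psubset.prems by (meson leadsE subsetD)
    define g where "g = coeff_embed (lookup p u / lookup f u) * f"
    have g: "g \<in> W" using W f(1) by (auto simp: subspace_def g_def)
    have gu: "lookup g u = lookup p u"
      using lookup_lead_exp[OF f(2)] f(3) by (simp add: g_def lookup_const_times)
    have gk: "m = u \<or> revlex_less m u" if "m \<in> keys g" for m
      using that lead_exp_props(2)[OF f(2), of m] f(3)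
      by (auto simp: g_def in_keys_iff lookup_const_times)
    obtain w where w: "w \<in> W" "\<forall>x\<in>X - {u}. lookup (p - g - w) x = 0"
      "\<forall>m\<in>keys w. \<exists>x\<in>X - {u}. m = x \<or> revlex_less m x"
      using psubset.IH[of "X - {u}" "p - g"] u(1) psubset.prems by blast
    have wu: "\<forall>m\<in>keys w. revlex_less m u"
      using w(3) u(2) revlex_less_trans by (metis Diff_iff singletonI)
    then have "u \<notin> keys w" using revlex_less_irrefl by blast
    then have "lookup w u = 0" by (simp add: in_keys_iff)
    then have "lookup (p - (g + w)) x = 0" if "x \<in> X" for x
      using w(2) gu that by (cases "x = u") (auto simp: lookup_minus lookup_add algebra_simps)
    moreover have "\<forall>m\<in>keys (g + w). \<exists>x\<in>X. m = x \<or> revlex_less m x"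
      using keys_add[of g w] gk wu u(1) by blast
    moreover have "g + w \<in> W" using W g w(1) by (simp add: subspace_def)
    ultimately show ?thesis by blast
  qed
qed

lemma forms_subset_iff_leads:
  fixes W :: "(nat, 'k::field) mpol set"
  assumes "subspace W" "W \<subseteq> forms n d"
  shows "forms n d \<subseteq> W \<longleftrightarrow> exps n d \<subseteq> leads W"
proof
  assume L: "forms n d \<subseteq> W"
  show "exps n d \<subseteq> leads W"
  proof
    fix m assume "m \<in> exps n d"
    then have "(mon m :: (nat, 'k) mpol) \<in> W" using L forms_mon by blast
    moreover have "(mon m :: (nat, 'k) mpol) \<noteq> 0" using keys_mon by (metis insert_not_empty keys_zero)
    moreover have "lead_exp (mon m :: (nat, 'k) mpol) = m" by (intro lead_exp_eqI) (auto simp: keys_mon)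
    ultimately show "m \<in> leads W" by (metis leadsI)
  qed
next
  assume R: "exps n d \<subseteq> leads W"
  show "forms n d \<subseteq> W"
  proof
    fix p :: "(nat, 'k) mpol" assume p: "p \<in> forms n d"
    obtain w where w: "w \<in> W" "\<forall>x\<in>exps n d. lookup (p - w) x = 0"
      using subspace_reduce[OF assms(1) finite_exps R] by blast
    have "p - w \<in> forms n d" using p w(1) assms(2) by (auto intro: forms_diff)
    then have "p - w = 0"
      using w(2) by (intro poly_mapping_eqI) (auto simp: forms_iff in_keys_iff subset_iff)
    then show "p \<in> W" using w(1) by simp
  qed
qed

text \<open>A combination \<open>w\<close> of the \<open>q i\<close> that vanishes at all leading exponents in \<open>Y\<close> vanishes on \<open>Y\<close>:
  otherwise its leading exponent would lie in \<open>Y\<close> as well.  So the \<open>q i\<close> are still independent after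
  restriction to these exponents.\<close>

lemma indep_le_card_leads:
  fixes W :: "(nat, 'k::field) mpol set"
  assumes W: "subspace W" "W \<subseteq> forms n d" and Y: "revlex_upset n d Y"
    and q: "\<And>i. i < r \<Longrightarrow> q i \<in> W" and ind: "indep_on Y r (\<lambda>i. lookup (q i))"
  shows "r \<le> card (leads W \<inter> Y)"
proof -
  have "indep_on (leads W \<inter> Y) r (\<lambda>i. lookup (q i))"
    unfolding indep_on_def
  proof (rule allI, rule impI)
    fix c assume c: "\<forall>y\<in>leads W \<inter> Y. (\<Sum>i<r. c i * lookup (q i) y) = 0"
    define w where "w = (\<Sum>i<r. coeff_embed (c i) * q i)"
    have lw: "lookup w y = (\<Sum>i<r. c i * lookup (q i) y)" for y
      by (simp add: w_def lookup_sum lookup_const_times)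
    have w: "w \<in> W"
      unfolding w_def using W(1) q by (intro subspace_sum) (auto simp: subspace_def)
    have "lookup w y = 0" if y: "y \<in> Y" for y
    proof (rule ccontr)
      assume nz: "lookup w y \<noteq> 0"
      then have w0: "w \<noteq> 0" by auto
      have "lead_exp w \<in> exps n d"
        using lead_exp_props(1)[OF w0] w W(2) forms_iff by blast
      moreover have "lead_exp w = y \<or> revlex_less y (lead_exp w)"
        using lead_exp_props(2)[OF w0, of y] nz by (auto simp: in_keys_iff)
      ultimately have "lead_exp w \<in> Y" using Y y unfolding revlex_upset_def by blast
      then show False using c leadsI[OF w w0] lookup_lead_exp[OF w0] lw by auto
    qed
    then show "\<forall>i<r. c i = 0" using indep_onD[OF ind, of c] lw by auto
  qed
  then show ?thesis using indep_on_card_le revlex_upset_finite[OF Y] by blast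
qed

text \<open>Elements with different leading exponents have coordinates in triangular form.\<close>

lemma leads_imp_indep:
  fixes W :: "(nat, 'k::field) mpol set"
  assumes "finite S" "S \<subseteq> leads W" "S \<subseteq> Y"
  obtains q where "\<And>i. i < card S \<Longrightarrow> q i \<in> W" "indep_on Y (card S) (\<lambda>i. lookup (q i))"
proof -
  obtain e where e: "bij_betw e {..<card S} S"
    using ex_bij_betw_nat_finite[OF assms(1)] by (auto simp: atLeast0LessThan)
  have eS: "e i \<in> S" if "i < card S" for i using e that by (auto simp: bij_betw_def)
  have "\<forall>i. \<exists>p. i < card S \<longrightarrow> p \<in> W \<and> p \<noteq> 0 \<and> lead_exp p = e i"
    using eS assms(2) by (meson leadsE subsetD)
  then obtain q where q: "\<And>i. i < card S \<Longrightarrow> q i \<in> W \<and> q i \<noteq> 0 \<and> lead_exp (q i) = e i"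
    by metis
  have "indep_on Y (card S) (\<lambda>i. lookup (q i))"
    unfolding indep_on_def
  proof (intro allI impI, rule ccontr)
    fix c i assume c: "\<forall>y\<in>Y. (\<Sum>i<card S. c i * lookup (q i) y) = 0"
      and i: "i < card S" "c i \<noteq> 0"
    let ?A = "e ` {i. i < card S \<and> c i \<noteq> 0}"
    obtain m where m: "m \<in> ?A" "\<And>m'. m' \<in> ?A \<Longrightarrow> m' \<noteq> m \<Longrightarrow> revlex_less m' m"
    proof (rule revlex_max_exists)
      show "finite ?A" by simp
      show "?A \<noteq> {}" using i by blast
    qed blast
    then obtain j where j: "j < card S" "c j \<noteq> 0" "m = e j" by blast
    have "c k * lookup (q k) m = 0" if k: "k < card S" "k \<noteq> j" for k
    proof (cases "c k = 0")
      case False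
      have "e k \<noteq> m" using k j e by (auto simp: bij_betw_def inj_on_def)
      then have less: "revlex_less (e k) m" using m(2) k False by blast
      have "m \<notin> keys (q k)"
      proof
        assume "m \<in> keys (q k)"
        then have "revlex_less m (e k)"
          using lead_exp_props(2)[of "q k" m] q[OF k(1)] \<open>e k \<noteq> m\<close> by auto
        then show False using less revlex_less_trans revlex_less_irrefl by blast
      qed
      then show ?thesis by (simp add: in_keys_iff)
    qed simp
    then have "(\<Sum>k<card S. c k * lookup (q k) m) = (\<Sum>k<card S. if k = j then c j * lookup (q j) m else 0)"
      by (intro sum.cong) auto
    also have "\<dots> = c j * lookup (q j) m" using j by simp
    also have "\<dots> \<noteq> 0" using j lookup_lead_exp[of "q j"] q[of j] by auto
    finally show False using c m(1) j eS assms(3) by auto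
  qed
  then show ?thesis using that q by blast
qed

section \<open>Homogeneous ideals and their leading exponents\<close>

lemma polyring_idealI:
  fixes J :: "(nat, 'k::comm_ring_1) mpol set"
  assumes "J \<subseteq> {p. in_vars {..<n} p}" "0 \<in> J" "\<And>p q. p \<in> J \<Longrightarrow> q \<in> J \<Longrightarrow> p + q \<in> J"
    and mult: "\<And>p q. in_vars {..<n} p \<Longrightarrow> q \<in> J \<Longrightarrow> p * q \<in> J"
  shows "ideal J (polyring n)"
proof -
  interpret cring "polyring n :: (nat, 'k) mpol ring" by (rule cring_polyring)
  have neg: "- p \<in> J" if "p \<in> J" for p
    using mult[of "-1" p] that by (simp add: in_vars_uminus in_vars_one)
  show ?thesis
  proof (rule idealI)
    show "subgroup J (add_monoid (polyring n))"
    proof (rule subgroup.intro)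
      show "inv\<^bsub>add_monoid (polyring n)\<^esub> x \<in> J" if "x \<in> J" for x
      proof -
        have "inv\<^bsub>add_monoid (polyring n)\<^esub> x = \<ominus>\<^bsub>polyring n\<^esub> x" by (simp add: a_inv_def)
        then show ?thesis using that assms(1) neg polyring_a_inv[of n x] by auto
      qed
    qed (use assms in auto)
  next
    fix a x :: "(nat, 'k) mpol" assume "a \<in> J" "x \<in> carrier (polyring n)"
    then have "x * a \<in> J" using mult by simp
    then show "x \<otimes>\<^bsub>polyring n\<^esub> a \<in> J" "a \<otimes>\<^bsub>polyring n\<^esub> x \<in> J" by (simp_all add: mult.commute)
  qed (rule ring_axioms)
qed

lemma polyring_idealD:
  fixes J :: "(nat, 'k::comm_ring_1) mpol set"
  assumes "ideal J (polyring n)"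
  shows "p \<in> J \<Longrightarrow> in_vars {..<n} p" "0 \<in> J" "p \<in> J \<Longrightarrow> q \<in> J \<Longrightarrow> p + q \<in> J"
    "in_vars {..<n} p \<Longrightarrow> q \<in> J \<Longrightarrow> p * q \<in> J" "p \<in> J \<Longrightarrow> q \<in> J \<Longrightarrow> p - q \<in> J"
proof -
  interpret ideal J "polyring n" by fact
  show "p \<in> J \<Longrightarrow> in_vars {..<n} p" using a_subset by auto
  show "0 \<in> J" using additive_subgroup.zero_closed[OF additive_subgroup_axioms] by simp
  have add: "f + q \<in> J" if "f \<in> J" "q \<in> J" for f q
    using additive_subgroup.a_closed[OF additive_subgroup_axioms that] by simp
  then show "p \<in> J \<Longrightarrow> q \<in> J \<Longrightarrow> p + q \<in> J" by blast
  have mult: "f * q \<in> J" if "in_vars {..<n} f" "q \<in> J" for f q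
    using I_l_closed[of q f] that by simp
  then show "in_vars {..<n} p \<Longrightarrow> q \<in> J \<Longrightarrow> p * q \<in> J" by blast
  show "p \<in> J \<Longrightarrow> q \<in> J \<Longrightarrow> p - q \<in> J"
    using mult[of "-1" q] add[of p "-q"] by (simp add: in_vars_uminus in_vars_one)
qed

lemma polyring_ideal_sum:
  assumes "ideal J (polyring n)" "\<And>x. x \<in> S \<Longrightarrow> f x \<in> (J :: (nat, 'k::comm_ring_1) mpol set)"
  shows "sum f S \<in> J"
  using assms(2) by (induction S rule: infinite_finite_induct) (auto intro: polyring_idealD[OF assms(1)])

lemma homogeneous_idealD:
  assumes "homogeneous_ideal n K"
  shows "ideal K (polyring n)" "p \<in> K \<Longrightarrow> hom_component d p \<in> K"
  using assms by (auto simp: homogeneous_ideal_def)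

lemma subspace_ideal:
  assumes "ideal K (polyring n)"
  shows "subspace K"
  using polyring_idealD[OF assms] by (auto simp: subspace_def in_vars_const)

lemma subspace_forms: "subspace (forms n d :: (nat, 'k::comm_ring_1) mpol set)"
  unfolding subspace_def using forms_zero forms_add forms_scale by blast

lemma subspace_ideal_piece:
  assumes "ideal K (polyring n)"
  shows "subspace (K \<inter> forms n d)"
  using polyring_idealD[OF assms] by (auto simp: subspace_def forms_zero forms_add forms_scale in_vars_const)

lemma leads_exps:
  assumes "homogeneous_ideal n K" "m \<in> leads K"
  shows "m \<in> exps n (mdeg m)"
proof -
  obtain p where "p \<in> K" "p \<noteq> 0" "lead_exp p = m" using assms(2) by (rule leadsE)
  then show ?thesis
    using polyring_idealD(1)[OF homogeneous_idealD(1)[OF assms(1)], of p] lead_exp_props(1)[of p]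
    by (auto simp: exps_def in_vars_def)
qed

lemma leads_ideal_piece:
  assumes K: "homogeneous_ideal n K"
  shows "leads (K \<inter> forms n d) = leads K \<inter> exps n d"
proof
  show "leads (K \<inter> forms n d) \<subseteq> leads K \<inter> exps n d"
  proof
    fix m assume "m \<in> leads (K \<inter> forms n d)"
    then obtain p where p: "p \<in> K" "p \<in> forms n d" "p \<noteq> 0" "lead_exp p = m" by (auto elim: leadsE)
    then show "m \<in> leads K \<inter> exps n d"
      using lead_exp_props(1)[OF p(3)] leadsI[OF p(1,3)] by (auto simp: forms_iff)
  qed
  show "leads K \<inter> exps n d \<subseteq> leads (K \<inter> forms n d)"
  proof
    fix m assume "m \<in> leads K \<inter> exps n d"
    then obtain p where p: "p \<in> K" "p \<noteq> 0" "lead_exp p = m" and d: "mdeg m = d"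
      by (auto elim: leadsE simp: exps_def)
    let ?q = "hom_component d p"
    have q: "?q \<in> K \<inter> forms n d"
      using homogeneous_idealD[OF K] polyring_idealD(1) p(1) hom_component_forms by blast
    have "m \<in> keys ?q"
      using d p lookup_lead_exp[of p] by (auto simp: in_keys_iff lookup_hom_component)
    moreover have "revlex_less m' m" if "m' \<in> keys ?q" "m' \<noteq> m" for m'
      using that p lead_exp_props(2)[of p m'] by (auto simp: in_keys_iff lookup_hom_component split: if_splits)
    ultimately have "lead_exp ?q = m" "?q \<noteq> 0" by (auto intro: lead_exp_eqI)
    then show "m \<in> leads (K \<inter> forms n d)" using q leadsI by metis
  qed
qed

lemma leads_add:
  fixes K :: "(nat, 'k::comm_ring_1) mpol set"
  assumes "ideal K (polyring n)" "m \<in> leads K" "keys s \<subseteq> {..<n}"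
  shows "s + m \<in> leads K"
proof -
  obtain p where p: "p \<in> K" "p \<noteq> 0" "lead_exp p = m" using assms(2) by (rule leadsE)
  have "mon s * p \<in> K"
    using polyring_idealD(4)[OF assms(1) _ p(1)] assms(3) by (simp add: in_vars_def keys_mon)
  then show ?thesis using lead_exp_mon_mult[OF p(2), of s] p(3) leadsI by metis
qed

lemma initial_ideal_eq:
  fixes K :: "(nat, 'k::comm_ring_1) mpol set"
  assumes K: "homogeneous_ideal n K"
  shows "initial_ideal n K = {p. keys p \<subseteq> leads K}" (is "_ = ?M")
proof -
  have KI: "ideal K (polyring n)" using homogeneous_idealD[OF K] by blast
  have vars: "keys m \<subseteq> {..<n}" if "m \<in> leads K" for m
    using leads_exps[OF K that] by (simp add: exps_def)
  have M: "ideal ?M (polyring n)"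
  proof (rule polyring_idealI)
    show "p * q \<in> ?M" if "in_vars {..<n} p" "q \<in> ?M" for p q :: "(nat, 'k) mpol"
      using keys_mult[of p q] that leads_add[OF KI] unfolding in_vars_def by blast
    show "p + q \<in> ?M" if "p \<in> ?M" "q \<in> ?M" for p q :: "(nat, 'k) mpol"
      using keys_add[of p q] that by blast
  qed (use vars in \<open>auto simp: in_vars_def\<close>)
  let ?S = "(\<lambda>p. mon (lead_exp p)) ` (K - {0})"
  have S: "?S = mon ` leads K" by (auto simp: leads_def)
  show ?thesis
  proof
    show "initial_ideal n K \<subseteq> ?M"
      unfolding initial_ideal_def genideal_def S using M by (auto simp: keys_mon)
    show "?M \<subseteq> initial_ideal n K"
      unfolding initial_ideal_def genideal_def S
    proof (intro subsetI InterI)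
      fix p :: "(nat, 'k) mpol" and J :: "(nat, 'k) mpol set"
      assume p: "p \<in> ?M" and "J \<in> {I. ideal I (polyring n) \<and> mon ` leads K \<subseteq> I}"
      then have J: "ideal J (polyring n)" "mon ` leads K \<subseteq> J" by auto
      have "(\<Sum>m\<in>keys p. single m (lookup p m)) \<in> J"
      proof (rule polyring_ideal_sum[OF J(1)])
        fix m assume "m \<in> keys p"
        then have "mon m \<in> J" using J(2) p by blast
        then show "single m (lookup p m) \<in> J"
          unfolding single_eq_const_mon[of m] by (intro polyring_idealD(4)[OF J(1)] in_vars_const)
      qed
      then show "p \<in> J" by (simp only: mpol_expand[symmetric])
    qed
  qed
qed

subsection \<open>Multiplication by powers of the last variable\<close>

lemma revlex_less_of_last_exponent:
  assumes "n \<ge> 1" "u \<in> exps n d" "v \<in> exps n d" "lookup u (n - 1) < lookup v (n - 1)"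
  shows "revlex_less v u"
proof -
  have "\<forall>j>n - 1. lookup v j = lookup u j"
  proof (intro allI impI)
    fix j assume "j > n - 1"
    then have "j \<notin> keys u" "j \<notin> keys v" using assms(2,3) by (auto simp: exps_def subset_iff)
    then show "lookup v j = lookup u j" by (simp add: in_keys_iff)
  qed
  then show ?thesis using assms unfolding revlex_less_def exps_def by auto
qed

lemma divisible_by_last_power:
  fixes p :: "(nat, 'k::comm_ring_1) mpol"
  assumes "in_vars V p" "\<And>m. m \<in> keys p \<Longrightarrow> i \<le> lookup m l"
  obtains q where "in_vars V q" "p = mon (single l i) * q"
proof
  let ?q = "\<Sum>m\<in>keys p. single (m - single l i) (lookup p m)"
  have m: "single l i + (m - single l i) = m" if "m \<in> keys p" for m
    by (rule poly_mapping_eqI)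
       (use assms(2)[OF that] in \<open>auto simp: lookup_add lookup_minus lookup_single when_def\<close>)
  have "mon (single l i) * ?q = (\<Sum>m\<in>keys p. single m (lookup p m))"
    unfolding mon_def sum_distrib_left mult_single by (intro sum.cong) (simp_all only: m mult_1_left)
  then show "p = mon (single l i) * ?q" by (simp only: mpol_expand[symmetric])
  show "in_vars V ?q"
  proof (rule in_vars_sum)
    fix k assume k: "k \<in> keys p"
    have "keys (k - single l i) \<subseteq> keys k"
      by (auto simp: in_keys_iff lookup_minus)
    then show "in_vars V (single (k - single l i) (lookup p k))"
      using assms(1) k by (auto simp: in_vars_def)
  qed
qed

lemma form_divisible_by_last_power:
  fixes p :: "(nat, 'k::comm_ring_1) mpol"
  assumes "p \<in> forms n (d + i)" "\<And>m. m \<in> keys p \<Longrightarrow> i \<le> lookup m l"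
  obtains q where "q \<in> forms n d" "p = mon (single l i) * q"
proof -
  obtain q where q: "in_vars {..<n} q" "p = mon (single l i) * q"
    using divisible_by_last_power[OF forms_in_vars[OF assms(1)] assms(2)] by blast
  have "m \<in> exps n d" if m: "m \<in> keys q" for m
  proof -
    have "lookup p (single l i + m) = lookup q m" unfolding q(2) mon_def lookup_single_times by simp
    then have "single l i + m \<in> keys p" using m by (simp add: in_keys_iff)
    then have "mdeg (single l i + m) = d + i" using assms(1) by (auto simp: forms_iff exps_def)
    then show ?thesis using q(1) m by (auto simp: mdeg_add mdeg_single exps_def in_vars_def)
  qed
  then show ?thesis using that q(2) by (auto simp: forms_iff)
qed

text \<open>If \<open>x\<^sub>n\<^sup>i\<close> does not divide \<open>w\<close>, then \<open>w\<close> is the leading monomial of \<open>w - x\<^sub>n\<^sup>i p\<close>, whatever the form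
  \<open>p\<close> is.  Conversely, if all these monomials \<open>w\<close> are leading monomials of \<open>K\<close>, the division algorithm
  leaves a multiple of \<open>x\<^sub>n\<^sup>i\<close>.\<close>

lemma last_power_surjective_iff:
  fixes K :: "(nat, 'k::field) mpol set"
  assumes K: "homogeneous_ideal n K" and n: "n \<ge> 1"
  shows "(\<forall>q\<in>forms n (d + i). \<exists>p\<in>forms n d. q - mon (single (n - 1) i) * p \<in> K) \<longleftrightarrow>
    (\<forall>w\<in>exps n (d + i). lookup w (n - 1) < i \<longrightarrow> w \<in> leads K)" (is "?L \<longleftrightarrow> ?R")
proof
  let ?x = "mon (single (n - 1) i) :: (nat, 'k) mpol"
  assume L: ?L
  show ?R
  proof (intro ballI impI)
    fix w assume w: "w \<in> exps n (d + i)" "lookup w (n - 1) < i"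
    then obtain p where p: "p \<in> forms n d" "mon w - ?x * p \<in> K" using L forms_mon by blast
    have xp: "m \<in> exps n (d + i) \<and> i \<le> lookup m (n - 1)" if m: "m \<in> keys (?x * p)" for m
    proof -
      obtain m' where "m' \<in> keys p" "m = single (n - 1) i + m'"
        using m keys_single_times[of "single (n - 1) i" 1 p] by (auto simp: mon_def)
      then show ?thesis using p(1) n
        by (auto simp: lookup_add lookup_single forms_iff exps_def mdeg_add mdeg_single keys_exp_add subset_iff split: if_splits)
    qed
    then have "w \<notin> keys (?x * p)" using w(2) by force
    then have wk: "w \<in> keys (mon w - ?x * p)" by (auto simp: in_keys_iff lookup_minus lookup_mon)
    have "lead_exp (mon w - ?x * p) = w"
    proof (rule lead_exp_eqI[OF wk])
      fix m assume "m \<in> keys (mon w - ?x * p)" "m \<noteq> w"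
      then have "m \<in> keys (?x * p)" using keys_diff[of "mon w :: (nat, 'k) mpol" "?x * p"] by (auto simp: keys_mon)
      then show "revlex_less m w"
        using xp[of m] w by (intro revlex_less_of_last_exponent[OF n w(1)]) auto
    qed
    moreover have "mon w - ?x * p \<noteq> 0" using wk by auto
    ultimately show "w \<in> leads K" using p(2) leadsI by metis
  qed
next
  assume R: ?R
  let ?X = "{w \<in> exps n (d + i). lookup w (n - 1) < i}"
  show ?L
  proof
    fix q :: "(nat, 'k) mpol" assume q: "q \<in> forms n (d + i)"
    have sub: "subspace (K \<inter> forms n (d + i))"
      using K by (intro subspace_ideal_piece homogeneous_idealD)
    have "?X \<subseteq> leads (K \<inter> forms n (d + i))" using R leads_ideal_piece[OF K] by auto
    then obtain w where w: "w \<in> K \<inter> forms n (d + i)" "\<forall>x\<in>?X. lookup (q - w) x = 0"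
      using subspace_reduce[OF sub, of ?X q] finite_exps by auto
    have qw: "q - w \<in> forms n (d + i)" using q w(1) by (auto intro: forms_diff)
    obtain p where p: "p \<in> forms n d" "q - w = mon (single (n - 1) i) * p"
    proof (rule form_divisible_by_last_power[OF qw])
      fix m assume "m \<in> keys (q - w)"
      then show "i \<le> lookup m (n - 1)"
        using w(2) qw by (force simp: forms_iff in_keys_iff)
    qed blast
    then have "q - mon (single (n - 1) i) * p = w" by (metis diff_diff_eq2 add_diff_cancel_left')
    then show "\<exists>p\<in>forms n d. q - mon (single (n - 1) i) * p \<in> K"
      using w(1) p(1) by auto
  qed
qed

text \<open>A form whose leading monomial is divisible by \<open>x\<^sub>n\<^sup>i\<close> is itself divisible by \<open>x\<^sub>n\<^sup>i\<close>, since all its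
  other monomials are smaller.\<close>

lemma last_power_injective_iff:
  fixes K :: "(nat, 'k::field) mpol set"
  assumes K: "homogeneous_ideal n K" and n: "n \<ge> 1"
  shows "(\<forall>p\<in>forms n d. mon (single (n - 1) i) * p \<in> K \<longrightarrow> p \<in> K) \<longleftrightarrow>
    (\<forall>u\<in>exps n d. single (n - 1) i + u \<in> leads K \<longrightarrow> u \<in> leads K)" (is "?L \<longleftrightarrow> ?R")
proof
  let ?x = "mon (single (n - 1) i) :: (nat, 'k) mpol"
  have xi: "single (n - 1) i \<in> exps n i" using n by (auto simp: exps_def mdeg_single)
  assume L: ?L
  show ?R
  proof (intro ballI impI)
    fix u assume u: "u \<in> exps n d" "single (n - 1) i + u \<in> leads K"
    let ?v = "single (n - 1) i + u"
    have v: "?v \<in> exps n (d + i)" using exps_add[OF u(1) xi] by (simp add: add.commute)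
    then have "?v \<in> leads (K \<inter> forms n (d + i))" using u(2) leads_ideal_piece[OF K] by auto
    then obtain q where q: "q \<in> K \<inter> forms n (d + i)" "q \<noteq> 0" "lead_exp q = ?v" by (rule leadsE)
    obtain p where p: "p \<in> forms n d" "q = ?x * p"
    proof (rule form_divisible_by_last_power)
      show "q \<in> forms n (d + i)" using q by blast
      fix m assume m: "m \<in> keys q"
      show "i \<le> lookup m (n - 1)"
      proof (rule ccontr)
        assume "\<not> i \<le> lookup m (n - 1)"
        then have "lookup m (n - 1) < lookup ?v (n - 1)" by (simp add: lookup_add)
        then have "revlex_less ?v m"
          using m q(1) v by (intro revlex_less_of_last_exponent[OF n]) (auto simp: forms_iff)
        moreover have "m = ?v \<or> revlex_less m ?v" using lead_exp_props(2)[OF q(2) m] q(3) by metis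
        ultimately show False using revlex_less_trans revlex_less_irrefl by metis
      qed
    qed blast
    have "p \<noteq> 0" using q(2) p(2) by auto
    then have "lead_exp p = u" using lead_exp_mon_mult(1)[of p "single (n - 1) i"] p(2) q(3) by simp
    moreover have "p \<in> K" using L p q(1) by blast
    ultimately show "u \<in> leads K" using \<open>p \<noteq> 0\<close> leadsI by metis
  qed
next
  let ?x = "mon (single (n - 1) i) :: (nat, 'k) mpol"
  assume R: ?R
  have KI: "ideal K (polyring n)" using K by (rule homogeneous_idealD)
  show ?L
  proof (intro ballI impI)
    fix p assume p: "p \<in> forms n d" "?x * p \<in> K"
    let ?X = "leads K \<inter> exps n d"
    obtain w where w: "w \<in> K \<inter> forms n d" "\<forall>x\<in>?X. lookup (p - w) x = 0"
      using subspace_reduce[OF subspace_ideal_piece[OF KI, of d], of ?X p] finite_exps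
        leads_ideal_piece[OF K, of d] by auto
    have "p - w = 0"
    proof (rule ccontr)
      assume nz: "p - w \<noteq> 0"
      let ?u = "lead_exp (p - w)"
      have "p - w \<in> forms n d" using p w by (auto intro: forms_diff)
      then have u: "?u \<in> exps n d" using lead_exp_props(1)[OF nz] by (auto simp: forms_iff)
      have "?x * w \<in> K" using w(1) n
        by (intro polyring_idealD(4)[OF KI]) (auto simp: in_vars_def keys_mon)
      then have "?x * (p - w) \<in> K" using p(2) polyring_idealD(5)[OF KI] by (simp add: right_diff_distrib)
      then have "single (n - 1) i + ?u \<in> leads K"
        using lead_exp_mon_mult[OF nz, of "single (n - 1) i"] leadsI by metis
      then have "?u \<in> ?X" using R u by blast
      then show False using w(2) lookup_lead_exp[OF nz] by blast
    qed
    then show "p \<in> K" using w(1) by simp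
  qed
qed

section \<open>Translation of the quotient ring statements\<close>

lemma coset_eq_iff:
  fixes I :: "(nat, 'k::comm_ring_1) mpol set"
  assumes "ideal I (polyring n)" "in_vars {..<n} p" "in_vars {..<n} q"
  shows "I +>\<^bsub>polyring n\<^esub> p = I +>\<^bsub>polyring n\<^esub> q \<longleftrightarrow> p - q \<in> I"
proof -
  interpret cring "polyring n :: (nat, 'k) mpol ring" by (rule cring_polyring)
  show ?thesis
    using quotient_eq_iff_same_a_r_cos[OF assms(1), of p q] assms(2,3)
    by (simp add: a_minus_def polyring_a_inv)
qed

lemma coset_mult:
  fixes I :: "(nat, 'k::comm_ring_1) mpol set"
  assumes "ideal I (polyring n)" "in_vars {..<n} p" "in_vars {..<n} q"
  shows "(I +>\<^bsub>polyring n\<^esub> p) \<otimes>\<^bsub>polyring n Quot I\<^esub> (I +>\<^bsub>polyring n\<^esub> q) = I +>\<^bsub>polyring n\<^esub> (p * q)"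
  using ring_hom_mult[OF ideal.rcos_ring_hom[OF assms(1)], of p q] assms(2,3) by simp

lemma coset_power:
  fixes I :: "(nat, 'k::comm_ring_1) mpol set"
  assumes "ideal I (polyring n)" "in_vars {..<n} p"
  shows "(I +>\<^bsub>polyring n\<^esub> p) [^]\<^bsub>polyring n Quot I\<^esub> e = I +>\<^bsub>polyring n\<^esub> (p ^ e)"
proof (induction e)
  case 0
  show ?case using ring_hom_one[OF ideal.rcos_ring_hom[OF assms(1)]] by (simp add: nat_pow_def)
next
  case (Suc e)
  then show ?case
    using coset_mult[OF assms(1) in_vars_power[OF assms(2)] assms(2)] by (simp add: mult.commute nat_pow_def)
qed

lemma strong_lefschetz_iff:
  fixes I :: "(nat, 'k::comm_ring_1) mpol set"
  assumes I: "ideal I (polyring n)"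
  shows "strong_lefschetz n I \<longleftrightarrow> (\<exists>L\<in>forms n 1. \<forall>d. \<forall>i\<ge>1.
    (\<forall>p\<in>forms n d. L ^ i * p \<in> I \<longrightarrow> p \<in> I) \<or>
    (\<forall>q\<in>forms n (d + i). \<exists>p\<in>forms n d. q - L ^ i * p \<in> I))"
proof -
  let ?A = "polyring n Quot I" and ?c = "\<lambda>p. I +>\<^bsub>polyring n\<^esub> p"
  let ?mul = "\<lambda>L i a. ?c L [^]\<^bsub>?A\<^esub> i \<otimes>\<^bsub>?A\<^esub> a"
  have eq: "inj_on (?mul L i) (quot_piece n I d) \<longleftrightarrow>
      (\<forall>p\<in>forms n d. L ^ i * p \<in> I \<longrightarrow> p \<in> I)" (is "?inj \<longleftrightarrow> ?inj'")
    "(?mul L i) ` quot_piece n I d = quot_piece n I (d + i) \<longleftrightarrow>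
      (\<forall>q\<in>forms n (d + i). \<exists>p\<in>forms n d. q - L ^ i * p \<in> I)" (is "?sur \<longleftrightarrow> ?sur'")
    if L: "L \<in> forms n 1" for L :: "(nat, 'k) mpol" and d i
  proof -
    have Li: "L ^ i \<in> forms n i" using forms_power[OF L, of i] by simp
    have mul: "?mul L i (?c p) = ?c (L ^ i * p)" if "p \<in> forms n d" for p
      using coset_power[OF I forms_in_vars[OF L], of i]
        coset_mult[OF I forms_in_vars[OF Li] forms_in_vars[OF that]] by simp
    have Lip: "L ^ i * p \<in> forms n (d + i)" if "p \<in> forms n d" for p
      using forms_mult[OF that Li] by (simp add: mult.commute)
    show "?inj \<longleftrightarrow> ?inj'"
    proof
      assume inj: ?inj
      show ?inj'
      proof (intro ballI impI)
        fix p assume p: "p \<in> forms n d" "L ^ i * p \<in> I"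
        have "?c (L ^ i * p) = ?c (L ^ i * 0)"
          using p forms_in_vars[OF Lip] by (subst coset_eq_iff[OF I]) (auto simp: in_vars_zero)
        then have "?c p = ?c 0"
          using inj mul p(1) forms_zero[of n d] unfolding quot_piece_def inj_on_def by (metis imageI)
        then show "p \<in> I" using coset_eq_iff[OF I forms_in_vars[OF p(1)] in_vars_zero] by simp
      qed
    next
      assume inj: ?inj'
      show ?inj
      proof (rule inj_onI)
        fix a b assume "a \<in> quot_piece n I d" "b \<in> quot_piece n I d"
          and ab: "?mul L i a = ?mul L i b"
        then obtain p q where pq: "p \<in> forms n d" "q \<in> forms n d" "a = ?c p" "b = ?c q"
          unfolding quot_piece_def by blast
        then have "L ^ i * p - L ^ i * q \<in> I"
          using ab mul coset_eq_iff[OF I forms_in_vars[OF Lip] forms_in_vars[OF Lip], of p q] by simp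
        then have "p - q \<in> I" using inj forms_diff[OF pq(1,2)] by (simp add: right_diff_distrib)
        then show "a = b" using pq coset_eq_iff[OF I forms_in_vars forms_in_vars, of p d q d] by simp
      qed
    qed
    have sub: "(?mul L i) ` quot_piece n I d \<subseteq> quot_piece n I (d + i)"
      using mul Lip by (auto simp: quot_piece_def)
    show "?sur \<longleftrightarrow> ?sur'"
    proof
      assume sur: ?sur
      show ?sur'
      proof
        fix q :: "(nat, 'k) mpol" assume q: "q \<in> forms n (d + i)"
        then have "?c q \<in> (?mul L i) ` quot_piece n I d"
          unfolding sur by (simp add: quot_piece_def)
        then obtain p where p: "p \<in> forms n d" "?c q = ?c (L ^ i * p)"
          using mul by (auto simp: quot_piece_def)
        then show "\<exists>p\<in>forms n d. q - L ^ i * p \<in> I"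
          using coset_eq_iff[OF I forms_in_vars[OF q] forms_in_vars[OF Lip]] by blast
      qed
    next
      assume sur: ?sur'
      have "quot_piece n I (d + i) \<subseteq> (?mul L i) ` quot_piece n I d"
      proof
        fix b assume "b \<in> quot_piece n I (d + i)"
        then obtain q where q: "q \<in> forms n (d + i)" "b = ?c q" by (auto simp: quot_piece_def)
        obtain p where p: "p \<in> forms n d" "q - L ^ i * p \<in> I" using sur q(1) by blast
        then have "b = ?mul L i (?c p)"
          using q mul coset_eq_iff[OF I forms_in_vars[OF q(1)] forms_in_vars[OF Lip]] by auto
        then show "b \<in> (?mul L i) ` quot_piece n I d"
          using p(1) by (auto simp: quot_piece_def)
      qed
      then show ?sur using sub by blast
    qed
  qed
  show ?thesis unfolding strong_lefschetz_def Let_def using eq by auto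
qed

lemma ideal_plus_form_piece:
  fixes I :: "(nat, 'k::comm_ring_1) mpol set"
  assumes I: "homogeneous_ideal n I" and L: "L \<in> forms n 1"
  defines "K \<equiv> I <+>\<^bsub>polyring n\<^esub> cgenideal (polyring n) L"
  shows "quot_piece n K (t + 1) = {\<zero>\<^bsub>polyring n Quot K\<^esub>} \<longleftrightarrow>
    (\<forall>q\<in>forms n (t + 1). \<exists>p\<in>forms n t. q - L * p \<in> I)"
proof -
  interpret cring "polyring n :: (nat, 'k) mpol ring" by (rule cring_polyring)
  have II: "ideal I (polyring n)" using I by (rule homogeneous_idealD)
  have K: "ideal K (polyring n)"
    unfolding K_def using L II by (intro add_ideals cgenideal_ideal) (auto dest: forms_in_vars)
  have memK: "q \<in> K \<longleftrightarrow> (\<exists>r. in_vars {..<n} r \<and> q - L * r \<in> I)" for q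
  proof
    assume "q \<in> K"
    then obtain f r where "f \<in> I" "in_vars {..<n} r" "q = f + r * L"
      unfolding K_def set_add_def' cgenideal_def by auto
    then show "\<exists>r. in_vars {..<n} r \<and> q - L * r \<in> I" by (intro exI[of _ r]) (simp add: mult.commute)
  next
    assume "\<exists>r. in_vars {..<n} r \<and> q - L * r \<in> I"
    then obtain r where r: "in_vars {..<n} r" "q - L * r \<in> I" by blast
    have "q = (q - L * r) + r * L" by (simp add: mult.commute)
    then have "\<exists>f\<in>I. \<exists>r. in_vars {..<n} r \<and> q = f + r * L" using r by blast
    then show "q \<in> K" unfolding K_def set_add_def' cgenideal_def by auto
  qed
  have "quot_piece n K (t + 1) = {\<zero>\<^bsub>polyring n Quot K\<^esub>} \<longleftrightarrow> (\<forall>q\<in>forms n (t + 1). q \<in> K)"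
  proof -
    have "\<zero>\<^bsub>polyring n Quot K\<^esub> = K +>\<^bsub>polyring n\<^esub> 0"
      using a_coset_add_zero[of K] polyring_idealD(1)[OF K] by (auto simp: FactRing_def)
    then have "quot_piece n K (t + 1) = {\<zero>\<^bsub>polyring n Quot K\<^esub>} \<longleftrightarrow>
        (\<forall>q\<in>forms n (t + 1). K +>\<^bsub>polyring n\<^esub> q = K +>\<^bsub>polyring n\<^esub> 0)"
      unfolding quot_piece_def using forms_zero[of n "t + 1"] by auto
    also have "\<dots> \<longleftrightarrow> (\<forall>q\<in>forms n (t + 1). q \<in> K)"
      using coset_eq_iff[OF K forms_in_vars in_vars_zero] by simp
    finally show ?thesis .
  qed
  also have "\<dots> \<longleftrightarrow> (\<forall>q\<in>forms n (t + 1). \<exists>p\<in>forms n t. q - L * p \<in> I)"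
  proof (intro ball_cong refl)
    fix q :: "(nat, 'k) mpol" assume q: "q \<in> forms n (t + 1)"
    show "q \<in> K \<longleftrightarrow> (\<exists>p\<in>forms n t. q - L * p \<in> I)"
    proof
      assume "q \<in> K"
      then obtain r where r: "in_vars {..<n} r" "q - L * r \<in> I" using memK by blast
      have "hom_component (t + 1) (q - L * r) = q - L * hom_component t r"
        using hom_component_of_form[OF q] hom_component_mult_form[OF L r(1)]
        by (simp add: hom_component_diff)
      then show "\<exists>p\<in>forms n t. q - L * p \<in> I"
        using homogeneous_idealD(2)[OF I r(2)] hom_component_forms[OF r(1)] by metis
    next
      assume "\<exists>p\<in>forms n t. q - L * p \<in> I"
      then show "q \<in> K" using memK forms_in_vars by blast
    qed
  qed
  finally show ?thesis .
qed

text \<open>The ideals of elements of order at least \<open>i\<close> form a descending chain; where it becomes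
  stationary modulo \<open>I\<close>, every form is congruent to one of higher order, and homogeneity of \<open>I\<close>
  puts it into \<open>I\<close>.\<close>

lemma artinian_imp_contains_forms:
  fixes I :: "(nat, 'k::comm_ring_1) mpol set"
  assumes I: "homogeneous_ideal n I" and art: "artinian (polyring n Quot I)"
  obtains D where "\<And>d. d \<ge> D \<Longrightarrow> forms n d \<subseteq> I"
proof -
  interpret cring "polyring n :: (nat, 'k) mpol ring" by (rule cring_polyring)
  have II: "ideal I (polyring n)" using I by (rule homogeneous_idealD)
  define M :: "nat \<Rightarrow> (nat, 'k) mpol set" where
    "M = (\<lambda>i. {p. in_vars {..<n} p \<and> (\<forall>m\<in>keys p. i \<le> mdeg m)})"
  have M: "ideal (M i) (polyring n)" for i
  proof (rule polyring_idealI)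
    show "p * q \<in> M i" if "in_vars {..<n} p" "q \<in> M i" for p q
      using that keys_mult[of p q] by (fastforce simp: M_def in_vars_mult mdeg_add)
    show "p + q \<in> M i" if "p \<in> M i" "q \<in> M i" for p q
      using that keys_add[of p q] by (auto simp: M_def in_vars_add)
  qed (auto simp: M_def in_vars_zero)
  let ?J = "\<lambda>i. (\<lambda>p. I +>\<^bsub>polyring n\<^esub> p) ` M i"
  have "ideal (?J i) (polyring n Quot I)" for i
    using ring_ideal_imp_quot_ideal[OF II M] .
  moreover have "?J (Suc i) \<subseteq> ?J i" for i by (intro image_mono) (auto simp: M_def)
  ultimately have "\<exists>N. \<forall>i\<ge>N. ?J i = ?J N"
    by (intro art[unfolded artinian_def, rule_format]) blast
  then obtain N where N: "\<forall>i\<ge>N. ?J i = ?J N" ..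
  show ?thesis
  proof
    fix d assume d: "d \<ge> N"
    show "forms n d \<subseteq> I"
    proof
      fix p :: "(nat, 'k) mpol" assume p: "p \<in> forms n d"
      have "p \<in> M d" using p forms_in_vars[OF p] by (auto simp: M_def forms_iff exps_def)
      then have "I +>\<^bsub>polyring n\<^esub> p \<in> ?J d" by blast
      also have "?J d = ?J (Suc d)" using N d by (metis le_SucI)
      finally obtain q where q: "q \<in> M (Suc d)" "I +>\<^bsub>polyring n\<^esub> p = I +>\<^bsub>polyring n\<^esub> q" by blast
      then have "p - q \<in> I" using coset_eq_iff[OF II forms_in_vars[OF p], of q] by (simp add: M_def)
      then have "hom_component d (p - q) \<in> I" using homogeneous_idealD[OF I] by blast
      moreover have "hom_component d q = 0"
        using q(1) by (intro poly_mapping_eqI) (force simp: lookup_hom_component M_def in_keys_iff)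
      ultimately show "p \<in> I" using hom_component_of_form[OF p] by (simp add: hom_component_diff)
    qed
  qed
qed

section \<open>Linear changes of coordinates\<close>

definition coord_change :: "nat \<Rightarrow> (nat \<times> nat \<Rightarrow> 'k::comm_ring_1) \<Rightarrow> (nat, 'k) mpol \<Rightarrow> (nat, 'k) mpol" where
  "coord_change n a = eval_mpol coeff_embed (\<lambda>j. \<Sum>i<n. coeff_embed (a (i, j)) * indet i)"

lemma gl_act_eq: "gl_act n g = coord_change n (\<lambda>ij. g $$ ij)"
  by (simp add: gl_act_def coord_change_def)

lemma coord_change_add: "coord_change n a (p + q) = coord_change n a p + coord_change n a q"
  and coord_change_diff: "coord_change n a (p - q) = coord_change n a p - coord_change n a q"
  and coord_change_mult: "coord_change n a (p * q) = coord_change n a p * coord_change n a q"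
  and coord_change_power: "coord_change n a (p ^ e) = coord_change n a p ^ e"
  and coord_change_const: "coord_change n a (coeff_embed c) = coeff_embed c"
  and coord_change_zero: "coord_change n a 0 = 0"
  and coord_change_sum: "coord_change n a (sum f S) = (\<Sum>x\<in>S. coord_change n a (f x))"
  and coord_change_indet: "coord_change n a (indet j) = (\<Sum>i<n. coeff_embed (a (i, j)) * indet i)"
  by (simp_all only: coord_change_def eval_mpol_add[OF coeff_hom_embed] eval_mpol_diff[OF coeff_hom_embed]
      eval_mpol_mult[OF coeff_hom_embed] eval_mpol_power[OF coeff_hom_embed]
      eval_mpol_const[OF coeff_hom_embed] eval_mpol_zero eval_mpol_sum[OF coeff_hom_embed]
      eval_mpol_indet[OF coeff_hom_embed])

lemma coord_change_forms: "p \<in> forms n d \<Longrightarrow> coord_change n a p \<in> forms n d"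
  unfolding coord_change_def
  by (erule eval_mpol_forms) (intro forms_sum forms_scale forms_indet, simp)

lemma coord_change_in_vars: "in_vars {..<n} p \<Longrightarrow> in_vars {..<n} (coord_change n a p)"
  unfolding coord_change_def
  by (erule in_vars_eval) (intro in_vars_sum in_vars_mult in_vars_const in_vars_indet, simp)

lemma coord_change_cong:
  assumes "in_vars {..<n} p" "\<And>i j. i < n \<Longrightarrow> j < n \<Longrightarrow> a (i, j) = b (i, j)"
  shows "coord_change n a p = coord_change n b p"
  unfolding coord_change_def using assms by (intro eval_mpol_cong[OF assms(1)] sum.cong) auto

lemma coeff_embed_sum: "coeff_embed (sum f S) = (\<Sum>x\<in>S. coeff_embed (f x))"
  by (induction S rule: infinite_finite_induct) (auto simp: single_add)

lemma coord_change_comp: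
  "coord_change n a (coord_change n b p) = coord_change n (\<lambda>(i, j). \<Sum>l<n. a (i, l) * b (l, j)) p"
proof -
  have "coord_change n a (\<Sum>l<n. coeff_embed (b (l, j)) * indet l) =
      (\<Sum>i<n. coeff_embed (\<Sum>l<n. a (i, l) * b (l, j)) * indet i)" for j
  proof -
    have "coord_change n a (\<Sum>l<n. coeff_embed (b (l, j)) * indet l) =
        (\<Sum>l<n. \<Sum>i<n. coeff_embed (a (i, l) * b (l, j)) * indet i)"
      unfolding coord_change_sum coord_change_mult coord_change_const coord_change_indet sum_distrib_left
      by (intro sum.cong refl) (simp add: mult.assoc[symmetric] mult_single mult.commute[of "b _"])
    also have "\<dots> = (\<Sum>i<n. \<Sum>l<n. coeff_embed (a (i, l) * b (l, j)) * indet i)"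
      by (rule sum.swap)
    finally show ?thesis by (simp only: coeff_embed_sum sum_distrib_right)
  qed
  then show ?thesis
    unfolding coord_change_def[of n b] coord_change_def[of n a] eval_mpol_comp
    by (simp add: coord_change_def)
qed

lemma coord_change_one:
  assumes "in_vars {..<n} p"
  shows "coord_change n (\<lambda>(i, j). if i = j then 1 else 0) p = p"
proof -
  have "(\<Sum>i<n. coeff_embed (if i = j then 1 else 0) * indet i) = (indet j :: (nat, 'a) mpol)" if "j < n" for j
  proof -
    have "(\<Sum>i<n. coeff_embed (if i = j then 1 else 0) * indet i) = (\<Sum>i<n. if i = j then indet j else (0 :: (nat, 'a) mpol))"
      by (intro sum.cong) auto
    then show ?thesis using that by simp
  qed
  then have "coord_change n (\<lambda>(i, j). if i = j then 1 else 0) p = eval_mpol coeff_embed indet p"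
    unfolding coord_change_def by (intro eval_mpol_cong[OF assms]) auto
  then show ?thesis by (simp add: eval_mpol_ident)
qed

lemma GL_inverse:
  assumes "g \<in> GL n"
  obtains h where "h \<in> GL n" "\<And>p. in_vars {..<n} p \<Longrightarrow> gl_act n g (gl_act n h p) = p"
    "\<And>p. in_vars {..<n} p \<Longrightarrow> gl_act n h (gl_act n g p) = p"
proof -
  obtain h where h: "h \<in> GL n" "g \<in> carrier_mat n n" "h \<in> carrier_mat n n" "g * h = 1\<^sub>m n" "h * g = 1\<^sub>m n"
    using GL_inverse_mat[OF assms] by metis
  have "gl_act n a (gl_act n b p) = p"
    if ab: "a \<in> carrier_mat n n" "b \<in> carrier_mat n n" "a * b = 1\<^sub>m n" and p: "in_vars {..<n} p"
    for a b :: "'a mat" and p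
  proof -
    have "(\<Sum>l<n. a $$ (i, l) * b $$ (l, j)) = (if i = j then 1 else 0)" if "i < n" "j < n" for i j
    proof -
      have "(\<Sum>l<n. a $$ (i, l) * b $$ (l, j)) = (a * b) $$ (i, j)"
        using ab(1,2) that by (auto simp: scalar_prod_def atLeast0LessThan intro!: sum.cong)
      then show ?thesis unfolding ab(3) using that by simp
    qed
    then have "gl_act n a (gl_act n b p) = coord_change n (\<lambda>(i, j). if i = j then 1 else 0) p"
      unfolding gl_act_eq coord_change_comp by (intro coord_change_cong[OF p]) simp
    then show ?thesis using coord_change_one[OF p] by simp
  qed
  then show ?thesis using that h by metis
qed

lemma hom_component_coord_change:
  assumes "in_vars {..<n} p"
  shows "hom_component d (coord_change n a p) = coord_change n a (hom_component d p)"
proof -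
  let ?S = "insert d (mdeg ` keys p)"
  have "coord_change n a p = (\<Sum>c\<in>?S. coord_change n a (hom_component c p))"
    by (subst sum_hom_components[of ?S p, symmetric]) (auto simp: coord_change_sum)
  then have "hom_component d (coord_change n a p) =
      (\<Sum>c\<in>?S. hom_component d (coord_change n a (hom_component c p)))"
    by (auto intro!: poly_mapping_eqI simp: lookup_hom_component lookup_sum)
  also have "\<dots> = (\<Sum>c\<in>?S. if c = d then coord_change n a (hom_component d p) else 0)"
    using hom_component_of_form[OF coord_change_forms[OF hom_component_forms[OF assms]]]
    by (intro sum.cong) auto
  finally show ?thesis by simp
qed

lemma gl_act_homogeneous_ideal:
  fixes I :: "(nat, 'k::field) mpol set"
  assumes I: "homogeneous_ideal n I" and g: "g \<in> GL n"
  shows "homogeneous_ideal n (gl_act n g ` I)"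
proof -
  have II: "ideal I (polyring n)" using I by (rule homogeneous_idealD)
  note D = polyring_idealD[OF II]
  obtain h where h: "\<And>p. in_vars {..<n} p \<Longrightarrow> gl_act n g (gl_act n h p) = p"
    using GL_inverse[OF g] by metis
  have "ideal (gl_act n g ` I) (polyring n)"
  proof (rule polyring_idealI)
    show "gl_act n g ` I \<subseteq> {p. in_vars {..<n} p}"
      using D(1) by (auto simp: gl_act_eq intro: coord_change_in_vars)
    show "0 \<in> gl_act n g ` I" using D(2) coord_change_zero[of n] by (metis gl_act_eq imageI)
    show "p + q \<in> gl_act n g ` I" if "p \<in> gl_act n g ` I" "q \<in> gl_act n g ` I" for p q
      using that D(3) by (auto simp: gl_act_eq coord_change_add[symmetric])
    show "p * q \<in> gl_act n g ` I" if p: "in_vars {..<n} p" and "q \<in> gl_act n g ` I" for p q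
    proof -
      obtain f where f: "f \<in> I" "q = gl_act n g f" using \<open>q \<in> gl_act n g ` I\<close> by blast
      have "gl_act n h p * f \<in> I" using D(4)[OF _ f(1)] coord_change_in_vars[OF p] by (simp add: gl_act_eq)
      moreover have "gl_act n g (gl_act n h p * f) = p * q"
        using h[OF p] f(2) by (simp add: gl_act_eq coord_change_mult)
      ultimately show ?thesis by (metis imageI)
    qed
  qed
  moreover have "hom_component d p \<in> gl_act n g ` I" if "p \<in> gl_act n g ` I" for p d
    using that D(1) homogeneous_idealD(2)[OF I]
    by (auto simp: gl_act_eq hom_component_coord_change)
  ultimately show ?thesis unfolding homogeneous_ideal_def by blast
qed

lemma gl_act_mem_iff:
  fixes I :: "(nat, 'k::field) mpol set"
  assumes I: "homogeneous_ideal n I" and g: "g \<in> GL n" and p: "in_vars {..<n} p"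
  shows "gl_act n g p \<in> gl_act n g ` I \<longleftrightarrow> p \<in> I"
proof
  assume "gl_act n g p \<in> gl_act n g ` I"
  then obtain q where q: "q \<in> I" "gl_act n g p = gl_act n g q" by blast
  have "in_vars {..<n} q" using polyring_idealD(1)[OF homogeneous_idealD(1)[OF I] q(1)] .
  then have "p = q" using GL_inverse[OF g] p q(2) by metis
  then show "p \<in> I" using q(1) by simp
qed blast

subsection \<open>Linear forms\<close>

lemma exps_degree_one: "exps n 1 = (\<lambda>i. single i 1) ` {..<n}"
proof
  show "exps n 1 \<subseteq> (\<lambda>i. single i 1) ` {..<n}"
  proof
    fix m assume m: "m \<in> exps n 1"
    then have d: "(\<Sum>i\<in>keys m. lookup m i) = 1" "keys m \<subseteq> {..<n}" by (auto simp: exps_def mdeg_def)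
    then obtain i where i: "i \<in> keys m" by fastforce
    have "(\<Sum>j\<in>keys m. lookup m j) = lookup m i + (\<Sum>j\<in>keys m - {i}. lookup m j)"
      using i by (simp add: sum.remove)
    moreover have "lookup m i \<ge> 1" using i by (simp add: in_keys_iff)
    ultimately have "lookup m i = 1" "(\<Sum>j\<in>keys m - {i}. lookup m j) = 0" using d by auto
    then have "lookup m k = lookup (single i 1) k" for k
      by (cases "k = i") (auto simp: lookup_single in_keys_iff)
    then have "m = single i 1" by (rule poly_mapping_eqI)
    then show "m \<in> (\<lambda>i. single i 1) ` {..<n}" using i d(2) by auto
  qed
qed (auto simp: exps_def mdeg_single)

lemma single_exp_inj [simp]: "single i (Suc 0) = single j (Suc 0) \<longleftrightarrow> i = j"
  by (metis keys_single nat.distinct(1) singleton_inject)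

lemma linear_form_expand:
  fixes L :: "(nat, 'k::comm_ring_1) mpol"
  assumes "L \<in> forms n 1"
  shows "L = (\<Sum>i<n. coeff_embed (lookup L (single i 1)) * indet i)"
proof -
  have "L = (\<Sum>m\<in>exps n 1. single m (lookup L m))"
    using assms by (intro mpol_expand_superset finite_exps) (simp add: forms_iff)
  also have "\<dots> = (\<Sum>i<n. single (single i 1) (lookup L (single i 1)))"
    unfolding exps_degree_one by (subst sum.reindex) (auto simp: inj_on_def)
  also have "\<dots> = (\<Sum>i<n. coeff_embed (lookup L (single i 1)) * indet i)"
    by (simp add: indet_def mult_single)
  finally show ?thesis .
qed

lemma linear_form_lookup:
  fixes j n :: nat
  assumes "j < n"
  shows "lookup (\<Sum>i<n. coeff_embed (c i) * indet i) (single j 1) = (c j :: 'k::comm_ring_1)"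
proof -
  have "lookup (\<Sum>i<n. coeff_embed (c i) * indet i) (single j 1) = (\<Sum>i<n. if i = j then c j else 0)"
    unfolding lookup_sum
    by (intro sum.cong) (auto simp: indet_def mult_single lookup_single when_def)
  then show ?thesis using assms by simp
qed

lemma mon_single_eq_power: "mon (single i e) = (indet i ^ e :: ('i, 'k::comm_ring_1) mpol)"
proof (induction e)
  case (Suc e)
  have "mon (single i (Suc e)) = (indet i * mon (single i e) :: ('i, 'k) mpol)"
    by (simp add: indet_def mon_def mult_single single_add[symmetric])
  then show ?case using Suc by simp
qed (simp add: mon_zero)

text \<open>Coordinates \<open>h\<close> with \<open>h x\<^sub>n = L\<close> are completed from the coefficient vector of \<open>L\<close>, and \<open>g\<close> is
  their inverse.\<close>

lemma linear_form_to_last_variable: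
  fixes L :: "(nat, 'k::field) mpol"
  assumes L: "L \<in> forms n 1" "L \<noteq> 0"
  obtains g where "g \<in> GL n" "gl_act n g L = indet (n - 1)"
proof -
  let ?a = "\<lambda>i. lookup L (single i 1)"
  obtain j where j: "j < n" "?a j \<noteq> 0"
  proof (rule ccontr)
    assume "\<not> thesis"
    then have "?a i = 0" if "i < n" for i using that(1) \<open>\<And>j. j < n \<Longrightarrow> ?a j \<noteq> 0 \<Longrightarrow> thesis\<close> by blast
    then have "L = 0" using linear_form_expand[OF L(1)] by simp
    then show False using L(2) by simp
  qed
  \<comment> \<open>The columns of \<open>h\<close> are the coordinates of \<open>L\<close> and all unit vectors but the \<open>j\<close>-th one.\<close>
  define s where "s = (\<lambda>c. if c = j then n - 1 else c)"
  define h where "h = mat n n (\<lambda>(i, c). if c = n - 1 then ?a i else if i = s c then 1 else 0)"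
  have hc: "h \<in> carrier_mat n n" by (simp add: h_def)
  have "det h \<noteq> 0"
  proof
    assume "det h = 0"
    then obtain v where v: "v \<in> carrier_vec n" "v \<noteq> 0\<^sub>v n" "h *\<^sub>v v = 0\<^sub>v n"
      using det_0_iff_vec_prod_zero_field[OF hc] by blast
    have row: "(\<Sum>c<n - 1. (if i = s c then 1 else 0) * v $ c) + ?a i * v $ (n - 1) = 0" if i: "i < n" for i
    proof -
      have "(h *\<^sub>v v) $ i = (\<Sum>c<n. h $$ (i, c) * v $ c)"
        using i v(1) hc by (auto simp: scalar_prod_def atLeast0LessThan intro!: sum.cong)
      also have "\<dots> = (\<Sum>c<n - 1. h $$ (i, c) * v $ c) + h $$ (i, n - 1) * v $ (n - 1)"
        using j(1) by (cases n) auto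
      also have "(\<Sum>c<n - 1. h $$ (i, c) * v $ c) = (\<Sum>c<n - 1. (if i = s c then 1 else 0) * v $ c)"
        using i by (intro sum.cong) (auto simp: h_def)
      finally have "(h *\<^sub>v v) $ i = (\<Sum>c<n - 1. (if i = s c then 1 else 0) * v $ c) + h $$ (i, n - 1) * v $ (n - 1)" .
      moreover have "h $$ (i, n - 1) = ?a i" using i j(1) by (simp add: h_def)
      ultimately show ?thesis unfolding v(3) using i by simp
    qed
    have "(\<Sum>c<n - 1. (if j = s c then 1 else 0) * v $ c) = 0"
      by (intro sum.neutral) (auto simp: s_def)
    then have last: "v $ (n - 1) = 0" using row[OF j(1)] j(2) by simp
    have "v $ c = 0" if c: "c < n - 1" for c
    proof -
      have "s c < n" using c by (auto simp: s_def)
      moreover have "(\<Sum>c'<n - 1. (if s c = s c' then 1 else 0) * v $ c') = (\<Sum>c'<n - 1. if c' = c then v $ c else 0)"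
        using c by (intro sum.cong) (auto simp: s_def split: if_splits)
      ultimately show ?thesis using row[of "s c"] last c by simp
    qed
    then have "v $ c = 0" if "c < n" for c using last that by (cases "c = n - 1") auto
    then show False using v(1,2) by (auto intro: eq_vecI)
  qed
  then have h: "h \<in> GL n" using hc GL_iff_det by blast
  obtain g where g: "g \<in> GL n" "\<And>p. in_vars {..<n} p \<Longrightarrow> gl_act n g (gl_act n h p) = p"
    using GL_inverse[OF h] by metis
  have "gl_act n h (indet (n - 1)) = (\<Sum>i<n. coeff_embed (?a i) * indet i)"
    unfolding gl_act_eq coord_change_indet using j(1) by (intro sum.cong) (auto simp: h_def)
  then have "gl_act n h (indet (n - 1)) = L" using linear_form_expand[OF L(1)] by simp
  then have "gl_act n g L = indet (n - 1)" using g(2)[of "indet (n - 1)"] j(1) by (auto simp: in_vars_indet)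
  then show ?thesis using that g(1) by blast
qed

subsection \<open>Polynomial dependence of coefficients\<close>

text \<open>Families of polynomials in \<open>x\<close> whose coefficients are polynomial functions of a parameter.\<close>

inductive polyfun_mpol :: "'j set \<Rightarrow> (('j \<Rightarrow> 'k::comm_ring_1) \<Rightarrow> ('i, 'k) mpol) \<Rightarrow> bool" for V where
  single: "polyfun V f \<Longrightarrow> polyfun_mpol V (\<lambda>a. single m (f a))"
| add: "polyfun_mpol V \<Phi> \<Longrightarrow> polyfun_mpol V \<Psi> \<Longrightarrow> polyfun_mpol V (\<lambda>a. \<Phi> a + \<Psi> a)"

lemma polyfun_lookup: "polyfun_mpol V \<Phi> \<Longrightarrow> polyfun V (\<lambda>a. lookup (\<Phi> a) m)"
proof (induction rule: polyfun_mpol.induct)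
  case (single f m')
  then show ?case by (cases "m' = m") (auto simp: lookup_single intro: polyfun.const)
qed (auto simp: lookup_add intro: polyfun.add)

lemma polyfun_mpol_mult:
  assumes "polyfun_mpol V \<Phi>" "polyfun_mpol V \<Psi>"
  shows "polyfun_mpol V (\<lambda>a. \<Phi> a * \<Psi> a)"
  using assms(1)
proof (induction rule: polyfun_mpol.induct)
  case (single f m)
  from assms(2) show ?case
  proof (induction rule: polyfun_mpol.induct)
    case (single f' m')
    then show ?case using \<open>polyfun V f\<close>
      by (simp add: mult_single) (intro polyfun_mpol.single polyfun.mult)
  next
    case (add \<Phi> \<Psi>)
    then show ?case by (simp add: distrib_left polyfun_mpol.add)
  qed
next
  case (add \<Phi>1 \<Phi>2)
  then show ?case by (simp add: distrib_right polyfun_mpol.add)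
qed

lemma polyfun_mpol_zero: "polyfun_mpol V (\<lambda>_. 0)"
  using polyfun_mpol.single[OF polyfun.const[of V 0], of 0] by simp

lemma polyfun_mpol_one: "polyfun_mpol V (\<lambda>_. 1)"
  using polyfun_mpol.single[OF polyfun.const[of V 1], of 0] by simp

lemma polyfun_mpol_sum:
  "(\<And>x. x \<in> S \<Longrightarrow> polyfun_mpol V (\<Phi> x)) \<Longrightarrow> polyfun_mpol V (\<lambda>a. \<Sum>x\<in>S. \<Phi> x a)"
  by (induction S rule: infinite_finite_induct) (auto intro: polyfun_mpol_zero polyfun_mpol.add)

lemma polyfun_mpol_prod:
  "(\<And>x. x \<in> S \<Longrightarrow> polyfun_mpol V (\<Phi> x)) \<Longrightarrow> polyfun_mpol V (\<lambda>a. \<Prod>x\<in>S. \<Phi> x a)"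
  by (induction S rule: infinite_finite_induct) (auto intro: polyfun_mpol_one polyfun_mpol_mult)

lemma polyfun_mpol_power: "polyfun_mpol V \<Phi> \<Longrightarrow> polyfun_mpol V (\<lambda>a. \<Phi> a ^ e)"
  by (induction e) (auto intro: polyfun_mpol_one polyfun_mpol_mult)

lemma polyfun_mpol_const: "polyfun_mpol V (\<lambda>_. p)"
  by (subst mpol_expand[of p]) (intro polyfun_mpol_sum polyfun_mpol.single polyfun.const)

lemma polyfun_mpol_coord_change:
  assumes "in_vars {..<n} p"
  shows "polyfun_mpol ({..<n} \<times> {..<n}) (\<lambda>a. coord_change n a p)"
  unfolding coord_change_def eval_mpol_def using assms
  by (intro polyfun_mpol_sum polyfun_mpol_mult polyfun_mpol_prod polyfun_mpol_power
      polyfun_mpol_const polyfun_mpol.single polyfun.var) (auto simp: in_vars_def)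

section \<open>The generic initial ideal\<close>

lemma gl_act_piece:
  fixes I :: "(nat, 'k::field) mpol set"
  assumes I: "homogeneous_ideal n I" and g: "g \<in> GL n"
  shows "gl_act n g ` I \<inter> forms n d = gl_act n g ` (I \<inter> forms n d)"
proof
  show "gl_act n g ` (I \<inter> forms n d) \<subseteq> gl_act n g ` I \<inter> forms n d"
    by (auto simp: gl_act_eq intro: coord_change_forms)
  show "gl_act n g ` I \<inter> forms n d \<subseteq> gl_act n g ` (I \<inter> forms n d)"
  proof
    fix q assume "q \<in> gl_act n g ` I \<inter> forms n d"
    then obtain p where p: "p \<in> I" "q = gl_act n g p" and q: "q \<in> forms n d" by blast
    obtain h where h: "\<And>p. in_vars {..<n} p \<Longrightarrow> gl_act n h (gl_act n g p) = p"
      using GL_inverse[OF g] by metis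
    have "p = gl_act n h q"
      using h[of p] p polyring_idealD(1)[OF homogeneous_idealD(1)[OF I]] by simp
    then have "p \<in> forms n d" using q by (simp add: gl_act_eq coord_change_forms)
    then show "q \<in> gl_act n g ` (I \<inter> forms n d)" using p by blast
  qed
qed

lemma gl_act_mat: "in_vars {..<n} p \<Longrightarrow> gl_act n (mat n n a) p = coord_change n a p"
  unfolding gl_act_eq by (rule coord_change_cong) auto

lemma one_in_GL: "1\<^sub>m n \<in> GL n"
  by (simp add: GL_iff_det)

lemma leads_transport_indep:
  fixes I :: "(nat, 'k::field) mpol set"
  assumes I: "homogeneous_ideal n I" and g: "g \<in> GL n" and Y: "Y \<subseteq> exps n d"
  obtains p where "\<And>i. i < card (leads (gl_act n g ` I) \<inter> Y) \<Longrightarrow> p i \<in> I \<inter> forms n d"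
    "indep_on Y (card (leads (gl_act n g ` I) \<inter> Y)) (\<lambda>i. lookup (gl_act n g (p i)))"
proof -
  let ?K = "gl_act n g ` I" and ?r = "card (leads (gl_act n g ` I) \<inter> Y)"
  have K: "homogeneous_ideal n ?K" using gl_act_homogeneous_ideal[OF I g] .
  have "finite (leads ?K \<inter> Y)" using Y finite_exps finite_subset by blast
  moreover have "leads ?K \<inter> Y \<subseteq> leads (?K \<inter> forms n d)" using leads_ideal_piece[OF K] Y by blast
  ultimately obtain q where q: "\<And>i. i < ?r \<Longrightarrow> q i \<in> ?K \<inter> forms n d"
    "indep_on Y ?r (\<lambda>i. lookup (q i))"
    using leads_imp_indep[of "leads ?K \<inter> Y" "?K \<inter> forms n d" Y] by blast
  have "\<forall>i. \<exists>p. i < ?r \<longrightarrow> p \<in> I \<inter> forms n d \<and> q i = gl_act n g p"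
    using q(1) unfolding gl_act_piece[OF I g] by blast
  then obtain p where p: "\<And>i. i < ?r \<Longrightarrow> p i \<in> I \<inter> forms n d \<and> q i = gl_act n g (p i)" by metis
  have "indep_on Y ?r (\<lambda>i. lookup (gl_act n g (p i)))"
    using q(2) p by (subst indep_on_cong[where w = "\<lambda>i. lookup (q i)"]) auto
  then show ?thesis using that p by blast
qed

lemma leads_count_ge:
  fixes I :: "(nat, 'k::field) mpol set"
  assumes I: "homogeneous_ideal n I" and g: "g \<in> GL n" and Y: "revlex_upset n d Y"
    and p: "\<And>i. i < r \<Longrightarrow> p i \<in> I \<inter> forms n d"
    and ind: "indep_on Y r (\<lambda>i. lookup (gl_act n g (p i)))"
  shows "r \<le> card (leads (gl_act n g ` I) \<inter> Y)"
proof -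
  let ?K = "gl_act n g ` I"
  have K: "homogeneous_ideal n ?K" using gl_act_homogeneous_ideal[OF I g] .
  have "r \<le> card (leads (?K \<inter> forms n d) \<inter> Y)"
  proof (rule indep_le_card_leads[OF _ _ Y _ ind])
    show "subspace (?K \<inter> forms n d)" using K by (intro subspace_ideal_piece homogeneous_idealD)
    show "gl_act n g (p i) \<in> ?K \<inter> forms n d" if "i < r" for i
      using p[OF that] gl_act_piece[OF I g, of d] by blast
  qed blast
  also have "leads (?K \<inter> forms n d) \<inter> Y = leads ?K \<inter> Y"
    using leads_ideal_piece[OF K, of d] Y unfolding revlex_upset_def by blast
  finally show ?thesis .
qed

text \<open>Both numbers are the dimension of \<open>I\<close> in degree \<open>d\<close>.\<close>

lemma card_leads_degree_invariant:
  fixes I :: "(nat, 'k::field) mpol set"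
  assumes I: "homogeneous_ideal n I" and g: "g \<in> GL n" and h: "h \<in> GL n"
  shows "card (leads (gl_act n g ` I) \<inter> exps n d) = card (leads (gl_act n h ` I) \<inter> exps n d)"
proof -
  have "card (leads (gl_act n g ` I) \<inter> exps n d) \<le> card (leads (gl_act n h ` I) \<inter> exps n d)"
    if g: "g \<in> GL n" and h: "h \<in> GL n" for g h
  proof -
    let ?r = "card (leads (gl_act n g ` I) \<inter> exps n d)"
    obtain p where p: "\<And>i. i < ?r \<Longrightarrow> p i \<in> I \<inter> forms n d"
      "indep_on (exps n d) ?r (\<lambda>i. lookup (gl_act n g (p i)))"
      using leads_transport_indep[OF I g subset_refl] by blast
    obtain h' where h': "\<And>p. in_vars {..<n} p \<Longrightarrow> gl_act n h' (gl_act n h p) = p"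
      using GL_inverse[OF h] by metis
    have lin: "gl_act n a (\<Sum>i<?r. coeff_embed (c i) * p i) = (\<Sum>i<?r. coeff_embed (c i) * gl_act n a (p i))"
      for a c by (simp add: gl_act_eq coord_change_sum coord_change_mult coord_change_const)
    have "indep_on (exps n d) ?r (\<lambda>i. lookup (gl_act n h (p i)))"
      unfolding indep_on_def
    proof (rule allI, rule impI)
      fix c assume c: "\<forall>y\<in>exps n d. (\<Sum>i<?r. c i * lookup (gl_act n h (p i)) y) = 0"
      let ?w = "\<Sum>i<?r. coeff_embed (c i) * p i"
      have w: "?w \<in> forms n d" using p(1) by (intro forms_sum forms_scale) auto
      have "gl_act n h ?w = 0"
      proof (rule poly_mapping_eqI)
        fix y
        show "lookup (gl_act n h ?w) y = lookup 0 y"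
        proof (cases "y \<in> exps n d")
          case True
          then show ?thesis using c unfolding lin by (simp add: lookup_sum lookup_const_times)
        next
          case False
          moreover have "gl_act n h ?w \<in> forms n d" using w unfolding gl_act_eq by (rule coord_change_forms)
          ultimately have "y \<notin> keys (gl_act n h ?w)" by (auto simp: forms_iff)
          then show ?thesis by (simp add: in_keys_iff)
        qed
      qed
      then have "?w = gl_act n h' 0" using h'[OF forms_in_vars[OF w]] by simp
      then have "?w = 0" by (simp add: gl_act_eq coord_change_zero)
      then have "gl_act n g ?w = 0" by (simp add: gl_act_eq coord_change_zero)
      then have "(\<Sum>i<?r. c i * lookup (gl_act n g (p i)) y) = 0" for y
        using lookup_sum[of "\<lambda>i. coeff_embed (c i) * gl_act n g (p i)" "{..<?r}" y]
        unfolding lin by (simp only: lookup_const_times lookup_zero)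
      then show "\<forall>i<?r. c i = 0" using indep_onD[OF p(2), of c] by blast
    qed
    then show ?thesis using leads_count_ge[OF I h revlex_upset_all, of ?r p] p(1) by blast
  qed
  then show ?thesis using g h by (simp add: le_antisym)
qed

text \<open>Whether \<open>m\<close> belongs to a set is seen by comparing the counts for the exponents \<open>\<ge> m\<close> and for
  those \<open>> m\<close>.\<close>

lemma exponent_sets_eqI:
  assumes E: "\<And>m. m \<in> E \<Longrightarrow> m \<in> exps n (mdeg m)" "\<And>m. m \<in> E' \<Longrightarrow> m \<in> exps n (mdeg m)"
    and count: "\<And>d Y. revlex_upset n d Y \<Longrightarrow> card (E \<inter> Y) = card (E' \<inter> Y)"
  shows "E = E'"
proof -
  have "m \<in> E \<longleftrightarrow> m \<in> E'" if m: "m \<in> exps n d" for m d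
  proof -
    let ?Y = "{z \<in> exps n d. revlex_less m z}"
    have up: "revlex_upset n d ?Y" "revlex_upset n d (insert m ?Y)"
      using m revlex_less_trans unfolding revlex_upset_def by blast+
    have "card (A \<inter> insert m ?Y) = card (A \<inter> ?Y) + (if m \<in> A then 1 else 0)" for A
    proof (cases "m \<in> A")
      case True
      have "finite (A \<inter> ?Y)" "m \<notin> A \<inter> ?Y" using revlex_upset_finite[OF up(1)] revlex_less_irrefl by auto
      then have "card (insert m (A \<inter> ?Y)) = card (A \<inter> ?Y) + 1" by simp
      then show ?thesis using True by simp
    qed simp
    from this[of E] this[of E'] show ?thesis
      using count[OF up(1)] count[OF up(2)] by (cases "m \<in> E"; cases "m \<in> E'") auto
  qed
  then show ?thesis using E by blast
qed

text \<open>For each of the finitely many pairs of a degree \<open>d < D\<close> and an upward closed set \<open>Y\<close>, choose \<open>g\<close>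
  for which the number of leading exponents in \<open>Y\<close> is maximal.  By \<open>indep_on_open\<close> it remains maximal
  where some polynomial function does not vanish, and \<open>F\<close> is the product of these functions and the
  determinant.  From degree \<open>D\<close> on all exponents are leading exponents.\<close>

lemma generic_leads:
  fixes I :: "(nat, 'k::field_char_0) mpol set"
  assumes I: "homogeneous_ideal n I" and D: "\<And>d. d \<ge> D \<Longrightarrow> forms n d \<subseteq> I"
  obtains F E where "polyfun ({..<n} \<times> {..<n}) F" "\<exists>a. F a \<noteq> 0"
    "\<And>a. F a \<noteq> 0 \<Longrightarrow> mat n n a \<in> GL n"
    "\<And>a. F a \<noteq> 0 \<Longrightarrow> leads (gl_act n (mat n n a) ` I) = E"
    "\<And>g d Y. g \<in> GL n \<Longrightarrow> revlex_upset n d Y \<Longrightarrow> card (leads (gl_act n g ` I) \<inter> Y) \<le> card (E \<inter> Y)"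
proof -
  let ?V = "{..<n} \<times> {..<n}"
  let ?E = "\<lambda>g. leads (gl_act n g ` I)"
  define S where "S = (SIGMA d:{..<D}. {Y. revlex_upset n d Y})"
  have "finite S"
    unfolding S_def
  proof (intro finite_SigmaI finite_lessThan)
    fix d
    have "{Y. revlex_upset n d Y} \<subseteq> Pow (exps n d)" by (auto simp: revlex_upset_def)
    then show "finite {Y. revlex_upset n d Y}" by (rule finite_subset) (simp add: finite_exps)
  qed
  have det_mat: "(det (mat n n a) :: 'k) \<noteq> 0 \<longleftrightarrow> mat n n a \<in> GL n" for a
    by (simp add: GL_iff_det)
  have "\<exists>f. polyfun ?V f \<and> (\<exists>a. f a \<noteq> 0) \<and> (\<forall>a. f a \<noteq> 0 \<longrightarrow> mat n n a \<in> GL n \<longrightarrow>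
      (\<forall>g\<in>GL n. card (?E g \<inter> snd s) \<le> card (?E (mat n n a) \<inter> snd s)))" if s: "s \<in> S" for s
  proof -
    obtain d Y where dY: "s = (d, Y)" "revlex_upset n d Y" using s by (auto simp: S_def)
    have "card (?E g \<inter> Y) < Suc (card Y)" for g
      using revlex_upset_finite[OF dY(2)] by (simp add: less_Suc_eq_le card_mono)
    then obtain g where g: "g \<in> GL n" "\<And>g'. g' \<in> GL n \<Longrightarrow> card (?E g' \<inter> Y) \<le> card (?E g \<inter> Y)"
      using ex_has_greatest_nat[of "\<lambda>g. g \<in> GL n" "1\<^sub>m n" "\<lambda>g. card (?E g \<inter> Y)" "Suc (card Y)"] one_in_GL
      by blast
    let ?r = "card (?E g \<inter> Y)"
    obtain p where p: "\<And>i. i < ?r \<Longrightarrow> p i \<in> I \<inter> forms n d"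
      "indep_on Y ?r (\<lambda>i. lookup (gl_act n g (p i)))"
      using leads_transport_indep[OF I g(1), of Y d] dY(2) unfolding revlex_upset_def by blast
    have vars: "in_vars {..<n} (p i)" if "i < ?r" for i using p(1)[OF that] forms_in_vars by blast
    obtain f where f: "polyfun ?V f" "f (\<lambda>ij. g $$ ij) \<noteq> 0"
      "\<And>a. f a \<noteq> 0 \<Longrightarrow> indep_on Y ?r (\<lambda>i. lookup (coord_change n a (p i)))"
    proof (rule indep_on_open[of ?r Y ?V "\<lambda>a i. lookup (coord_change n a (p i))"])
      show "polyfun ?V (\<lambda>a. lookup (coord_change n a (p i)) y)" if "i < ?r" for i y
        using vars[OF that] by (intro polyfun_lookup polyfun_mpol_coord_change)
      show "indep_on Y ?r (\<lambda>i. lookup (coord_change n (\<lambda>ij. g $$ ij) (p i)))"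
        using p(2) by (simp add: gl_act_eq)
    qed blast
    have "card (?E g' \<inter> Y) \<le> card (?E (mat n n a) \<inter> Y)"
      if a: "f a \<noteq> 0" "mat n n a \<in> GL n" and g': "g' \<in> GL n" for a g'
    proof -
      have "indep_on Y ?r (\<lambda>i. lookup (gl_act n (mat n n a) (p i)))"
        using f(3)[OF a(1)] gl_act_mat[OF vars, of _ a]
        by (subst indep_on_cong[where w = "\<lambda>i. lookup (coord_change n a (p i))"]) auto
      then have "?r \<le> card (?E (mat n n a) \<inter> Y)"
        using leads_count_ge[OF I a(2) dY(2), of ?r p] p(1) by blast
      then show ?thesis using g(2)[OF g'] by simp
    qed
    then show ?thesis using f(1,2) dY(1) by auto
  qed
  then have "\<forall>s\<in>S. \<exists>f. polyfun ?V f \<and> (\<exists>a. f a \<noteq> 0) \<and> (\<forall>a. f a \<noteq> 0 \<longrightarrow> mat n n a \<in> GL n \<longrightarrow>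
      (\<forall>g\<in>GL n. card (?E g \<inter> snd s) \<le> card (?E (mat n n a) \<inter> snd s)))" by blast
  from bchoice[OF this] obtain f where f: "\<And>s. s \<in> S \<Longrightarrow> polyfun ?V (f s)" "\<And>s. s \<in> S \<Longrightarrow> \<exists>a. f s a \<noteq> 0"
    "\<And>s a g. s \<in> S \<Longrightarrow> f s a \<noteq> 0 \<Longrightarrow> mat n n a \<in> GL n \<Longrightarrow> g \<in> GL n \<Longrightarrow>
      card (?E g \<inter> snd s) \<le> card (?E (mat n n a) \<inter> snd s)" by blast
  define F where "F = (\<lambda>a. (\<Prod>s\<in>S. f s a) * det (mat n n a))"
  have F: "polyfun ?V F"
    unfolding F_def using f(1) by (intro polyfun.mult polyfun_prod polyfun_det)
  obtain a1 where a1: "(\<Prod>s\<in>S. f s a1) \<noteq> 0"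
    using polyfun_prod_nonzero[OF \<open>finite S\<close>, of ?V f] f(1,2) by blast
  have one: "det (mat n n (\<lambda>ij. 1\<^sub>m n $$ ij) :: 'k mat) \<noteq> 0"
  proof -
    have "mat n n (\<lambda>ij. 1\<^sub>m n $$ ij) = (1\<^sub>m n :: 'k mat)" by (rule eq_matI) auto
    then show ?thesis by simp
  qed
  have "polyfun ?V (\<lambda>a. \<Prod>s\<in>S. f s a)" using f(1) by (rule polyfun_prod)
  from polyfun_common_nonzero[OF this a1 polyfun_det one]
  obtain a0 where "(\<Prod>s\<in>S. f s a0) \<noteq> 0" "det (mat n n a0) \<noteq> 0" by blast
  then have a0: "F a0 \<noteq> 0" by (simp add: F_def)
  have GL: "mat n n a \<in> GL n" if "F a \<noteq> 0" for a using that det_mat[of a] by (auto simp: F_def)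
  have max: "card (?E g \<inter> Y) \<le> card (?E (mat n n a) \<inter> Y)"
    if a: "F a \<noteq> 0" and g: "g \<in> GL n" and Y: "revlex_upset n d Y" for a g d Y
  proof (cases "d < D")
    case True
    then have "(d, Y) \<in> S" using Y by (simp add: S_def)
    moreover have "f (d, Y) a \<noteq> 0" using a \<open>finite S\<close> calculation by (auto simp: F_def)
    ultimately show ?thesis using f(3)[of "(d, Y)" a g] GL[OF a] g by simp
  next
    case False
    let ?K = "gl_act n (mat n n a) ` I"
    have K: "homogeneous_ideal n ?K" using gl_act_homogeneous_ideal[OF I GL[OF a]] .
    obtain h where h: "\<And>p. in_vars {..<n} p \<Longrightarrow> gl_act n (mat n n a) (gl_act n h p) = p"
      using GL_inverse[OF GL[OF a]] by metis
    have "forms n d \<subseteq> ?K \<inter> forms n d"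
    proof
      fix p :: "(nat, 'k) mpol" assume p: "p \<in> forms n d"
      then have "gl_act n h p \<in> I" using D[of d] False coord_change_forms[OF p] by (auto simp: gl_act_eq)
      then show "p \<in> ?K \<inter> forms n d" using h[OF forms_in_vars[OF p]] p by (metis IntI imageI)
    qed
    then have "exps n d \<subseteq> leads (?K \<inter> forms n d)"
      using forms_subset_iff_leads[of "?K \<inter> forms n d" n d] K
      by (simp add: subspace_ideal_piece homogeneous_idealD)
    then have "?E (mat n n a) \<inter> Y = Y"
      using Y leads_ideal_piece[OF K, of d] unfolding revlex_upset_def by blast
    then show ?thesis using revlex_upset_finite[OF Y] by (simp add: card_mono)
  qed
  have eq: "?E (mat n n a) = ?E (mat n n a0)" if a: "F a \<noteq> 0" for a
  proof (rule exponent_sets_eqI)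
    show "m \<in> exps n (mdeg m)" if "m \<in> ?E (mat n n a)" for m
      using leads_exps[OF gl_act_homogeneous_ideal[OF I GL[OF a]] that] .
    show "m \<in> exps n (mdeg m)" if "m \<in> ?E (mat n n a0)" for m
      using leads_exps[OF gl_act_homogeneous_ideal[OF I GL[OF a0]] that] .
    show "card (?E (mat n n a) \<inter> Y) = card (?E (mat n n a0) \<inter> Y)" if "revlex_upset n d Y" for d Y
      using max[OF a GL[OF a0] that] max[OF a0 GL[OF a] that] by simp
  qed
  show ?thesis
  proof (rule that)
    show "\<exists>a. F a \<noteq> 0" using a0 by blast
  qed (fact F GL eq max[OF a0])+
qed

text \<open>\<open>F\<close> describes an open set of coordinates in which the leading exponents of \<open>I\<close> have their generic
  value \<open>E\<close>.  Later arguments deform coordinates inside this set, so that it has to be given by a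
  function on all matrices.\<close>

locale generic_leading_exponents =
  fixes n :: nat and I :: "(nat, 'k::field_char_0) mpol set"
    and F :: "(nat \<times> nat \<Rightarrow> 'k) \<Rightarrow> 'k" and E :: "(nat \<Rightarrow>\<^sub>0 nat) set"
  assumes n: "n \<ge> 2" and I: "homogeneous_ideal n I"
    and forms_in_I: "\<exists>D. \<forall>d\<ge>D. forms n d \<subseteq> I"
    and F: "polyfun ({..<n} \<times> {..<n}) F" "\<exists>a. F a \<noteq> 0"
    and F_GL: "F a \<noteq> 0 \<Longrightarrow> mat n n a \<in> GL n"
    and F_leads: "F a \<noteq> 0 \<Longrightarrow> leads (gl_act n (mat n n a) ` I) = E"
    and leads_max: "g \<in> GL n \<Longrightarrow> revlex_upset n d Y \<Longrightarrow> card (leads (gl_act n g ` I) \<inter> Y) \<le> card (E \<inter> Y)"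
begin

lemma generic_point:
  obtains g where "g \<in> GL n" "leads (gl_act n g ` I) = E"
  using F(2) F_GL F_leads by blast

lemma E_add: "m \<in> E \<Longrightarrow> keys s \<subseteq> {..<n} \<Longrightarrow> s + m \<in> E"
  using generic_point leads_add homogeneous_idealD(1)[OF gl_act_homogeneous_ideal[OF I]] by metis

lemma card_E_degree: "g \<in> GL n \<Longrightarrow> card (leads (gl_act n g ` I) \<inter> exps n d) = card (E \<inter> exps n d)"
  using generic_point card_leads_degree_invariant[OF I] by metis

text \<open>Surjectivity of multiplication by \<open>x\<^sub>n\<^sup>i\<close> is a condition of this form, so it passes from special to
  generic coordinates.\<close>

lemma upset_transfer:
  assumes "g \<in> GL n" "revlex_upset n d Y" "Y \<subseteq> leads (gl_act n g ` I)"
  shows "Y \<subseteq> E"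
proof -
  have "card Y \<le> card (E \<inter> Y)"
    using leads_max[OF assms(1,2)] assms(3) by (simp add: Int_absorb1)
  then have "E \<inter> Y = Y"
    using revlex_upset_finite[OF assms(2)] by (intro card_seteq) auto
  then show ?thesis by blast
qed

lemma gin_eq: "gin n I = {p. keys p \<subseteq> E}"
  unfolding gin_def
proof (rule generic_value_eq[where G = "\<lambda>a. det (mat n n a)"])
  obtain a where a: "F a \<noteq> 0" using F(2) by blast
  have coords: "F (\<lambda>ij. mat n n b $$ ij) = F b" for b
    by (rule polyfun_cong[OF F(1)]) auto
  have mat: "mat n n (\<lambda>ij. g $$ ij) = g" if "g \<in> GL n" for g :: "'k mat"
    using that by (intro eq_matI) (auto simp: GL_def)
  show "generic_matrix n (\<lambda>g. initial_ideal n (gl_act n g ` I) = {p. keys p \<subseteq> E})"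
  proof (rule holds_generically_principal[OF F(1)])
    show "mat n n a \<in> GL n" "F (\<lambda>ij. mat n n a $$ ij) \<noteq> 0" using F_GL[OF a] a coords by auto
    fix g assume g: "g \<in> GL n" "F (\<lambda>ij. g $$ ij) \<noteq> 0"
    then have "leads (gl_act n g ` I) = E" using F_leads mat by metis
    then show "initial_ideal n (gl_act n g ` I) = {p. keys p \<subseteq> E}"
      using initial_ideal_eq[OF gl_act_homogeneous_ideal[OF I g(1)]] by simp
  qed
  show "polyfun ({..<n} \<times> {..<n}) (\<lambda>a. det (mat n n a) :: 'k)" by (rule polyfun_det)
  show "det (mat n n (\<lambda>ij. g $$ ij)) \<noteq> 0" if "g \<in> GL n" for g :: "'k mat"
    using that mat[OF that] by (simp add: GL_iff_det)
  show "\<exists>g\<in>GL n. \<forall>j\<in>{..<n} \<times> {..<n}. g $$ j = b j" if "det (mat n n b) \<noteq> 0" for b :: "nat \<times> nat \<Rightarrow> 'k"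
    using that by (intro bexI[of _ "mat n n b"]) (auto simp: GL_iff_det)
qed

lemma mon_in_gin_iff: "mon m \<in> gin n I \<longleftrightarrow> m \<in> E"
  by (simp add: gin_eq keys_mon)

end

section \<open>Stability of the generic initial ideal\<close>

context generic_leading_exponents
begin

text \<open>The monomial \<open>x\<^bsub>n-1\<^esub>\<^sup>m x\<^sub>n\<^sup>t\<close> is the smallest of its degree that is not divisible by \<open>x\<^sub>n\<^bsup>t+1\<^esup>\<close>.\<close>

lemma revlex_below_last_two:
  assumes k: "k \<in> exps n (m + t)" and less: "revlex_less k (single (n - 2) m + single (n - 1) t)"
  shows "lookup k (n - 1) \<ge> Suc t"
proof -
  let ?w = "single (n - 2) m + single (n - 1) t"
  have n12: "n - 1 \<noteq> n - 2" "n - 2 < n" "n - 1 < n" using n by auto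
  have deg: "(\<Sum>i<n. lookup k i) = m + t"
    using k mdeg_superset[of "{..<n}" k] by (auto simp: exps_def)
  have w: "lookup ?w i = (if i = n - 2 then m else if i = n - 1 then t else 0)" for i
    using n12 by (auto simp: lookup_add lookup_single)
  have "mdeg ?w = m + t" by (simp add: mdeg_add mdeg_single)
  then obtain j where j: "lookup k j > lookup ?w j" "\<forall>i>j. lookup k i = lookup ?w i"
    using less k by (auto simp: revlex_less_def exps_def)
  have "j \<in> keys k" using j(1) by (auto simp: in_keys_iff)
  then have jn: "j < n" using k by (auto simp: exps_def)
  have sub: "(\<Sum>i\<in>A. lookup k i) \<le> m + t" if "A \<subseteq> {..<n}" for A
    using that sum_mono2[of "{..<n}" A "lookup k"] deg by simp
  consider "j = n - 1" | "j = n - 2" | "j < n - 2" using jn by linarith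
  then show ?thesis
  proof cases
    case 1
    then show ?thesis using j(1) w[of j] n12 by auto
  next
    case 2
    then have "lookup k (n - 2) > m" "lookup k (n - 1) = t" using j w n12 by auto
    then show ?thesis using sub[of "{n - 2, n - 1}"] n12 by simp
  next
    case 3
    then have "lookup k j > 0" "lookup k (n - 2) = m" "lookup k (n - 1) = t" using j w n12 by auto
    then show ?thesis using sub[of "{j, n - 2, n - 1}"] n12 3 by simp
  qed
qed

lemma generic_element_with_lead:
  assumes w: "single (n - 2) m + single (n - 1) t \<in> E" and a: "F a \<noteq> 0"
  obtains p r where "p \<in> I" "in_vars {..<n} r"
    "coord_change n a p = indet (n - 2) ^ m * indet (n - 1) ^ t + indet (n - 1) ^ Suc t * r"
proof -
  let ?w = "single (n - 2) m + single (n - 1) t" and ?K = "gl_act n (mat n n a) ` I"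
  have KI: "homogeneous_ideal n ?K" using gl_act_homogeneous_ideal[OF I F_GL[OF a]] .
  have wd: "?w \<in> exps n (m + t)" using n by (auto simp: exps_def mdeg_add mdeg_single keys_exp_add)
  then have "?w \<in> leads (?K \<inter> forms n (m + t))"
    using w F_leads[OF a] leads_ideal_piece[OF KI] by auto
  then obtain f where f: "f \<in> ?K \<inter> forms n (m + t)" "f \<noteq> 0" "lead_exp f = ?w" by (rule leadsE)
  define c where "c = lookup f ?w"
  have c: "c \<noteq> 0" using lookup_lead_exp[OF f(2)] f(3) by (simp add: c_def)
  define f' where "f' = coeff_embed (1 / c) * f"
  have f'K: "f' \<in> ?K"
    unfolding f'_def using f(1)
    by (intro polyring_idealD(4)[OF homogeneous_idealD(1)[OF KI]] in_vars_const) auto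
  then obtain p where p: "p \<in> I" "f' = gl_act n (mat n n a) p" by blast
  have "in_vars {..<n} p" using p(1) polyring_idealD(1)[OF homogeneous_idealD(1)[OF I]] by blast
  then have pa: "coord_change n a p = f'" using p(2) gl_act_mat by metis
  have lk: "lookup (f' - mon ?w) k = (if k = ?w then 0 else lookup f k / c)" for k
    using c by (auto simp: f'_def lookup_minus lookup_const_times lookup_mon c_def)
  have kf: "k \<in> keys f" "k \<noteq> ?w" if "k \<in> keys (f' - mon ?w)" for k
  proof -
    have "(if k = ?w then 0 else lookup f k / c) \<noteq> 0"
      using that lk[of k] by (simp only: in_keys_iff not_False_eq_True)
    then show "k \<in> keys f" "k \<noteq> ?w" by (simp_all add: in_keys_iff split: if_splits)
  qed
  have "in_vars {..<n} (f' - mon ?w)"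
  proof -
    have "keys k \<subseteq> {..<n}" if "k \<in> keys f" for k
      using f(1) that by (auto simp: forms_iff exps_def)
    then show ?thesis using kf(1) unfolding in_vars_def by blast
  qed
  moreover have "Suc t \<le> lookup k (n - 1)" if "k \<in> keys (f' - mon ?w)" for k
  proof (rule revlex_below_last_two)
    note k = kf[OF that]
    show "k \<in> exps n (m + t)" using f(1) k(1) by (auto simp: forms_iff)
    show "revlex_less k ?w" using lead_exp_props(2)[OF f(2) k(1)] k(2) f(3) by simp
  qed
  ultimately obtain r where r: "in_vars {..<n} r" "f' - mon ?w = mon (single (n - 1) (Suc t)) * r"
    using divisible_by_last_power[of "{..<n}" "f' - mon ?w" "Suc t" "n - 1"] by blast
  have "f' = mon ?w + mon (single (n - 1) (Suc t)) * r" using r(2) by (simp add: algebra_simps)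
  also have "\<dots> = indet (n - 2) ^ m * indet (n - 1) ^ t + indet (n - 1) ^ Suc t * r"
    by (simp only: mon_add mon_single_eq_power)
  finally show ?thesis using that p(1) r(1) pa by metis
qed

text \<open>If \<open>x\<^bsub>n-1\<^esub>\<^sup>m x\<^sub>n\<^sup>t\<close> is a leading monomial in generic coordinates, then in a fixed generic system
  \<open>l\<^sup>m x\<^sub>n\<^sup>t\<close> lies in the ideal modulo \<open>x\<^sub>n\<^bsup>t+1\<^esup>\<close> for generic linear forms
  \<open>l = x\<^bsub>n-1\<^esub> + \<Sum>\<^sub>i \<gamma>\<^sub>i x\<^sub>i\<close>: shearing \<open>x\<^bsub>n-1\<^esub>\<close> into \<open>l\<close> leads to further generic coordinates with the same
  \<open>x\<^sub>n\<close>.  In characteristic zero the powers \<open>l\<^sup>m\<close> span the forms of degree \<open>m\<close> in \<open>x\<^sub>1, \<dots>, x\<^bsub>n-1\<^esub>\<close>,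
  so \<open>l\<^sup>m\<close> may be replaced by every monomial of degree \<open>m\<close> in them.\<close>

lemma E_stable:
  assumes w: "single (n - 2) m + single (n - 1) t \<in> E"
    and v: "v \<in> exps n (m + t)" "lookup v (n - 1) = t"
  shows "v \<in> E"
proof -
  obtain a0 where a0: "F a0 \<noteq> 0" using F(2) by blast
  let ?K = "gl_act n (mat n n a0) ` I"
  have K: "homogeneous_ideal n ?K" using gl_act_homogeneous_ideal[OF I F_GL[OF a0]] .
  note KD = polyring_idealD[OF homogeneous_idealD(1)[OF K]]
  have n12: "n - 1 \<noteq> n - 2" "n - 2 < n" "n - 1 < n" using n by auto
  let ?x = "indet (n - 1) :: (nat, 'k) mpol" and ?y = "indet (n - 2) :: (nat, 'k) mpol"
  define W where "W = {h. \<exists>r. in_vars {..<n} r \<and> h * ?x ^ t - ?x ^ Suc t * r \<in> ?K}"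
  have W: "subspace W"
    using subspace_linear_congruence[of UNIV "{r. in_vars {..<n} r}" ?K "?x ^ t" "?x ^ Suc t"]
      subspace_ideal[OF homogeneous_idealD(1)[OF K]]
    by (simp only: W_def mem_Collect_eq UNIV_I simp_thms Bex_def)
       (simp add: subspace_def in_vars_zero in_vars_add in_vars_mult in_vars_const)
  \<comment> \<open>The coordinates in which the shear \<open>b\<close> below, which takes \<open>x\<^bsub>n-1\<^esub>\<close> to \<open>l \<gamma>\<close>, has been undone.\<close>
  define sheared where "sheared = (\<lambda>\<gamma> (i, j). a0 (i, j) - \<gamma> i * a0 (n - 2, j))"
  define l where "l = (\<lambda>\<gamma>. ?y + (\<Sum>i<n. coeff_embed (\<gamma> i) * indet i))"
  have power_in_W: "l \<gamma> ^ m \<in> W" if \<gamma>: "\<gamma> (n - 2) = 0" "F (sheared \<gamma>) \<noteq> 0" for \<gamma>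
  proof -
    obtain p r where p: "p \<in> I" "in_vars {..<n} r"
      "coord_change n (sheared \<gamma>) p = ?y ^ m * ?x ^ t + ?x ^ Suc t * r"
      using generic_element_with_lead[OF w \<gamma>(2)] by blast
    define b where "b = (\<lambda>(i, j). (if i = j then 1 else 0) + (if j = n - 2 then \<gamma> i else 0))"
    have pv: "in_vars {..<n} p" using p(1) polyring_idealD(1)[OF homogeneous_idealD(1)[OF I]] by blast
    have "(\<Sum>l<n. b (i, l) * sheared \<gamma> (l, j)) = a0 (i, j)" if "i < n" "j < n" for i j
    proof -
      have "(\<Sum>l<n. b (i, l) * sheared \<gamma> (l, j)) =
          (\<Sum>l<n. (if l = i then sheared \<gamma> (i, j) else 0) + (if l = n - 2 then \<gamma> i * sheared \<gamma> (n - 2, j) else 0))"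
        by (intro sum.cong) (auto simp: b_def algebra_simps)
      also have "\<dots> = sheared \<gamma> (i, j) + \<gamma> i * sheared \<gamma> (n - 2, j)"
        using that n12 by (simp add: sum.distrib)
      finally show ?thesis using \<gamma>(1) by (simp add: sheared_def)
    qed
    then have "coord_change n b (coord_change n (sheared \<gamma>) p) = coord_change n a0 p"
      unfolding coord_change_comp by (intro coord_change_cong[OF pv]) simp
    moreover have "coord_change n b ?y = l \<gamma>"
    proof -
      have "coord_change n b ?y = (\<Sum>i<n. (if i = n - 2 then ?y else 0) + coeff_embed (\<gamma> i) * indet i)"
        unfolding coord_change_indet by (intro sum.cong) (auto simp: b_def single_add algebra_simps)
      then show ?thesis using n12 by (simp add: l_def sum.distrib)
    qed
    moreover have "coord_change n b ?x = ?x"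
    proof -
      have "coord_change n b ?x = (\<Sum>i<n. if i = n - 1 then ?x else 0)"
        unfolding coord_change_indet using n12 by (intro sum.cong) (auto simp: b_def)
      then show ?thesis using n12 by simp
    qed
    ultimately have "coord_change n a0 p = l \<gamma> ^ m * ?x ^ t + ?x ^ Suc t * coord_change n b r"
      unfolding p(3) by (simp only: coord_change_add coord_change_mult coord_change_power)
    moreover have "coord_change n a0 p \<in> ?K" using gl_act_mat[OF pv, of a0] p(1) by (metis imageI)
    ultimately have "l \<gamma> ^ m * ?x ^ t - ?x ^ Suc t * (- coord_change n b r) \<in> ?K" by simp
    then show ?thesis
      unfolding W_def using in_vars_uminus[OF coord_change_in_vars[OF p(2), of b]] by blast
  qed
  \<comment> \<open>The parameters \<open>\<gamma>\<^sub>s\<close> are eliminated one at a time: for fixed other parameters, almost every value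
    \<open>\<tau>\<close> of \<open>\<gamma>\<^sub>s\<close> is admissible, and the coefficients of the powers of \<open>\<tau>\<close> in \<open>(l + \<tau> x\<^sub>s)\<^sup>M x\<^bsup>\<beta>'\<^esup>\<close> lie in \<open>W\<close>.\<close>
  have eliminate: "\<forall>\<gamma> \<beta>. (\<forall>i\<ge>s. \<gamma> i = 0) \<longrightarrow> F (sheared \<gamma>) \<noteq> 0 \<longrightarrow> keys \<beta> \<subseteq> {s..<n - 2} \<longrightarrow>
      mdeg \<beta> \<le> m \<longrightarrow> l \<gamma> ^ (m - mdeg \<beta>) * mon \<beta> \<in> W" if "s \<le> n - 2" for s
    using that
  proof (induction s rule: inc_induct)
    case base
    then show ?case using power_in_W by (auto simp: mdeg_zero mon_zero)
  next
    case (step s)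
    show ?case
    proof (intro allI impI)
      fix \<gamma> :: "nat \<Rightarrow> 'k" and \<beta> :: "nat \<Rightarrow>\<^sub>0 nat"
      assume \<gamma>: "\<forall>i\<ge>s. \<gamma> i = 0" "F (sheared \<gamma>) \<noteq> 0"
        and \<beta>: "keys \<beta> \<subseteq> {s..<n - 2}" "mdeg \<beta> \<le> m"
      define k where "k = lookup \<beta> s"
      define \<beta>' where "\<beta>' = \<beta> - single s k"
      have \<beta>_split: "\<beta> = single s k + \<beta>'"
        by (rule poly_mapping_eqI) (auto simp: \<beta>'_def k_def lookup_add lookup_minus lookup_single when_def)
      have keys': "keys \<beta>' \<subseteq> {Suc s..<n - 2}"
      proof
        fix i assume "i \<in> keys \<beta>'"
        then have "lookup \<beta> i \<noteq> 0" "i \<noteq> s"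
          by (auto simp: \<beta>'_def k_def in_keys_iff lookup_minus lookup_single when_def split: if_splits)
        then have "i \<in> keys \<beta>" by (simp add: in_keys_iff)
        then have "i \<in> {s..<n - 2}" using \<beta>(1) by blast
        then show "i \<in> {Suc s..<n - 2}" using \<open>i \<noteq> s\<close> by auto
      qed
      have deg: "mdeg \<beta> = k + mdeg \<beta>'"
        using mdeg_add[of "single s k" \<beta>'] by (simp add: \<beta>_split[symmetric] mdeg_single)
      define M where "M = m - mdeg \<beta>'"
      have kM: "k \<le> M" "M - k = m - mdeg \<beta>" using deg \<beta>(2) by (auto simp: M_def)
      let ?T = "{\<tau>. F (sheared (\<gamma>(s := \<tau>))) \<noteq> 0}"
      have "sheared (\<gamma>(s := \<tau>)) = (\<lambda>ij. sheared \<gamma> ij + \<tau> * (if fst ij = s then - a0 (n - 2, snd ij) else 0))" for \<tau>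
        using \<gamma>(1) by (auto simp: sheared_def fun_eq_iff)
      then have "finite {\<tau>. F (sheared (\<gamma>(s := \<tau>))) = 0}"
        using finite_zeros_on_line[where f = F and a = "sheared \<gamma>"
            and b = "\<lambda>ij. if fst ij = s then - a0 (n - 2, snd ij) else 0", OF F(1) \<gamma>(2)]
        by (simp only:)
      moreover have "?T = UNIV - {\<tau>. F (sheared (\<gamma>(s := \<tau>))) = 0}" by blast
      ultimately have T: "infinite ?T"
        using infinite_UNIV_char_0 by (metis Diff_infinite_finite)
      define u where "u = (\<lambda>j. of_nat (M choose j) * indet s ^ j * l \<gamma> ^ (M - j) * mon \<beta>')"
      have "(\<Sum>j\<le>M. coeff_embed (\<tau> ^ j) * u j) \<in> W" if \<tau>: "\<tau> \<in> ?T" for \<tau>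
      proof -
        have "l (\<gamma>(s := \<tau>)) = ?y + (\<Sum>i<n. coeff_embed (\<gamma> i) * indet i + (if i = s then coeff_embed \<tau> * indet s else 0))"
          unfolding l_def using \<gamma>(1) by (intro arg_cong2[of _ _ _ _ "(+)"] sum.cong) auto
        also have "\<dots> = coeff_embed \<tau> * indet s + l \<gamma>"
          using step.hyps by (simp add: l_def sum.distrib algebra_simps)
        finally have "l (\<gamma>(s := \<tau>)) ^ M = (\<Sum>j\<le>M. of_nat (M choose j) * (coeff_embed \<tau> * indet s) ^ j * l \<gamma> ^ (M - j))"
          by (simp add: binomial_ring)
        moreover have "(coeff_embed \<tau> :: (nat, 'k) mpol) ^ j = coeff_embed (\<tau> ^ j)" for j
          by (induction j) (simp_all add: mult_single)
        ultimately have "l (\<gamma>(s := \<tau>)) ^ M * mon \<beta>' = (\<Sum>j\<le>M. coeff_embed (\<tau> ^ j) * u j)"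
          by (simp add: u_def power_mult_distrib sum_distrib_right sum_distrib_left mult_ac)
        moreover have "l (\<gamma>(s := \<tau>)) ^ M * mon \<beta>' \<in> W"
          unfolding M_def using step.IH[rule_format, of "\<gamma>(s := \<tau>)" \<beta>'] \<gamma>(1) \<tau> keys' deg \<beta>(2) by auto
        ultimately show ?thesis by simp
      qed
      from subspace_coefficients[OF W T this kM(1)] have "u k \<in> W" .
      then have "coeff_embed (1 / of_nat (M choose k)) * u k \<in> W" using W by (simp add: subspace_def)
      moreover have "coeff_embed (1 / of_nat (M choose k)) * u k = l \<gamma> ^ (m - mdeg \<beta>) * mon \<beta>"
      proof -
        have "of_nat (M choose k) = (coeff_embed (of_nat (M choose k)) :: (nat, 'k) mpol)" by simp
        then have "coeff_embed (1 / of_nat (M choose k)) * of_nat (M choose k) = (1 :: (nat, 'k) mpol)"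
          using kM(1) by (simp only: mult_single) simp
        then have "coeff_embed (1 / of_nat (M choose k)) * u k = indet s ^ k * l \<gamma> ^ (M - k) * mon \<beta>'"
          unfolding u_def by (simp only: mult.assoc[symmetric] mult_1_left)
        then show ?thesis
          unfolding kM(2) \<beta>_split mon_add by (simp add: mon_single_eq_power mult_ac)
      qed
      ultimately show "l \<gamma> ^ (m - mdeg \<beta>) * mon \<beta> \<in> W" by simp
    qed
  qed
  define \<beta> where "\<beta> = v - single (n - 2) (lookup v (n - 2)) - single (n - 1) t"
  let ?u = "single (n - 2) (lookup v (n - 2))"
  have v_split: "v = (?u + \<beta>) + single (n - 1) t"
    by (rule poly_mapping_eqI)
       (use v(2) n12 in \<open>auto simp: \<beta>_def lookup_add lookup_minus lookup_single when_def\<close>)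
  have "mdeg v = lookup v (n - 2) + mdeg \<beta> + t"
    using mdeg_add[of "?u + \<beta>" "single (n - 1) t"] mdeg_add[of ?u \<beta>]
    unfolding v_split[symmetric] by (simp add: mdeg_single)
  then have deg: "mdeg \<beta> \<le> m" "m - mdeg \<beta> = lookup v (n - 2)" using v(1) by (auto simp: exps_def)
  have "keys \<beta> \<subseteq> {0..<n - 2}"
  proof
    fix i assume "i \<in> keys \<beta>"
    then have "lookup v i \<noteq> 0" "i \<noteq> n - 2" "i \<noteq> n - 1"
      using v(2) by (auto simp: \<beta>_def in_keys_iff lookup_minus lookup_single when_def split: if_splits)
    moreover have "i \<in> keys v" using calculation(1) by (simp add: in_keys_iff)
    then have "i < n" using v(1) by (auto simp: exps_def)
    ultimately show "i \<in> {0..<n - 2}" by auto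
  qed
  moreover have "sheared (\<lambda>_. 0) = a0" by (auto simp: sheared_def)
  ultimately have "l (\<lambda>_. 0) ^ (m - mdeg \<beta>) * mon \<beta> \<in> W"
    using eliminate[of 0, rule_format, of "\<lambda>_. 0" \<beta>] a0 deg(1) by simp
  then have "mon (?u + \<beta>) \<in> W"
    unfolding deg(2) by (simp add: l_def mon_add mon_single_eq_power)
  then obtain r where r: "in_vars {..<n} r" "mon (?u + \<beta>) * ?x ^ t - ?x ^ Suc t * r \<in> ?K"
    unfolding W_def by blast
  have monv: "mon (?u + \<beta>) * ?x ^ t = mon v"
    by (simp only: mon_single_eq_power[symmetric] mon_add[symmetric] v_split[symmetric])
  \<comment> \<open>All monomials of \<open>x\<^sub>n\<^bsup>t+1\<^esup> r\<close> in the degree of \<open>v\<close> are smaller than \<open>v\<close>.\<close>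
  let ?q = "?x ^ Suc t * r"
  let ?f = "hom_component (m + t) (mon v - ?q)"
  have f: "?f \<in> ?K" using homogeneous_idealD(2)[OF K] r(2) monv by simp
  have q: "Suc t \<le> lookup k (n - 1)" if "k \<in> keys ?q" for k
  proof -
    have "k \<in> keys (single (single (n - 1) (Suc t)) 1 * r)"
      using that by (simp only: mon_single_eq_power[symmetric] mon_def)
    then show ?thesis using keys_single_times[of "single (n - 1) (Suc t)" 1 r] by (auto simp: lookup_add)
  qed
  have "lookup ?q v = 0" using q[of v] v(2) by (auto simp: in_keys_iff)
  then have vf: "v \<in> keys ?f"
    using v(1) by (simp add: in_keys_iff lookup_hom_component lookup_minus lookup_mon exps_def)
  have "lead_exp ?f = v"
  proof (rule lead_exp_eqI[OF vf])
    fix k assume k: "k \<in> keys ?f" "k \<noteq> v"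
    then have "k \<in> keys ?q" "mdeg k = m + t"
      by (auto simp: in_keys_iff lookup_hom_component lookup_minus lookup_mon split: if_splits)
    moreover have "keys k \<subseteq> {..<n}" using KD(1)[OF f] k(1) by (auto simp: in_vars_def)
    ultimately show "revlex_less k v"
      using n q[of k] v by (intro revlex_less_of_last_exponent[OF _ v(1)]) (auto simp: exps_def)
  qed
  moreover have "?f \<noteq> 0" using vf by auto
  ultimately have "v \<in> leads ?K" using leadsI[OF f] by simp
  then show ?thesis using F_leads[OF a0] by simp
qed

end

section \<open>The Lefschetz property and the reduction number in terms of the generic initial ideal\<close>

lemma gl_act_image_forms:
  assumes g: "g \<in> GL n"
  shows "gl_act n g ` forms n d = (forms n d :: (nat, 'k::field) mpol set)"
proof
  show "gl_act n g ` forms n d \<subseteq> forms n d" by (auto simp: gl_act_eq intro: coord_change_forms)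
  obtain h where h: "\<And>p. in_vars {..<n} p \<Longrightarrow> gl_act n g (gl_act n h p) = p"
    using GL_inverse[OF g] by metis
  show "forms n d \<subseteq> gl_act n g ` forms n d"
  proof
    fix p :: "(nat, 'k) mpol" assume p: "p \<in> forms n d"
    then have "gl_act n h p \<in> forms n d" by (simp add: gl_act_eq coord_change_forms)
    then show "p \<in> gl_act n g ` forms n d" using h[OF forms_in_vars[OF p]] by (metis imageI)
  qed
qed

lemma multiplication_transport:
  fixes I :: "(nat, 'k::field) mpol set"
  assumes I: "homogeneous_ideal n I" and g: "g \<in> GL n" and L: "L \<in> forms n 1"
    and gL: "gl_act n g L = indet (n - 1)"
  shows "(\<forall>p\<in>forms n d. L ^ i * p \<in> I \<longrightarrow> p \<in> I) \<longleftrightarrow>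
      (\<forall>p\<in>forms n d. mon (single (n - 1) i) * p \<in> gl_act n g ` I \<longrightarrow> p \<in> gl_act n g ` I)"
    and "(\<forall>q\<in>forms n e. \<exists>p\<in>forms n d. q - L ^ i * p \<in> I) \<longleftrightarrow>
      (\<forall>q\<in>forms n e. \<exists>p\<in>forms n d. q - mon (single (n - 1) i) * p \<in> gl_act n g ` I)"
proof -
  have Li: "in_vars {..<n} (L ^ i * p)" if "p \<in> forms n d" for p
    using forms_in_vars[OF L] forms_in_vars[OF that] by (intro in_vars_mult in_vars_power)
  have mult: "mon (single (n - 1) i) * gl_act n g p = gl_act n g (L ^ i * p)" for p
    using gL by (simp add: gl_act_eq coord_change_mult coord_change_power mon_single_eq_power)
  note mem = gl_act_mem_iff[OF I g]
  show "(\<forall>p\<in>forms n d. L ^ i * p \<in> I \<longrightarrow> p \<in> I) \<longleftrightarrow>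
      (\<forall>p\<in>forms n d. mon (single (n - 1) i) * p \<in> gl_act n g ` I \<longrightarrow> p \<in> gl_act n g ` I)"
  proof -
    have "(\<forall>p\<in>forms n d. mon (single (n - 1) i) * p \<in> gl_act n g ` I \<longrightarrow> p \<in> gl_act n g ` I) \<longleftrightarrow>
      (\<forall>p\<in>gl_act n g ` forms n d. mon (single (n - 1) i) * p \<in> gl_act n g ` I \<longrightarrow> p \<in> gl_act n g ` I)"
      by (simp only: gl_act_image_forms[OF g])
    also have "\<dots> \<longleftrightarrow> (\<forall>p\<in>forms n d. L ^ i * p \<in> I \<longrightarrow> p \<in> I)"
      unfolding ball_simps mult using mem[OF Li] mem[OF forms_in_vars] by blast
    finally show ?thesis by blast
  qed
  have diff: "gl_act n g q - mon (single (n - 1) i) * gl_act n g p \<in> gl_act n g ` I \<longleftrightarrow> q - L ^ i * p \<in> I"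
    if "q \<in> forms n e" "p \<in> forms n d" for p q
  proof -
    have "gl_act n g q - mon (single (n - 1) i) * gl_act n g p = gl_act n g (q - L ^ i * p)"
      unfolding mult by (simp add: gl_act_eq coord_change_diff)
    moreover have "in_vars {..<n} (q - L ^ i * p)"
      using forms_in_vars[OF that(1)] in_vars_uminus[OF Li[OF that(2)]] in_vars_add by fastforce
    ultimately show ?thesis using mem by simp
  qed
  have "(\<forall>q\<in>forms n e. \<exists>p\<in>forms n d. q - mon (single (n - 1) i) * p \<in> gl_act n g ` I) \<longleftrightarrow>
    (\<forall>q\<in>gl_act n g ` forms n e. \<exists>p\<in>gl_act n g ` forms n d. q - mon (single (n - 1) i) * p \<in> gl_act n g ` I)"
    by (simp only: gl_act_image_forms[OF g])
  also have "\<dots> \<longleftrightarrow> (\<forall>q\<in>forms n e. \<exists>p\<in>forms n d. q - L ^ i * p \<in> I)"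
    using diff by (simp add: ball_simps bex_simps)
  finally show "(\<forall>q\<in>forms n e. \<exists>p\<in>forms n d. q - L ^ i * p \<in> I) \<longleftrightarrow>
      (\<forall>q\<in>forms n e. \<exists>p\<in>forms n d. q - mon (single (n - 1) i) * p \<in> gl_act n g ` I)" by blast
qed

text \<open>Write a basis of the forms of degree \<open>d + 1\<close> as \<open>q\<^sub>i = b\<^sub>i + L0 p\<^sub>i\<close> with \<open>b\<^sub>i \<in> I\<close>.  The elements
  \<open>b\<^sub>i + L p\<^sub>i\<close> depend polynomially on \<open>L\<close>, so they are a basis for generic \<open>L\<close> as well.\<close>

lemma surjectivity_open:
  fixes I :: "(nat, 'k::field) mpol set"
  assumes I: "homogeneous_ideal n I" and L0: "L0 \<in> forms n 1"
    and sur: "\<forall>q\<in>forms n (d + 1). \<exists>p\<in>forms n d. q - L0 * p \<in> I"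
  obtains f where "polyfun {..<n} f" "f (\<lambda>i. lookup L0 (single i 1)) \<noteq> 0"
    "\<And>L. L \<in> forms n 1 \<Longrightarrow> f (\<lambda>i. lookup L (single i 1)) \<noteq> 0 \<Longrightarrow>
       \<forall>q\<in>forms n (d + 1). \<exists>p\<in>forms n d. q - L * p \<in> I"
proof -
  let ?e = "d + 1" and ?r = "card (exps n (d + 1))"
  have II: "ideal I (polyring n)" using I by (rule homogeneous_idealD)
  have "exps n ?e \<subseteq> leads (forms n ?e :: (nat, 'k) mpol set)"
    using forms_subset_iff_leads[OF subspace_forms, of n ?e n ?e] by blast
  then obtain q :: "nat \<Rightarrow> (nat, 'k) mpol" where q: "\<And>i. i < ?r \<Longrightarrow> q i \<in> forms n ?e"
    "indep_on (exps n ?e) ?r (\<lambda>i. lookup (q i))"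
    using leads_imp_indep[OF finite_exps, of n ?e "forms n ?e" "exps n ?e"] by blast
  have "\<forall>i. \<exists>p. i < ?r \<longrightarrow> p \<in> forms n d \<and> q i - L0 * p \<in> I" using q(1) sur by blast
  then obtain p where p: "\<And>i. i < ?r \<Longrightarrow> p i \<in> forms n d \<and> q i - L0 * p i \<in> I" by metis
  let ?l = "\<lambda>a. \<Sum>j<n. coeff_embed (a j) * indet j"
  let ?v = "\<lambda>a i. (q i - L0 * p i) + ?l a * p i"
  let ?c = "\<lambda>L i. lookup L (single i 1)"
  obtain f where f: "polyfun {..<n} f" "f (?c L0) \<noteq> 0"
    "\<And>a. f a \<noteq> 0 \<Longrightarrow> indep_on (exps n ?e) ?r (\<lambda>i. lookup (?v a i))"
  proof (rule indep_on_open[of ?r "exps n ?e" "{..<n}" "\<lambda>a i. lookup (?v a i)" "?c L0"])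
    show "polyfun {..<n} (\<lambda>a. lookup (?v a i) y)" for i y
      by (intro polyfun_lookup polyfun_mpol.add polyfun_mpol_mult polyfun_mpol_sum polyfun_mpol_const
          polyfun_mpol.single polyfun.var) auto
    show "indep_on (exps n ?e) ?r (\<lambda>i. lookup (?v (?c L0) i))"
      using q(2) unfolding linear_form_expand[OF L0, symmetric] by simp
  qed blast
  have "\<forall>q\<in>forms n ?e. \<exists>p\<in>forms n d. q - L * p \<in> I"
    if L: "L \<in> forms n 1" "f (?c L) \<noteq> 0" for L
  proof -
    define W where "W = {q \<in> forms n ?e. \<exists>p\<in>forms n d. q - L * p \<in> I}"
    have W: "subspace W"
      using subspace_linear_congruence[OF subspace_forms[of n ?e] subspace_forms[of n d] subspace_ideal[OF II], of 1 L]
      unfolding W_def mult_1_right .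
    have "?l (?c L) = L" using linear_form_expand[OF L(1)] by simp
    then have v: "?v (?c L) i = (q i - L0 * p i) + L * p i" for i by simp
    have "?v (?c L) i \<in> W" if i: "i < ?r" for i
    proof -
      have *: "q i \<in> forms n ?e" "p i \<in> forms n d" "q i - L0 * p i \<in> I" using q(1) p i by auto
      have "M * p i \<in> forms n ?e" if "M \<in> forms n 1" for M
        using forms_mult[OF *(2) that] by (simp add: mult.commute)
      then have "?v (?c L) i \<in> forms n ?e" unfolding v using * L0 L(1) by (intro forms_add forms_diff)
      moreover have "?v (?c L) i - L * p i \<in> I" unfolding v using *(3) by simp
      ultimately show ?thesis unfolding W_def using *(2) by blast
    qed
    then have "?r \<le> card (leads W \<inter> exps n ?e)"
      using f(3)[OF L(2)]
      by (intro indep_le_card_leads[where q = "?v (?c L)", OF W _ revlex_upset_all]) (auto simp: W_def)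
    then have "leads W \<inter> exps n ?e = exps n ?e" using finite_exps by (intro card_seteq) auto
    then have "forms n ?e \<subseteq> W" using forms_subset_iff_leads[OF W, of n ?e] by (auto simp: W_def)
    then show ?thesis unfolding W_def by blast
  qed
  then show ?thesis using that f(1,2) by blast
qed

context generic_leading_exponents
begin

lemma n_ge_1: "n \<ge> 1"
  using n by simp

lemma generic_linear_form:
  obtains g L where "g \<in> GL n" "leads (gl_act n g ` I) = E" "L \<in> forms n 1" "gl_act n g L = indet (n - 1)"
proof -
  obtain g where g: "g \<in> GL n" "leads (gl_act n g ` I) = E" using generic_point .
  have "(indet (n - 1) :: (nat, 'k) mpol) \<in> gl_act n g ` forms n 1"
    unfolding gl_act_image_forms[OF g(1)] using n by (intro forms_indet) simp
  then show ?thesis using that g by (metis imageE)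
qed

lemma forms_in_I_imp_exps: "forms n d \<subseteq> I \<Longrightarrow> exps n d \<subseteq> E"
proof -
  assume d: "forms n d \<subseteq> I"
  obtain g where g: "g \<in> GL n" "leads (gl_act n g ` I) = E" using generic_point .
  let ?K = "gl_act n g ` I"
  have K: "homogeneous_ideal n ?K" using gl_act_homogeneous_ideal[OF I g(1)] .
  have "forms n d \<subseteq> ?K \<inter> forms n d"
    using d gl_act_piece[OF I g(1), of d] gl_act_image_forms[OF g(1), of d] by (simp add: Int_absorb1)
  then have "exps n d \<subseteq> leads (?K \<inter> forms n d)"
    using forms_subset_iff_leads[of "?K \<inter> forms n d" n d] K
    by (simp add: subspace_ideal_piece homogeneous_idealD)
  then show ?thesis using leads_ideal_piece[OF K] g(2) by auto
qed

lemma high_degree_in_E: "\<exists>D. \<forall>d\<ge>D. exps n d \<subseteq> E"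
  using forms_in_I forms_in_I_imp_exps by blast

text \<open>The leading exponents of degree \<open>d + i\<close> divisible by \<open>x\<^sub>n\<^sup>i\<close> are the complement of those in an
  upward closed set, and the total number of leading exponents is the same in all coordinates.  So in
  generic coordinates there are as few of them as possible.  If multiplication by \<open>x\<^sub>n\<^sup>i\<close> is injective
  in the coordinates \<open>g\<close>, there are as many of them as leading exponents of degree \<open>d\<close>; then the same
  holds generically, and all of them are multiples of leading exponents of degree \<open>d\<close>.\<close>

lemma injectivity_transfer:
  assumes g: "g \<in> GL n"
    and inj: "\<forall>u\<in>exps n d. single (n - 1) i + u \<in> leads (gl_act n g ` I) \<longrightarrow> u \<in> leads (gl_act n g ` I)"
    and u: "u \<in> exps n d" "single (n - 1) i + u \<in> E"
  shows "u \<in> E"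
proof -
  let ?G = "leads (gl_act n g ` I)" and ?s = "single (n - 1) i" and ?e = "d + i"
  let ?Y = "{w \<in> exps n ?e. lookup w (n - 1) < i}" and ?T = "(+) ?s ` exps n d"
  have si: "?s \<in> exps n i" using n by (auto simp: exps_def mdeg_single)
  have T: "?T = {w \<in> exps n ?e. i \<le> lookup w (n - 1)}"
  proof
    show "?T \<subseteq> {w \<in> exps n ?e. i \<le> lookup w (n - 1)}"
      using exps_add[OF _ si, of _ d] by (auto simp: lookup_add add.commute)
    show "{w \<in> exps n ?e. i \<le> lookup w (n - 1)} \<subseteq> ?T"
    proof
      fix w assume w: "w \<in> {w \<in> exps n ?e. i \<le> lookup w (n - 1)}"
      have split: "w = ?s + (w - ?s)"
        by (rule poly_mapping_eqI) (use w in \<open>auto simp: lookup_add lookup_minus lookup_single when_def\<close>)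
      have "mdeg w = i + mdeg (w - ?s)" by (subst split) (simp add: mdeg_add mdeg_single)
      moreover have "keys (w - ?s) \<subseteq> keys w" by (auto simp: in_keys_iff lookup_minus)
      ultimately have "w - ?s \<in> exps n d" using w by (auto simp: exps_def)
      then show "w \<in> ?T" using split by blast
    qed
  qed
  have fin: "finite ?Y" "finite ?T" using finite_exps by auto
  have split: "card (A \<inter> exps n ?e) = card (A \<inter> ?Y) + card (A \<inter> ?T)" for A
  proof -
    have "A \<inter> exps n ?e = (A \<inter> ?Y) \<union> (A \<inter> ?T)" "(A \<inter> ?Y) \<inter> (A \<inter> ?T) = {}" unfolding T by auto
    then show ?thesis using fin by (simp add: card_Un_disjoint)
  qed
  have inj_add: "inj_on ((+) ?s) X" for X by (simp add: inj_on_def)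
  have "card (?G \<inter> ?Y) \<le> card (E \<inter> ?Y)"
    using leads_max[OF g revlex_upset_last_exponent[OF n_ge_1]] .
  moreover have "card (?G \<inter> exps n ?e) = card (E \<inter> exps n ?e)" using card_E_degree[OF g] .
  ultimately have "card (E \<inter> ?T) \<le> card (?G \<inter> ?T)" using split[of E] split[of ?G] by simp
  also have "?G \<inter> ?T \<subseteq> (+) ?s ` (?G \<inter> exps n d)" using inj by auto
  then have "card (?G \<inter> ?T) \<le> card ((+) ?s ` (?G \<inter> exps n d))"
    using finite_exps by (intro card_mono) auto
  also have "\<dots> = card (?G \<inter> exps n d)" by (intro card_image inj_add)
  also have "\<dots> = card ((+) ?s ` (E \<inter> exps n d))" using card_E_degree[OF g] by (simp add: card_image inj_add)
  finally have "card (E \<inter> ?T) \<le> card ((+) ?s ` (E \<inter> exps n d))" .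
  moreover have "(+) ?s ` (E \<inter> exps n d) \<subseteq> E \<inter> ?T" using E_add n by auto
  ultimately have "(+) ?s ` (E \<inter> exps n d) = E \<inter> ?T" using fin by (intro card_seteq) auto
  then have "?s + u \<in> (+) ?s ` (E \<inter> exps n d)" using u by blast
  then show ?thesis by auto
qed

lemma strong_lefschetz_iff_E:
  assumes proper: "I \<noteq> carrier (polyring n)"
  shows "strong_lefschetz n I \<longleftrightarrow> (\<forall>d. \<forall>i\<ge>1.
    (\<forall>u\<in>exps n d. single (n - 1) i + u \<in> E \<longrightarrow> u \<in> E) \<or>
    (\<forall>w\<in>exps n (d + i). lookup w (n - 1) < i \<longrightarrow> w \<in> E))"
    (is "_ \<longleftrightarrow> (\<forall>d. \<forall>i\<ge>1. ?inj d i \<or> ?sur d i)")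
proof -
  have II: "ideal I (polyring n)" using I by (rule homogeneous_idealD)
  let ?inj' = "\<lambda>L d i. \<forall>p\<in>forms n d. L ^ i * p \<in> I \<longrightarrow> p \<in> I"
  let ?sur' = "\<lambda>L d i. \<forall>q\<in>forms n (d + i). \<exists>p\<in>forms n d. q - L ^ i * p \<in> I"
  show ?thesis
    unfolding strong_lefschetz_iff[OF II]
  proof
    assume "\<exists>L\<in>forms n 1. \<forall>d. \<forall>i\<ge>1. ?inj' L d i \<or> ?sur' L d i"
    then obtain L0 where L0: "L0 \<in> forms n 1" "\<And>d i. i \<ge> 1 \<Longrightarrow> ?inj' L0 d i \<or> ?sur' L0 d i" by blast
    have "\<exists>L\<in>forms n 1. L \<noteq> 0 \<and> (\<forall>d. \<forall>i\<ge>1. ?inj' L d i \<or> ?sur' L d i)"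
    proof (cases "L0 = 0")
      case True
      \<comment> \<open>Multiplication by zero has maximal rank only if \<open>A\<close> is concentrated in degree zero.\<close>
      have one: "1 \<notin> I"
      proof
        assume "1 \<in> I"
        then have "in_vars {..<n} p \<Longrightarrow> p \<in> I" for p using polyring_idealD(4)[OF II, of p 1] by simp
        then show False using proper polyring_idealD(1)[OF II] by auto
      qed
      have pos: "forms n e \<subseteq> I" if "e \<ge> 1" for e
      proof -
        have "\<not> ?inj' L0 0 e"
          using True that one polyring_idealD(2)[OF II] forms_one[of n] by (auto simp: zero_power)
        then show ?thesis using L0(2)[OF that, of 0] True that by (auto simp: zero_power)
      qed
      have "?sur' (indet (n - 1)) d i" if "i \<ge> 1" for d i
        using pos[of "d + i"] that forms_zero by (auto intro!: bexI[of _ 0])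
      moreover have "(indet (n - 1) :: (nat, 'k) mpol) \<noteq> 0"
        by (metis indet_def mon_def keys_mon keys_zero insert_not_empty)
      ultimately show ?thesis using forms_indet[of "n - 1" n] n_ge_1 by (intro bexI[of _ "indet (n - 1)"]) auto
    qed (use L0 in blast)
    then obtain L where L: "L \<in> forms n 1" "L \<noteq> 0" "\<And>d i. i \<ge> 1 \<Longrightarrow> ?inj' L d i \<or> ?sur' L d i" by blast
    obtain g where g: "g \<in> GL n" "gl_act n g L = indet (n - 1)"
      using linear_form_to_last_variable[OF L(1,2)] .
    let ?K = "gl_act n g ` I"
    have K: "homogeneous_ideal n ?K" using gl_act_homogeneous_ideal[OF I g(1)] .
    show "\<forall>d. \<forall>i\<ge>1. ?inj d i \<or> ?sur d i"
    proof (intro allI impI)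
      fix d i :: nat assume i: "i \<ge> 1"
      from L(3)[OF i, of d] show "?inj d i \<or> ?sur d i"
      proof
        assume "?inj' L d i"
        then have "\<forall>u\<in>exps n d. single (n - 1) i + u \<in> leads ?K \<longrightarrow> u \<in> leads ?K"
          unfolding multiplication_transport(1)[OF I g(1) L(1) g(2)] last_power_injective_iff[OF K n_ge_1] .
        then show ?thesis using injectivity_transfer[OF g(1)] by blast
      next
        assume "?sur' L d i"
        then have "{w \<in> exps n (d + i). lookup w (n - 1) < i} \<subseteq> leads ?K"
          unfolding multiplication_transport(2)[OF I g(1) L(1) g(2)] last_power_surjective_iff[OF K n_ge_1]
          by blast
        then show ?thesis
          using upset_transfer[OF g(1) revlex_upset_last_exponent[OF n_ge_1]] by blast
      qed
    qed
  next
    assume R: "\<forall>d. \<forall>i\<ge>1. ?inj d i \<or> ?sur d i"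
    obtain g L where g: "g \<in> GL n" "leads (gl_act n g ` I) = E" "L \<in> forms n 1" "gl_act n g L = indet (n - 1)"
      using generic_linear_form .
    have K: "homogeneous_ideal n (gl_act n g ` I)" using gl_act_homogeneous_ideal[OF I g(1)] .
    have "?inj' L d i \<or> ?sur' L d i" if "i \<ge> 1" for d i
      using R that unfolding multiplication_transport[OF I g(1,3,4)]
        last_power_injective_iff[OF K n_ge_1] last_power_surjective_iff[OF K n_ge_1] g(2) by blast
    then show "\<exists>L\<in>forms n 1. \<forall>d. \<forall>i\<ge>1. ?inj' L d i \<or> ?sur' L d i" using g(3) by blast
  qed
qed

text \<open>By \<open>surjectivity_open\<close> the degrees from which on \<open>A / L A\<close> vanishes are as small as possible for
  generic \<open>L\<close>, and by \<open>upset_transfer\<close> this minimum is attained by \<open>x\<^sub>n\<close> in generic coordinates.\<close>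

lemma reduction_number_eq:
  "reduction_number n I = (LEAST t. \<forall>w\<in>exps n (t + 1). lookup w (n - 1) = 0 \<longrightarrow> w \<in> E)"
    (is "_ = (LEAST t. ?R t)")
proof -
  let ?P = "\<lambda>L t. \<forall>q\<in>forms n (t + 1). \<exists>p\<in>forms n t. q - L * p \<in> I"
  let ?f = "\<lambda>L. LEAST t. quot_piece n (I <+>\<^bsub>polyring n\<^esub> cgenideal (polyring n) L) (t + 1) =
    {\<zero>\<^bsub>polyring n Quot (I <+>\<^bsub>polyring n\<^esub> cgenideal (polyring n) L)\<^esub>}"
  have f: "?f L = (LEAST t. ?P L t)" if "L \<in> forms n 1" for L
    by (simp only: ideal_plus_form_piece[OF I that])
  define r where "r = (LEAST t. ?R t)"
  have "\<exists>t. ?R t" using high_degree_in_E by (metis le_add1 subsetD)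
  then have Rr: "?R r" unfolding r_def by (rule LeastI_ex)
  have P_iff: "?P L t \<longleftrightarrow> (\<forall>w\<in>exps n (t + 1). lookup w (n - 1) < 1 \<longrightarrow> w \<in> leads (gl_act n g ` I))"
    if "g \<in> GL n" "L \<in> forms n 1" "gl_act n g L = indet (n - 1)" for g L t
    using multiplication_transport(2)[OF I that, of "t + 1" t 1]
      last_power_surjective_iff[OF gl_act_homogeneous_ideal[OF I that(1)] n_ge_1, of t 1] by simp
  have P_imp_R: "?R t" if L: "L \<in> forms n 1" and P: "?P L t" for L t
  proof (cases "L = 0")
    case True
    then have "forms n (t + 1) \<subseteq> I" using P by auto
    then show ?thesis using forms_in_I_imp_exps by blast
  next
    case False
    then obtain g where g: "g \<in> GL n" "gl_act n g L = indet (n - 1)"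
      using linear_form_to_last_variable[OF L] by blast
    have "{w \<in> exps n (t + 1). lookup w (n - 1) < 1} \<subseteq> leads (gl_act n g ` I)"
      using P P_iff[OF g(1) L g(2), of t] by blast
    from upset_transfer[OF g(1) revlex_upset_last_exponent[OF n_ge_1] this] show ?thesis by auto
  qed
  obtain g L0 where g: "g \<in> GL n" "leads (gl_act n g ` I) = E" "L0 \<in> forms n 1" "gl_act n g L0 = indet (n - 1)"
    using generic_linear_form .
  have "?P L0 r" using Rr P_iff[OF g(1,3,4), of r] g(2) by simp
  then obtain h where h: "polyfun {..<n} h" "h (\<lambda>i. lookup L0 (single i 1)) \<noteq> 0"
    "\<And>L. L \<in> forms n 1 \<Longrightarrow> h (\<lambda>i. lookup L (single i 1)) \<noteq> 0 \<Longrightarrow> ?P L r"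
    using surjectivity_open[OF I g(3)] by blast
  have generic: "general_linear_form n (\<lambda>L. ?f L = r)"
  proof (rule holds_generically_principal[where f = h and x = L0])
    show "polyfun {..<n} h" "L0 \<in> forms n 1" "h (\<lambda>i. lookup L0 (single i 1)) \<noteq> 0" by (fact h(1) g(3) h(2))+
    fix L assume L: "L \<in> forms n 1" "h (\<lambda>i. lookup L (single i 1)) \<noteq> 0"
    have "(LEAST t. ?P L t) = r"
    proof (rule Least_equality)
      show "?P L r" using h(3)[OF L] .
      show "r \<le> t" if "?P L t" for t unfolding r_def using P_imp_R[OF L(1) that] by (rule Least_le)
    qed
    then show "?f L = r" using f[OF L(1)] by simp
  qed
  have "reduction_number n I = (THE r. general_linear_form n (\<lambda>L. ?f L = r))"
    unfolding reduction_number_def Let_def by (simp only: eq_commute)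
  also have "\<dots> = r"
  proof (rule generic_value_eq[OF generic polyfun.const[of _ 1]])
    show "\<exists>L\<in>forms n 1. \<forall>j\<in>{..<n}. lookup L (single j 1) = a j" for a :: "nat \<Rightarrow> 'k"
      by (intro bexI[of _ "\<Sum>i<n. coeff_embed (a i) * indet i"] forms_sum forms_scale forms_indet)
         (auto simp: linear_form_lookup[unfolded One_nat_def])
  qed simp
  finally show ?thesis unfolding r_def .
qed

end

section \<open>Comparison of the chains of standard monomials\<close>

lemma lookup_nth_list: "lookup (Poly_Mapping.nth xs) i = (if i < length xs then xs ! i else 0)"
  by (simp add: nth_default_def)

lemma keys_nth_list: "keys (Poly_Mapping.nth (xs :: nat list)) \<subseteq> {..<length xs}"
proof
  fix i assume "i \<in> keys (Poly_Mapping.nth xs)"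
  then have "lookup (Poly_Mapping.nth xs) i \<noteq> 0" by (simp only: in_keys_iff) simp
  then show "i \<in> {..<length xs}" unfolding lookup_nth_list by (auto split: if_splits)
qed

lemma keys_nth_list_subset: "length xs \<le> n \<Longrightarrow> keys (Poly_Mapping.nth (xs :: nat list)) \<subseteq> {..<n}"
  by (rule order.trans[OF keys_nth_list]) simp

lemma nth_zeros: "Poly_Mapping.nth (replicate k (0::nat)) = 0"
  by (rule poly_mapping_eqI) (simp add: nth_default_def)

lemma mdeg_nth_list: "mdeg (Poly_Mapping.nth xs) = sum_list xs"
  unfolding mdeg_superset[OF finite_lessThan keys_nth_list] sum_list_sum_nth
  by (intro sum.cong) (auto simp: nth_default_def)

lemma exps_nth_list: "length xs \<le> n \<Longrightarrow> Poly_Mapping.nth xs \<in> exps n (sum_list xs)"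
  using keys_nth_list[of xs] by (auto simp: exps_def mdeg_nth_list simp del: keys_nth)

lemma nth_list_snoc:
  "Poly_Mapping.nth (xs @ [t]) = Poly_Mapping.nth xs + single (length xs) (t :: nat)"
  by (rule poly_mapping_eqI) (auto simp: lookup_add lookup_single nth_default_def nth_append when_def)

lemma exps_as_list:
  assumes "w \<in> exps n d"
  shows "w = Poly_Mapping.nth (map (lookup w) [0..<n])"
proof (rule poly_mapping_eqI)
  fix i
  have "i \<notin> keys w" if "\<not> i < n" using assms that by (auto simp: exps_def)
  then show "lookup w i = lookup (Poly_Mapping.nth (map (lookup w) [0..<n])) i"
    unfolding lookup_nth_list by (auto simp: in_keys_iff)
qed

text \<open>Each \<open>x \<in> A\<close> with \<open>\<phi> x > 0\<close> stands for an interval of \<open>\<phi> x\<close> degrees beginning at \<open>deg x\<close>, and \<open>b m\<close>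
  is the longest one that begins at \<open>m\<close>.  If every interval ends no earlier than the longest one of the
  next degree, this applies to \<open>b m\<close> and \<open>b (m + 1)\<close> as well, and so extends to all higher degrees.\<close>

lemma interval_comparison:
  fixes \<phi> :: "'a \<Rightarrow> nat" and deg :: "'a \<Rightarrow> nat" and b :: "nat \<Rightarrow> 'a"
  assumes b: "\<And>m. b m \<in> A" "\<And>m. deg (b m) = m"
    and b_max: "\<And>x. x \<in> A \<Longrightarrow> \<phi> x \<le> \<phi> (b (deg x))"
    and b_mono: "\<And>m m'. m \<le> m' \<Longrightarrow> \<phi> (b m) = 0 \<Longrightarrow> \<phi> (b m') = 0"
    and r: "\<phi> (b (r + 1)) = 0" "\<And>t. t < r \<Longrightarrow> \<phi> (b (t + 1)) > 0"
  shows "(\<forall>x\<in>A. \<forall>y\<in>A. \<phi> x > 0 \<longrightarrow> \<phi> y > 0 \<longrightarrow> deg x < deg y \<longrightarrow> deg y + \<phi> y \<le> deg x + \<phi> x) \<longleftrightarrow>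
    (\<forall>x\<in>A. \<phi> x > 0 \<longrightarrow> deg x + \<phi> x \<ge> r + 1 \<and> \<phi> x \<ge> \<phi> (b (deg x + 1)) + 1)" (is "?L \<longleftrightarrow> ?R")
proof
  assume L: ?L
  have deg_le: "deg x \<le> r" if x: "x \<in> A" "\<phi> x > 0" for x
    using b_mono[of "r + 1" "deg x"] r(1) b_max[OF x(1)] x(2) by fastforce
  show ?R
  proof (intro ballI impI conjI)
    fix x assume x: "x \<in> A" "\<phi> x > 0"
    show "deg x + \<phi> x \<ge> r + 1"
    proof (cases "deg x < r")
      case True
      then have "\<phi> (b r) > 0" using r(2)[of "r - 1"] by simp
      then show ?thesis using L x b[of r] True by fastforce
    next
      case False
      then show ?thesis using x(2) by simp
    qed
    show "\<phi> x \<ge> \<phi> (b (deg x + 1)) + 1"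
    proof (cases "\<phi> (b (deg x + 1)) = 0")
      case True
      then show ?thesis using x(2) by simp
    next
      case False
      then show ?thesis using L x b[of "deg x + 1"] by fastforce
    qed
  qed
next
  assume R: ?R
  show ?L
  proof (intro ballI impI)
    fix x y assume x: "x \<in> A" "\<phi> x > 0" and y: "y \<in> A" "\<phi> y > 0" "deg x < deg y"
    have "deg x + \<phi> x \<ge> m + \<phi> (b m)" if m: "deg x < m" "\<phi> (b m) > 0" for m
      using that
    proof (induction m)
      case (Suc m)
      show ?case
      proof (cases "deg x = m")
        case True
        then show ?thesis using R x by fastforce
      next
        case False
        have "\<phi> (b m) > 0" using b_mono[of m "Suc m"] Suc.prems(2) by fastforce
        then have "m + \<phi> (b m) \<le> deg x + \<phi> x" "\<phi> (b m) \<ge> \<phi> (b (m + 1)) + 1"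
          using Suc False R b[of m] by auto
        then show ?thesis by simp
      qed
    qed simp
    from this[OF y(3)] b_max[OF y(1)] y(2) show "deg y + \<phi> y \<le> deg x + \<phi> x" by simp
  qed
qed

context generic_leading_exponents
begin

lemma in_E_mono:
  assumes "m \<in> E" "keys m' \<subseteq> {..<n}" "\<And>i. lookup m i \<le> lookup m' i"
  shows "m' \<in> E"
proof -
  have "(m' - m) + m = m'"
    using assms(3) by (intro poly_mapping_eqI) (simp add: lookup_add lookup_minus)
  moreover have "keys (m' - m) \<subseteq> keys m'" by (auto simp: in_keys_iff lookup_minus)
  then have "keys (m' - m) \<subseteq> {..<n}" using assms(2) by blast
  ultimately show ?thesis using E_add[OF assms(1), of "m' - m"] by simp
qed

lemma gin_f_le_iff:
  assumes "length \<alpha> < n"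
  shows "gin_f n I \<alpha> \<le> t \<longleftrightarrow> Poly_Mapping.nth (\<alpha> @ [t]) \<in> E"
proof
  have up: "Poly_Mapping.nth (\<alpha> @ [t']) \<in> E" if "Poly_Mapping.nth (\<alpha> @ [t]) \<in> E" "t \<le> t'" for t t'
  proof (rule in_E_mono[OF that(1)])
    show "keys (Poly_Mapping.nth (\<alpha> @ [t'])) \<subseteq> {..<n}" using assms by (intro keys_nth_list_subset) simp
    show "lookup (Poly_Mapping.nth (\<alpha> @ [t])) i \<le> lookup (Poly_Mapping.nth (\<alpha> @ [t'])) i" for i
      unfolding lookup_nth_list using that(2) by (auto simp: nth_append)
  qed
  obtain D where D: "\<And>d. d \<ge> D \<Longrightarrow> exps n d \<subseteq> E" using high_degree_in_E by blast
  have "Poly_Mapping.nth (\<alpha> @ [D]) \<in> exps n (sum_list (\<alpha> @ [D]))" using assms by (intro exps_nth_list) simp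
  then have "Poly_Mapping.nth (\<alpha> @ [D]) \<in> E" using D[of "sum_list (\<alpha> @ [D])"] by auto
  then have "Poly_Mapping.nth (\<alpha> @ [gin_f n I \<alpha>]) \<in> E"
    unfolding gin_f_def mon_in_gin_iff by (rule LeastI)
  then show "Poly_Mapping.nth (\<alpha> @ [t]) \<in> E" if "gin_f n I \<alpha> \<le> t" using up that by blast
  show "gin_f n I \<alpha> \<le> t" if "Poly_Mapping.nth (\<alpha> @ [t]) \<in> E"
    unfolding gin_f_def mon_in_gin_iff using that by (rule Least_le)
qed

lemma gin_J_iff:
  "\<alpha> \<in> gin_J n I (n - 1) \<longleftrightarrow> length \<alpha> = n - 1 \<and> gin_f n I \<alpha> > 0"
proof -
  have zero: "Poly_Mapping.nth (xs @ [0]) = Poly_Mapping.nth xs" for xs :: "nat list"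
    by (rule poly_mapping_eqI) (auto simp: nth_default_def nth_append)
  have pos: "gin_f n I \<alpha> > 0 \<longleftrightarrow> Poly_Mapping.nth \<alpha> \<notin> E" if "length \<alpha> = n - 1"
    using gin_f_le_iff[of \<alpha> 0] that n unfolding zero by auto
  have step: "\<alpha> ! j < gin_f n I (take j \<alpha>) \<longleftrightarrow> Poly_Mapping.nth (take (Suc j) \<alpha>) \<notin> E"
    if "length \<alpha> = n - 1" "j < n - 1" for j
  proof -
    have "length (take j \<alpha>) < n" using that by simp
    then show ?thesis
      using gin_f_le_iff[of "take j \<alpha>" "\<alpha> ! j"] that take_Suc_conv_app_nth[of j \<alpha>] by auto
  qed
  have "(\<forall>j<n - 1. Poly_Mapping.nth (take (Suc j) \<alpha>) \<notin> E) \<longleftrightarrow> Poly_Mapping.nth \<alpha> \<notin> E"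
    if len: "length \<alpha> = n - 1"
  proof
    assume "\<forall>j<n - 1. Poly_Mapping.nth (take (Suc j) \<alpha>) \<notin> E"
    then have "Poly_Mapping.nth (take (Suc (n - 2)) \<alpha>) \<notin> E" using n by auto
    moreover have "Suc (n - 2) = n - 1" using n by auto
    ultimately show "Poly_Mapping.nth \<alpha> \<notin> E" using len by simp
  next
    assume *: "Poly_Mapping.nth \<alpha> \<notin> E"
    have "Poly_Mapping.nth \<alpha> \<in> E" if "Poly_Mapping.nth (take k \<alpha>) \<in> E" for k
    proof (rule in_E_mono[OF that])
      show "keys (Poly_Mapping.nth \<alpha>) \<subseteq> {..<n}" using len by (intro keys_nth_list_subset) simp
      show "lookup (Poly_Mapping.nth (take k \<alpha>)) i \<le> lookup (Poly_Mapping.nth \<alpha>) i" for i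
        unfolding lookup_nth_list by auto
    qed
    then show "\<forall>j<n - 1. Poly_Mapping.nth (take (Suc j) \<alpha>) \<notin> E" using * by blast
  qed
  then show ?thesis unfolding gin_J_def using pos step by auto
qed

abbreviation last_tuple :: "nat \<Rightarrow> nat list" where
  "last_tuple m \<equiv> replicate (n - 2) 0 @ [m]"

lemma gin_f_le_last_tuple:
  assumes "length \<alpha> = n - 1"
  shows "gin_f n I \<alpha> \<le> gin_f n I (last_tuple (sum_list \<alpha>))"
proof -
  let ?m = "sum_list \<alpha>" and ?t = "gin_f n I (last_tuple (sum_list \<alpha>))"
  have "Poly_Mapping.nth (last_tuple ?m @ [?t]) \<in> E"
    using gin_f_le_iff[of "last_tuple ?m" ?t] n by simp
  moreover have "Poly_Mapping.nth (last_tuple ?m @ [?t]) = single (n - 2) ?m + single (n - 1) ?t"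
  proof -
    have "Suc (n - 2) = n - 1" using n by simp
    then show ?thesis unfolding nth_list_snoc by (simp add: nth_zeros)
  qed
  ultimately have w: "single (n - 2) ?m + single (n - 1) ?t \<in> E" by simp
  have "Poly_Mapping.nth (\<alpha> @ [?t]) \<in> exps n (?m + ?t)"
    using exps_nth_list[of "\<alpha> @ [?t]" n] assms n by simp
  moreover have "lookup (Poly_Mapping.nth (\<alpha> @ [?t])) (n - 1) = ?t"
    unfolding lookup_nth_list using assms n by (simp add: nth_append)
  ultimately have "Poly_Mapping.nth (\<alpha> @ [?t]) \<in> E" using E_stable[OF w] by blast
  then show ?thesis using gin_f_le_iff[of \<alpha> ?t] assms n by simp
qed

lemma sum_list_last_tuple: "sum_list (last_tuple m) = m"
  by (simp add: sum_list_replicate)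

lemma length_last_tuple: "length (last_tuple m) = n - 1"
  using n by simp

lemma gin_f_last_tuple_mono:
  assumes "m \<le> m'" "gin_f n I (last_tuple m) = 0"
  shows "gin_f n I (last_tuple m') = 0"
proof -
  have "Poly_Mapping.nth (last_tuple m @ [0]) \<in> E"
    using gin_f_le_iff[of "last_tuple m" 0] assms(2) n by simp
  then have "Poly_Mapping.nth (last_tuple m' @ [0]) \<in> E"
  proof (rule in_E_mono)
    show "keys (Poly_Mapping.nth (last_tuple m' @ [0])) \<subseteq> {..<n}"
      using n by (intro keys_nth_list_subset) simp
    show "lookup (Poly_Mapping.nth (last_tuple m @ [0])) i \<le> lookup (Poly_Mapping.nth (last_tuple m' @ [0])) i" for i
      unfolding lookup_nth_list using assms(1) by (auto simp: nth_append nth_Cons split: nat.split)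
  qed
  then show ?thesis using gin_f_le_iff[of "last_tuple m'" 0] n by simp
qed

text \<open>A monomial that is not divisible by \<open>x\<^sub>n\<close> lies in \<open>gin I\<close> exactly if its chain is empty, and \<open>(0, \<dots>, 0, m)\<close>
  has the longest chain among the monomials of degree \<open>m\<close>.\<close>

lemma reduction_number_last_tuple:
  "reduction_number n I = (LEAST t. gin_f n I (last_tuple (t + 1)) = 0)"
proof -
  have "(\<forall>w\<in>exps n (t + 1). lookup w (n - 1) = 0 \<longrightarrow> w \<in> E) \<longleftrightarrow> gin_f n I (last_tuple (t + 1)) = 0" for t
  proof
    let ?b = "Poly_Mapping.nth (last_tuple (t + 1) @ [0])"
    assume "\<forall>w\<in>exps n (t + 1). lookup w (n - 1) = 0 \<longrightarrow> w \<in> E"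
    moreover have "?b \<in> exps n (t + 1)"
      using exps_nth_list[of "last_tuple (t + 1) @ [0]" n] n by (simp add: sum_list_replicate)
    moreover have "lookup ?b (n - 1) = 0" unfolding lookup_nth_list using n by (simp add: nth_append)
    ultimately show "gin_f n I (last_tuple (t + 1)) = 0" using gin_f_le_iff[of "last_tuple (t + 1)" 0] n by simp
  next
    assume z: "gin_f n I (last_tuple (t + 1)) = 0"
    show "\<forall>w\<in>exps n (t + 1). lookup w (n - 1) = 0 \<longrightarrow> w \<in> E"
    proof (intro ballI impI)
      fix w assume w: "w \<in> exps n (t + 1)" "lookup w (n - 1) = 0"
      let ?\<alpha> = "map (lookup w) [0..<n - 1]"
      have wl: "w = Poly_Mapping.nth (?\<alpha> @ [0])"
      proof -
        have "map (lookup w) [0..<n] = ?\<alpha> @ [0]"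
          using w(2) n by (cases n) auto
        then show ?thesis using exps_as_list[OF w(1)] by simp
      qed
      have "sum_list (?\<alpha> @ [0]) = t + 1" using w(1) mdeg_nth_list[of "?\<alpha> @ [0]"] wl by (simp add: exps_def)
      then have "sum_list ?\<alpha> = t + 1" by simp
      then have "gin_f n I ?\<alpha> \<le> 0" using gin_f_le_last_tuple[of ?\<alpha>] z by simp
      then show "w \<in> E" using gin_f_le_iff[of ?\<alpha> 0] n wl by simp
    qed
  qed
  then show ?thesis unfolding reduction_number_eq by simp
qed

text \<open>\<open>x\<^sub>n\<^sup>i\<close> fails to be injective in degree \<open>d\<close> exactly if a chain through degree \<open>d\<close> ends before
  degree \<open>d + i\<close>, and fails to be surjective exactly if a chain through degree \<open>d + i\<close> begins after
  degree \<open>d\<close>.  Both happen for some \<open>d\<close> and \<open>i\<close> exactly if a chain begins and ends after another one;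
  the critical choice is the first degree of the lower and the last degree of the upper chain.\<close>

lemma maximal_rank_iff_chains:
  "(\<forall>d. \<forall>i\<ge>1. (\<forall>u\<in>exps n d. single (n - 1) i + u \<in> E \<longrightarrow> u \<in> E) \<or>
      (\<forall>w\<in>exps n (d + i). lookup w (n - 1) < i \<longrightarrow> w \<in> E)) \<longleftrightarrow>
   (\<forall>\<alpha>\<in>{\<alpha>. length \<alpha> = n - 1}. \<forall>\<beta>\<in>{\<alpha>. length \<alpha> = n - 1}. gin_f n I \<alpha> > 0 \<longrightarrow> gin_f n I \<beta> > 0 \<longrightarrow>
      sum_list \<alpha> < sum_list \<beta> \<longrightarrow> sum_list \<beta> + gin_f n I \<beta> \<le> sum_list \<alpha> + gin_f n I \<alpha>)"
    (is "?L \<longleftrightarrow> ?R")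
proof -
  let ?m = "\<lambda>(\<alpha> :: nat list) t. Poly_Mapping.nth (\<alpha> @ [t])" and ?f = "gin_f n I"
  have mE: "?m \<alpha> t \<in> E \<longleftrightarrow> ?f \<alpha> \<le> t" if "length \<alpha> = n - 1" for \<alpha> t
    using gin_f_le_iff[of \<alpha> t] that n by auto
  have m_exps: "?m \<alpha> t \<in> exps n (sum_list \<alpha> + t)" if "length \<alpha> = n - 1" for \<alpha> t
    using exps_nth_list[of "\<alpha> @ [t]" n] that n by simp
  have m_last: "lookup (?m \<alpha> t) (n - 1) = t" if "length \<alpha> = n - 1" for \<alpha> t
    unfolding lookup_nth_list using that n by (simp add: nth_append)
  have m_mult: "single (n - 1) i + ?m \<alpha> t = ?m \<alpha> (t + i)" if "length \<alpha> = n - 1" for \<alpha> t i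
    unfolding nth_list_snoc using that by (simp add: single_add add_ac)
  have m_cases: "\<exists>\<alpha> t. length \<alpha> = n - 1 \<and> u = ?m \<alpha> t \<and> d = sum_list \<alpha> + t" if u: "u \<in> exps n d" for u d
  proof -
    have "map (lookup u) [0..<n] = map (lookup u) [0..<n - 1] @ [lookup u (n - 1)]" using n by (cases n) auto
    then have "u = ?m (map (lookup u) [0..<n - 1]) (lookup u (n - 1))" using exps_as_list[OF u] by simp
    moreover from this have "d = sum_list (map (lookup u) [0..<n - 1]) + lookup u (n - 1)"
      using u mdeg_nth_list[of "map (lookup u) [0..<n - 1] @ [lookup u (n - 1)]"] by (simp add: exps_def)
    ultimately show ?thesis by (metis length_map length_upt minus_nat.diff_0)
  qed
  show ?thesis
  proof
    assume L: ?L
    show ?R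
    proof (intro ballI impI, rule ccontr)
      fix \<alpha> \<beta> assume len: "\<alpha> \<in> {\<alpha>. length \<alpha> = n - 1}" "\<beta> \<in> {\<alpha>. length \<alpha> = n - 1}"
        and pos: "?f \<alpha> > 0" "?f \<beta> > 0" and less: "sum_list \<alpha> < sum_list \<beta>"
        and "\<not> sum_list \<beta> + ?f \<beta> \<le> sum_list \<alpha> + ?f \<alpha>"
      then have gt: "sum_list \<alpha> + ?f \<alpha> < sum_list \<beta> + ?f \<beta>" by simp
      \<comment> \<open>\<open>?d\<close> is the first degree of the chain of \<open>\<alpha>\<close>, \<open>?d + ?i\<close> the last one of the chain of \<open>\<beta>\<close>.\<close>
      let ?d = "sum_list \<alpha>" and ?i = "sum_list \<beta> + ?f \<beta> - 1 - sum_list \<alpha>"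
      have i: "?i \<ge> 1" "?d + ?i = sum_list \<beta> + (?f \<beta> - 1)" using less pos by auto
      have u: "?m \<alpha> 0 \<in> exps n ?d" "single (n - 1) ?i + ?m \<alpha> 0 \<in> E" "?m \<alpha> 0 \<notin> E"
        using m_exps[of \<alpha> 0] m_mult[of \<alpha> ?i 0] mE[of \<alpha>] len pos gt by auto
      have w: "?m \<beta> (?f \<beta> - 1) \<in> exps n (?d + ?i)" "lookup (?m \<beta> (?f \<beta> - 1)) (n - 1) < ?i" "?m \<beta> (?f \<beta> - 1) \<notin> E"
        using m_exps[of \<beta> "?f \<beta> - 1"] m_last[of \<beta> "?f \<beta> - 1"] mE[of \<beta> "?f \<beta> - 1"] len pos less
        unfolding i(2) by auto
      show False using L i(1) u w by blast
    qed
  next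
    assume R: ?R
    show ?L
    proof (intro allI impI, rule ccontr)
      fix d i :: nat assume "i \<ge> 1"
        and "\<not> ((\<forall>u\<in>exps n d. single (n - 1) i + u \<in> E \<longrightarrow> u \<in> E) \<or>
          (\<forall>w\<in>exps n (d + i). lookup w (n - 1) < i \<longrightarrow> w \<in> E))"
      then obtain u w where u: "u \<in> exps n d" "single (n - 1) i + u \<in> E" "u \<notin> E"
        and w: "w \<in> exps n (d + i)" "lookup w (n - 1) < i" "w \<notin> E" by blast
      obtain \<alpha> s where \<alpha>: "length \<alpha> = n - 1" "u = ?m \<alpha> s" "d = sum_list \<alpha> + s" using m_cases[OF u(1)] by blast
      obtain \<beta> t where \<beta>: "length \<beta> = n - 1" "w = ?m \<beta> t" "d + i = sum_list \<beta> + t" using m_cases[OF w(1)] by blast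
      have "s < ?f \<alpha>" "?f \<alpha> \<le> s + i" using u(2,3) \<alpha> mE[OF \<alpha>(1)] m_mult[OF \<alpha>(1)] by auto
      moreover have "t < ?f \<beta>" "t < i" using w(2,3) \<beta> mE[OF \<beta>(1)] m_last[OF \<beta>(1)] by auto
      ultimately show False using R[rule_format, of \<alpha> \<beta>] \<alpha> \<beta> by auto
    qed
  qed
qed

lemma strong_lefschetz_criterion:
  assumes "I \<noteq> carrier (polyring n)"
  shows "strong_lefschetz n I \<longleftrightarrow>
    (\<forall>\<alpha> \<in> gin_J n I (n - 1).
       sum_list \<alpha> + gin_f n I \<alpha> \<ge> reduction_number n I + 1 \<and>
       gin_f n I \<alpha> \<ge> gin_f n I (last_tuple (sum_list \<alpha> + 1)) + 1)"
proof -
  let ?r = "reduction_number n I"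
  obtain D where D: "\<And>d. d \<ge> D \<Longrightarrow> exps n d \<subseteq> E" using high_degree_in_E by blast
  have "gin_f n I (last_tuple (D + 1)) = 0"
    using gin_f_le_iff[of "last_tuple (D + 1)" 0] exps_nth_list[of "last_tuple (D + 1) @ [0]" n] D[of "D + 1"] n
    by (auto simp: sum_list_replicate)
  then have r0: "gin_f n I (last_tuple (?r + 1)) = 0"
    unfolding reduction_number_last_tuple by (rule LeastI)
  have r1: "gin_f n I (last_tuple (t + 1)) > 0" if "t < ?r" for t
    using not_less_Least[of t "\<lambda>t. gin_f n I (last_tuple (t + 1)) = 0"] that
    unfolding reduction_number_last_tuple by simp
  have "strong_lefschetz n I \<longleftrightarrow> (\<forall>\<alpha>\<in>{\<alpha>. length \<alpha> = n - 1}. gin_f n I \<alpha> > 0 \<longrightarrow>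
      sum_list \<alpha> + gin_f n I \<alpha> \<ge> ?r + 1 \<and> gin_f n I \<alpha> \<ge> gin_f n I (last_tuple (sum_list \<alpha> + 1)) + 1)"
    unfolding strong_lefschetz_iff_E[OF assms] maximal_rank_iff_chains
  proof (rule interval_comparison)
    show "last_tuple m \<in> {\<alpha>. length \<alpha> = n - 1}" "sum_list (last_tuple m) = m" for m
      using length_last_tuple sum_list_last_tuple by auto
    show "gin_f n I \<alpha> \<le> gin_f n I (last_tuple (sum_list \<alpha>))" if "\<alpha> \<in> {\<alpha>. length \<alpha> = n - 1}" for \<alpha>
      using gin_f_le_last_tuple that by simp
    show "gin_f n I (last_tuple m') = 0" if "m \<le> m'" "gin_f n I (last_tuple m) = 0" for m m'
      using gin_f_last_tuple_mono that .
  qed (fact r0 r1)+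
  then show ?thesis using gin_J_iff by auto
qed

end

theorem theorem3p7:
  fixes n :: nat and I :: "(nat, 'k::field_char_0) mpol set"
  assumes "n \<ge> 2"
    and "homogeneous_ideal n I"
    and "I \<noteq> carrier (polyring n)"
    and "artinian (polyring n Quot I)"
  shows "strong_lefschetz n I \<longleftrightarrow>
    (\<forall>\<alpha> \<in> gin_J n I (n - 1).
       sum_list \<alpha> + gin_f n I \<alpha> \<ge> reduction_number n I + 1 \<and>
       gin_f n I \<alpha> \<ge> gin_f n I (replicate (n - 2) 0 @ [sum_list \<alpha> + 1]) + 1)"
proof -
  obtain D where D: "\<And>d. d \<ge> D \<Longrightarrow> forms n d \<subseteq> I"
    using artinian_imp_contains_forms[OF assms(2,4)] by blast
  obtain F E where FE: "polyfun ({..<n} \<times> {..<n}) F" "\<exists>a. F a \<noteq> 0"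
    "\<And>a. F a \<noteq> 0 \<Longrightarrow> mat n n a \<in> GL n"
    "\<And>a. F a \<noteq> 0 \<Longrightarrow> leads (gl_act n (mat n n a) ` I) = E"
    "\<And>g d Y. g \<in> GL n \<Longrightarrow> revlex_upset n d Y \<Longrightarrow> card (leads (gl_act n g ` I) \<inter> Y) \<le> card (E \<inter> Y)"
    using generic_leads[OF assms(2) D] by blast
  interpret generic_leading_exponents n I F E
    using assms(1,2) D FE by unfold_locales blast+
  show ?thesis using assms(3) by (rule strong_lefschetz_criterion)
qed

end
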